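(* Let $G=A_5\simeq\mathrm{PSL}_2(\mathbb{F}_4)$ and $H\simeq V_4$. There is a flabby resolution $0\to J_{G/H}\to P\to F\to0$ with $\mathrm{rank}_{\mathbb{Z}}F=21$ such that there is an isomorphism of $A_5$-lattices $$\mathbb{Z}[A_5/C_5]\oplus\mathbb{Z}[A_5/A_4]^{\oplus2}\simeq\mathbb{Z}\oplus F$$ (rank $22$). In particular $F$ is stably permutation.
   Context: A $G$-lattice is a finitely generated $\mathbb{Z}[G]$-module free over $\mathbb{Z}$. A permutation $G$-lattice is one isomorphic to $\bigoplus_i\mathbb{Z}[G/H_i]$; $\mathbb{Z}$ is the trivial lattice. Stably permutation: $M\oplus P\simeq P'$ with $P,P'$ permutation. $F$ is flabby if $\widehat H^{-1}(H',F)=0$ for all subgroups $H'\le G$. A flabby resolution of $M$ is an exact sequence $0\to M\to P\to F\to0$ with $P$ permutation and $F$ flabby. For $H\le G$, the Chevalley module $J_{G/H}=\mathrm{Hom}_{\mathbb{Z}}(I_{G/H},\mathbb{Z})$ where $I_{G/H}=\ker(\mathbb{Z}[G/H]\to\mathbb{Z})$; $0\to\mathbb{Z}\to\mathbb{Z}[G/H]\to J_{G/H}\to0$ is exact. $V_4=C_2\times C_2$. Subgroups $C_5$, $A_4$ of $A_5$ are unique up to conjugacy. *)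

theory Defs
  imports "HOL-Algebra.Sym_Groups" "HOL-Algebra.Elementary_Groups" "Jordan_Normal_Form.Matrix"
begin

text \<open>A G-lattice of rank n is represented by an integral representation
  rho : G -> GL_n(Z), i.e. Z^n with a Z[G]-action given by integer matrices.\<close>

type_synonym 'g lat = "nat \<times> ('g \<Rightarrow> int mat)"

definition G_lattice :: "('g, 'b) monoid_scheme \<Rightarrow> 'g lat \<Rightarrow> bool" where
  "G_lattice G M \<longleftrightarrow>
     (\<forall>g\<in>carrier G. snd M g \<in> carrier_mat (fst M) (fst M)) \<and>
     (\<forall>g\<in>carrier G. \<forall>h\<in>carrier G. snd M (g \<otimes>\<^bsub>G\<^esub> h) = snd M g * snd M h) \<and>
     snd M \<one>\<^bsub>G\<^esub> = 1\<^sub>m (fst M)"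

definition lat_hom :: "('g, 'b) monoid_scheme \<Rightarrow> 'g lat \<Rightarrow> 'g lat \<Rightarrow> int mat \<Rightarrow> bool" where
  "lat_hom G M N A \<longleftrightarrow> A \<in> carrier_mat (fst N) (fst M) \<and>
     (\<forall>g\<in>carrier G. A * snd M g = snd N g * A)"

definition lat_iso :: "('g, 'b) monoid_scheme \<Rightarrow> 'g lat \<Rightarrow> 'g lat \<Rightarrow> bool" where
  "lat_iso G M N \<longleftrightarrow> (\<exists>A B. lat_hom G M N A \<and> lat_hom G N M B \<and>
     A * B = 1\<^sub>m (fst N) \<and> B * A = 1\<^sub>m (fst M))"

definition lat_dsum :: "'g lat \<Rightarrow> 'g lat \<Rightarrow> 'g lat" where
  "lat_dsum M N = (fst M + fst N,
     \<lambda>g. four_block_mat (snd M g) (0\<^sub>m (fst M) (fst N)) (0\<^sub>m (fst N) (fst M)) (snd N g))"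

definition lat_zero :: "'g lat" where
  "lat_zero = (0, \<lambda>g. 1\<^sub>m 0)"

fun lat_dsum_list :: "'g lat list \<Rightarrow> 'g lat" where
  "lat_dsum_list [] = lat_zero"
| "lat_dsum_list (M # Ms) = lat_dsum M (lat_dsum_list Ms)"

definition lat_triv :: "'g lat" where
  "lat_triv = (1, \<lambda>g. 1\<^sub>m 1)"

definition perm_lat_of :: "'x set \<Rightarrow> ('g \<Rightarrow> 'x \<Rightarrow> 'x) \<Rightarrow> 'g lat" where
  "perm_lat_of X act = (let xs = (SOME xs. set xs = X \<and> distinct xs) in
     (length xs, \<lambda>g. mat (length xs) (length xs)
        (\<lambda>(i, j). if act g (xs ! j) = xs ! i then 1 else 0)))"

definition coset_lat :: "('g, 'b) monoid_scheme \<Rightarrow> 'g set \<Rightarrow> 'g lat" where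
  "coset_lat G H = perm_lat_of {a <#\<^bsub>G\<^esub> H | a. a \<in> carrier G} (\<lambda>g S. g <#\<^bsub>G\<^esub> S)"

definition perm_lattice :: "('g, 'b) monoid_scheme \<Rightarrow> 'g lat \<Rightarrow> bool" where
  "perm_lattice G M \<longleftrightarrow> G_lattice G M \<and>
     (\<exists>Hs. (\<forall>H\<in>set Hs. subgroup H G) \<and> lat_iso G M (lat_dsum_list (map (coset_lat G) Hs)))"

definition stably_perm :: "('g, 'b) monoid_scheme \<Rightarrow> 'g lat \<Rightarrow> bool" where
  "stably_perm G M \<longleftrightarrow> (\<exists>P P'. perm_lattice G P \<and> perm_lattice G P' \<and>
     lat_iso G (lat_dsum M P) P')"

text \<open>Tate cohomology H^-1(H',F) = ker(N_H') / I_H' F vanishes.\<close>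
definition tate_minus1_zero :: "('g, 'b) monoid_scheme \<Rightarrow> 'g set \<Rightarrow> 'g lat \<Rightarrow> bool" where
  "tate_minus1_zero G H' F \<longleftrightarrow>
     (\<forall>x\<in>carrier_vec (fst F).
        (\<forall>i<fst F. (\<Sum>h\<in>H'. (snd F h *\<^sub>v x) $ i) = 0) \<longrightarrow>
        (\<exists>y. (\<forall>h\<in>H'. y h \<in> carrier_vec (fst F)) \<and>
             (\<forall>i<fst F. x $ i = (\<Sum>h\<in>H'. (snd F h *\<^sub>v y h) $ i - y h $ i))))"

definition flabby :: "('g, 'b) monoid_scheme \<Rightarrow> 'g lat \<Rightarrow> bool" where
  "flabby G F \<longleftrightarrow> G_lattice G F \<and> (\<forall>H'. subgroup H' G \<longrightarrow> tate_minus1_zero G H' F)"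

definition short_exact :: "('g, 'b) monoid_scheme \<Rightarrow> 'g lat \<Rightarrow> int mat \<Rightarrow> 'g lat \<Rightarrow> int mat \<Rightarrow> 'g lat \<Rightarrow> bool" where
  "short_exact G M A P B F \<longleftrightarrow>
     G_lattice G M \<and> G_lattice G P \<and> G_lattice G F \<and>
     lat_hom G M P A \<and> lat_hom G P F B \<and>
     (\<forall>u\<in>carrier_vec (fst M). A *\<^sub>v u = 0\<^sub>v (fst P) \<longrightarrow> u = 0\<^sub>v (fst M)) \<and>
     (\<forall>w\<in>carrier_vec (fst F). \<exists>v\<in>carrier_vec (fst P). B *\<^sub>v v = w) \<and>
     (\<forall>v\<in>carrier_vec (fst P). B *\<^sub>v v = 0\<^sub>v (fst F) \<longleftrightarrow> (\<exists>u\<in>carrier_vec (fst M). A *\<^sub>v u = v))"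

definition flabby_resolution :: "('g, 'b) monoid_scheme \<Rightarrow> 'g lat \<Rightarrow> int mat \<Rightarrow> 'g lat \<Rightarrow> int mat \<Rightarrow> 'g lat \<Rightarrow> bool" where
  "flabby_resolution G M A P B F \<longleftrightarrow> short_exact G M A P B F \<and> perm_lattice G P \<and> flabby G F"

definition aug_kernel :: "('g, 'b) monoid_scheme \<Rightarrow> 'g set \<Rightarrow> 'g lat \<Rightarrow> int mat \<Rightarrow> bool" where
  "aug_kernel G H I \<iota> \<longleftrightarrow> G_lattice G I \<and> lat_hom G I (coset_lat G H) \<iota> \<and>
     (\<forall>u\<in>carrier_vec (fst I). \<iota> *\<^sub>v u = 0\<^sub>v (fst (coset_lat G H)) \<longrightarrow> u = 0\<^sub>v (fst I)) \<and>
     (\<forall>v\<in>carrier_vec (fst (coset_lat G H)).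
        (\<Sum>i<fst (coset_lat G H). v $ i) = 0 \<longleftrightarrow> (\<exists>u\<in>carrier_vec (fst I). \<iota> *\<^sub>v u = v))"

text \<open>Dual lattice Hom_Z(M,Z), (g phi)(m) = phi(g^-1 m), in the dual basis.\<close>
definition lat_dual :: "('g, 'b) monoid_scheme \<Rightarrow> 'g lat \<Rightarrow> 'g lat" where
  "lat_dual G M = (fst M, \<lambda>g. transpose_mat (snd M (inv\<^bsub>G\<^esub> g)))"

definition aug_ideal :: "('g, 'b) monoid_scheme \<Rightarrow> 'g set \<Rightarrow> 'g lat" where
  "aug_ideal G H = (SOME I. \<exists>\<iota>. aug_kernel G H I \<iota>)"

definition chevalley_J :: "('g, 'b) monoid_scheme \<Rightarrow> 'g set \<Rightarrow> 'g lat" where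
  "chevalley_J G H = lat_dual G (aug_ideal G H)"

end

theory Submission
  imports Defs
begin

text \<open>With \<open>G = A\<^sub>5\<close> there is an exact complex of permutation lattices
  \<open>0 \<rightarrow> \<int> \<rightarrow> \<int>[G/V\<^sub>4] \<rightarrow> \<int>[G/V\<^sub>4] \<oplus> \<int>[G/C\<^sub>3] \<rightarrow> \<int>[G/C\<^sub>5] \<oplus> \<int>[G/A\<^sub>4] \<oplus> \<int>[G/A\<^sub>4] \<rightarrow> \<int> \<rightarrow> 0\<close>
  whose last map is the augmentation with weights \<open>(1, -4, -3)\<close>. Exactness is certified by a
  (non-equivariant) contracting homotopy. Since \<open>12 * 3 - 5 * 4 - 5 * 3 = 1\<close>, the last map has the invariant
  section with weights \<open>(3, 1, 1)\<close>, so its kernel \<open>F\<close> of rank 21 satisfies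
  \<open>\<int> \<oplus> F \<simeq> \<int>[G/C\<^sub>5] \<oplus> \<int>[G/A\<^sub>4] \<oplus> \<int>[G/A\<^sub>4]\<close>; being a direct summand of a permutation lattice,
  \<open>F\<close> is flabby. The cokernel of the first map is the Chevalley module, which gives the resolution.
  Arbitrary subgroups \<open>V\<^sub>4\<close>, \<open>C\<^sub>5\<close>, \<open>A\<^sub>4\<close> are recognized as stabilizers: the first two are centralizers of
  suitable elements, the last fixes a point.\<close>

section \<open>Permutation lattices with an explicit basis\<close>

text \<open>The subgroups in the statement are known only up to isomorphism, and
  \<open>coset_lat\<close> and \<open>aug_ideal\<close> pick their bases by \<open>SOME\<close>. The
  computation therefore takes place in fixed bases indexed by the points of explicit conjugacy
  orbits; permutation matrices and one-sided inverses carry the result over to whatever basis was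
  picked. Equivariance of the differentials is built into their construction from orbits on pairs,
  so the contracting homotopy has to satisfy integer matrix identities only: exactness concerns the
  underlying abelian groups. The trivial summand splits off because the last map takes the values
  12, -20 and -15 on the three orbit sums, and these are coprime; (3, 1, 1) is one solution of the
  resulting Bezout equation. The ranks fit since 15 - 1 = 14, 35 - 14 = 21 and 22 - 1 = 21.\<close>

definition acts_on :: "('g, 'b) monoid_scheme \<Rightarrow> ('g \<Rightarrow> 'x \<Rightarrow> 'x) \<Rightarrow> 'x set \<Rightarrow> bool" where
  "acts_on G act X \<longleftrightarrow> (\<forall>g\<in>carrier G. \<forall>x\<in>X. act g x \<in> X) \<and> (\<forall>x\<in>X. act \<one>\<^bsub>G\<^esub> x = x) \<and>
     (\<forall>g\<in>carrier G. \<forall>h\<in>carrier G. \<forall>x\<in>X. act (g \<otimes>\<^bsub>G\<^esub> h) x = act g (act h x))"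

text \<open>Entries are indexed by points instead of positions: a product becomes a sum over points,
  and a linear map between permutation lattices is equivariant when its kernel function is constant
  along the diagonal action.\<close>

definition kmat :: "('y \<Rightarrow> 'x \<Rightarrow> int) \<Rightarrow> 'y list \<Rightarrow> 'x list \<Rightarrow> int mat" where
  "kmat F ys xs = mat (length ys) (length xs) (\<lambda>(i, j). F (ys ! i) (xs ! j))"

text \<open>The order of the basis is explicit here, where \<open>perm_lat_of\<close> leaves it to
  \<open>SOME\<close>.\<close>

definition list_lat :: "'x list \<Rightarrow> ('g \<Rightarrow> 'x \<Rightarrow> 'x) \<Rightarrow> 'g lat" where
  "list_lat xs act = (length xs, \<lambda>g. kmat (\<lambda>y x. of_bool (act g x = y)) xs xs)"

lemma acts_onD:
  assumes "acts_on G act X"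
  shows "g \<in> carrier G \<Longrightarrow> x \<in> X \<Longrightarrow> act g x \<in> X"
    and "x \<in> X \<Longrightarrow> act \<one>\<^bsub>G\<^esub> x = x"
    and "g \<in> carrier G \<Longrightarrow> h \<in> carrier G \<Longrightarrow> x \<in> X \<Longrightarrow> act (g \<otimes>\<^bsub>G\<^esub> h) x = act g (act h x)"
  using assms by (auto simp: acts_on_def)

lemma acts_on_inv:
  assumes "group G" "acts_on G act X" "g \<in> carrier G" "x \<in> X"
  shows "act (inv\<^bsub>G\<^esub> g) (act g x) = x" "act g (act (inv\<^bsub>G\<^esub> g) x) = x"
proof -
  interpret group G by fact
  show "act (inv\<^bsub>G\<^esub> g) (act g x) = x"
    using acts_onD(3)[OF assms(2), of "inv\<^bsub>G\<^esub> g" g x] acts_onD(2)[OF assms(2)] assms by simp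
  show "act g (act (inv\<^bsub>G\<^esub> g) x) = x"
    using acts_onD(3)[OF assms(2), of g "inv\<^bsub>G\<^esub> g" x] acts_onD(2)[OF assms(2)] assms by simp
qed

lemma acts_on_eq_iff:
  assumes "group G" "acts_on G act X" "g \<in> carrier G" "x \<in> X" "y \<in> X"
  shows "act g x = y \<longleftrightarrow> x = act (inv\<^bsub>G\<^esub> g) y"
  using acts_on_inv[OF assms(1,2,3)] assms(4,5) by metis

lemma acts_on_subset: "acts_on G act X \<Longrightarrow> Y \<subseteq> X \<Longrightarrow> (\<And>g y. g \<in> carrier G \<Longrightarrow> y \<in> Y \<Longrightarrow> act g y \<in> Y) \<Longrightarrow> acts_on G act Y"
  unfolding acts_on_def by blast

lemma acts_on_Un: "acts_on G act X \<Longrightarrow> acts_on G act Y \<Longrightarrow> acts_on G act (X \<union> Y)"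
  unfolding acts_on_def by blast

lemma kmat_carrier [simp]: "kmat F ys xs \<in> carrier_mat (length ys) (length xs)"
  by (simp add: kmat_def)

lemma kmat_dim [simp]: "dim_row (kmat F ys xs) = length ys" "dim_col (kmat F ys xs) = length xs"
  by (simp_all add: kmat_def)

lemma kmat_index [simp]: "i < length ys \<Longrightarrow> j < length xs \<Longrightarrow> kmat F ys xs $$ (i, j) = F (ys ! i) (xs ! j)"
  by (simp add: kmat_def)

lemma kmat_cong:
  "(\<And>y x. y \<in> set ys \<Longrightarrow> x \<in> set xs \<Longrightarrow> F y x = G y x) \<Longrightarrow> kmat F ys xs = kmat G ys xs"
  by (auto simp: kmat_def intro!: cong_mat)

lemma sum_nth_distinct:
  fixes f :: "'x \<Rightarrow> int"
  assumes "distinct xs"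
  shows "(\<Sum>k<length xs. f (xs ! k)) = (\<Sum>x\<in>set xs. f x)"
  using sum.reindex_bij_betw[OF bij_betw_nth[OF assms refl refl], of f] by simp

lemma kmat_mult:
  assumes "distinct ys"
  shows "kmat F zs ys * kmat G ys xs = kmat (\<lambda>z x. \<Sum>y\<in>set ys. F z y * G y x) zs xs"
proof (rule eq_matI)
  fix i j assume *: "i < dim_row (kmat (\<lambda>z x. \<Sum>y\<in>set ys. F z y * G y x) zs xs)"
    "j < dim_col (kmat (\<lambda>z x. \<Sum>y\<in>set ys. F z y * G y x) zs xs)"
  then have "(kmat F zs ys * kmat G ys xs) $$ (i, j)
      = (\<Sum>k<length ys. F (zs ! i) (ys ! k) * G (ys ! k) (xs ! j))"
    by (simp add: scalar_prod_def atLeast0LessThan)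
  also have "\<dots> = (\<Sum>y\<in>set ys. F (zs ! i) y * G y (xs ! j))"
    by (rule sum_nth_distinct[OF assms])
  finally show "(kmat F zs ys * kmat G ys xs) $$ (i, j)
      = kmat (\<lambda>z x. \<Sum>y\<in>set ys. F z y * G y x) zs xs $$ (i, j)"
    using * by simp
qed auto

lemma kmat_mult_graph:
  assumes "distinct ys" "\<And>x. x \<in> set xs \<Longrightarrow> f x \<in> set ys"
  shows "kmat F zs ys * kmat (\<lambda>y x. of_bool (f x = y)) ys xs = kmat (\<lambda>z x. F z (f x)) zs xs"
  unfolding kmat_mult[OF assms(1)]
  by (rule kmat_cong) (use assms(2) in \<open>simp add: of_bool_def if_distrib[where f="\<lambda>x. _ * x"] cong: if_cong\<close>)

text \<open>The relation \<open>P\<close> stays abstract so that the rule covers the matrix of a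
  group element, where \<open>act g y = z\<close> has to be read as \<open>y\<close> being the image
  of \<open>z\<close> under the inverse of \<open>g\<close>.\<close>

lemma kmat_graph_mult:
  assumes "distinct ys" "\<And>z. z \<in> set zs \<Longrightarrow> f z \<in> set ys"
    and "\<And>z y. z \<in> set zs \<Longrightarrow> y \<in> set ys \<Longrightarrow> P z y \<longleftrightarrow> y = f z"
  shows "kmat (\<lambda>z y. of_bool (P z y)) zs ys * kmat F ys xs = kmat (\<lambda>z x. F (f z) x) zs xs"
  unfolding kmat_mult[OF assms(1)]
proof (rule kmat_cong)
  fix z x assume z: "z \<in> set zs"
  have "(\<Sum>y\<in>set ys. of_bool (P z y) * F y x) = (\<Sum>y\<in>set ys. if y = f z then F y x else 0)"
    by (rule sum.cong) (auto simp: assms(3)[OF z])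
  then show "(\<Sum>y\<in>set ys. of_bool (P z y) * F y x) = F (f z) x"
    using assms(2)[OF z] by simp
qed

lemma kmat_one: "distinct xs \<Longrightarrow> kmat (\<lambda>y x. of_bool (x = y)) xs xs = 1\<^sub>m (length xs)"
  by (rule eq_matI) (auto simp: nth_eq_iff_index_eq)

lemma kmat_transpose: "transpose_mat (kmat F ys xs) = kmat (\<lambda>x y. F y x) xs ys"
  by (rule eq_matI) auto

lemma fst_list_lat [simp]: "fst (list_lat xs act) = length xs"
  by (simp add: list_lat_def)

lemma G_lattice_list_lat:
  assumes "acts_on G act (set xs)" "distinct xs"
  shows "G_lattice G (list_lat xs act)"
  unfolding G_lattice_def
proof (intro conjI ballI)
  fix g h assume gh: "g \<in> carrier G" "h \<in> carrier G"
  show "snd (list_lat xs act) (g \<otimes>\<^bsub>G\<^esub> h) = snd (list_lat xs act) g * snd (list_lat xs act) h"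
    using acts_onD[OF assms(1)] gh
    by (simp add: list_lat_def kmat_mult_graph[OF assms(2)] cong: kmat_cong)
next
  show "snd (list_lat xs act) \<one>\<^bsub>G\<^esub> = 1\<^sub>m (fst (list_lat xs act))"
    using acts_onD(2)[OF assms(1)]
    by (simp add: list_lat_def kmat_one[OF assms(2), symmetric] cong: kmat_cong)
qed (simp add: list_lat_def)

lemma lat_hom_kmat:
  assumes "group G" "acts_on G act (set xs)" "acts_on G act' (set ys)" "distinct xs" "distinct ys"
    and F: "\<And>g y x. g \<in> carrier G \<Longrightarrow> y \<in> set ys \<Longrightarrow> x \<in> set xs \<Longrightarrow> F (act' g y) (act g x) = F y x"
  shows "lat_hom G (list_lat xs act) (list_lat ys act') (kmat F ys xs)"
  unfolding lat_hom_def
proof (intro conjI ballI)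
  interpret group G by fact
  fix g assume g: "g \<in> carrier G"
  have "kmat F ys xs * snd (list_lat xs act) g = kmat (\<lambda>y x. F y (act g x)) ys xs"
    using acts_onD(1)[OF assms(2) g] by (simp add: list_lat_def kmat_mult_graph[OF assms(4)])
  \<comment> \<open>Invariance is applied to the pair formed by \<open>x\<close> and the translate
    of \<open>y\<close> by the inverse of \<open>g\<close>; this moves the action from the columns
    to the rows.\<close>
  also have "\<dots> = kmat (\<lambda>y x. F (act' (inv\<^bsub>G\<^esub> g) y) x) ys xs"
  proof (rule kmat_cong)
    fix y x assume yx: "y \<in> set ys" "x \<in> set xs"
    show "F y (act g x) = F (act' (inv\<^bsub>G\<^esub> g) y) x"
      using F[of g "act' (inv\<^bsub>G\<^esub> g) y" x] g yx acts_onD(1)[OF assms(3), of "inv\<^bsub>G\<^esub> g" y]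
      by (simp add: acts_on_inv[OF assms(1,3)])
  qed
  also have "\<dots> = snd (list_lat ys act') g * kmat F ys xs"
    unfolding list_lat_def snd_conv
    by (rule kmat_graph_mult[symmetric])
      (use assms(5) g acts_onD(1)[OF assms(3)] acts_on_eq_iff[OF assms(1,3)] in auto)
  finally show "kmat F ys xs * snd (list_lat xs act) g = snd (list_lat ys act') g * kmat F ys xs" .
qed simp

lemma kmat_bij:
  assumes "distinct xs" "distinct ys" "bij_betw f (set xs) (set ys)"
  shows "kmat (\<lambda>y x. of_bool (f x = y)) ys xs * kmat (\<lambda>x y. of_bool (f x = y)) xs ys = 1\<^sub>m (length ys)"
    and "kmat (\<lambda>x y. of_bool (f x = y)) xs ys * kmat (\<lambda>y x. of_bool (f x = y)) ys xs = 1\<^sub>m (length xs)"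
proof -
  have f: "x \<in> set xs \<Longrightarrow> f x \<in> set ys" for x
    using assms(3) by (auto simp: bij_betw_def)
  show "kmat (\<lambda>x y. of_bool (f x = y)) xs ys * kmat (\<lambda>y x. of_bool (f x = y)) ys xs = 1\<^sub>m (length xs)"
    unfolding kmat_one[OF assms(1), symmetric]
    by (subst kmat_mult_graph[OF assms(2)])
      (use assms(3) f in \<open>auto simp: bij_betw_def inj_on_def intro!: kmat_cong\<close>)
  show "kmat (\<lambda>y x. of_bool (f x = y)) ys xs * kmat (\<lambda>x y. of_bool (f x = y)) xs ys = 1\<^sub>m (length ys)"
    unfolding kmat_one[OF assms(2), symmetric]
    by (subst kmat_graph_mult[where f="inv_into (set xs) f"])
      (use assms in \<open>auto simp: bij_betw_def inv_into_into f_inv_into_f intro!: kmat_cong\<close>)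
qed

lemma lat_homs_bij:
  assumes "group G" "acts_on G act (set xs)" "acts_on G act' (set ys)" "distinct xs" "distinct ys"
    and "bij_betw f (set xs) (set ys)"
    and "\<And>g x. g \<in> carrier G \<Longrightarrow> x \<in> set xs \<Longrightarrow> f (act g x) = act' g (f x)"
  shows "lat_hom G (list_lat xs act) (list_lat ys act') (kmat (\<lambda>y x. of_bool (f x = y)) ys xs)"
    and "lat_hom G (list_lat ys act') (list_lat xs act) (kmat (\<lambda>x y. of_bool (f x = y)) xs ys)"
proof -
  have iff: "act' g (f x) = act' g y \<longleftrightarrow> f x = y"
    if "g \<in> carrier G" "x \<in> set xs" "y \<in> set ys" for g x y
  proof -
    have "f x \<in> set ys" using assms(6) that(2) by (auto simp: bij_betw_def)
    then show ?thesis
      using acts_on_inv(1)[OF assms(1,3) that(1,3)] acts_on_inv(1)[OF assms(1,3) that(1), of "f x"]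
      by metis
  qed
  show "lat_hom G (list_lat xs act) (list_lat ys act') (kmat (\<lambda>y x. of_bool (f x = y)) ys xs)"
    by (rule lat_hom_kmat[OF assms(1-5)]) (simp add: assms(7) iff)
  show "lat_hom G (list_lat ys act') (list_lat xs act) (kmat (\<lambda>x y. of_bool (f x = y)) xs ys)"
    by (rule lat_hom_kmat[OF assms(1,3,2,5,4)]) (simp add: assms(7) iff)
qed

lemma lat_iso_bij:
  assumes "group G" "acts_on G act (set xs)" "acts_on G act' (set ys)" "distinct xs" "distinct ys"
    and "bij_betw f (set xs) (set ys)"
    and "\<And>g x. g \<in> carrier G \<Longrightarrow> x \<in> set xs \<Longrightarrow> f (act g x) = act' g (f x)"
  shows "lat_iso G (list_lat xs act) (list_lat ys act')"
  unfolding lat_iso_def fst_list_lat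
  using lat_homs_bij[of G act xs act' ys f, OF assms] kmat_bij[OF assms(4-6)] by blast

lemma perm_lat_of_eq_list_lat:
  assumes "finite X"
  obtains xs where "set xs = X" "distinct xs" "perm_lat_of X act = list_lat xs act"
proof
  let ?xs = "SOME xs. set xs = X \<and> distinct xs"
  show "set ?xs = X" "distinct ?xs"
    using someI_ex[OF finite_distinct_list[OF assms]] by auto
  show "perm_lat_of X act = list_lat ?xs act"
    by (simp add: perm_lat_of_def list_lat_def kmat_def of_bool_def Let_def)
qed

section \<open>Isomorphisms and direct sums\<close>

lemma lat_iso_sym: "lat_iso G M N \<Longrightarrow> lat_iso G N M"
  unfolding lat_iso_def by blast

lemma G_lattice_carrier: "G_lattice G M \<Longrightarrow> g \<in> carrier G \<Longrightarrow> snd M g \<in> carrier_mat (fst M) (fst M)"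
  by (simp add: G_lattice_def)

lemma lat_hom_comp:
  assumes "lat_hom G L M A" "lat_hom G M N B" "G_lattice G L" "G_lattice G M" "G_lattice G N"
  shows "lat_hom G L N (B * A)"
  unfolding lat_hom_def
proof (intro conjI ballI)
  have A: "A \<in> carrier_mat (fst M) (fst L)" and B: "B \<in> carrier_mat (fst N) (fst M)"
    using assms by (auto simp: lat_hom_def)
  then show "B * A \<in> carrier_mat (fst N) (fst L)" by simp
  fix g assume g: "g \<in> carrier G"
  note c = G_lattice_carrier[OF assms(3) g] G_lattice_carrier[OF assms(4) g] G_lattice_carrier[OF assms(5) g]
  have "B * A * snd L g = B * (snd M g * A)"
    using assms(1) g assoc_mult_mat[OF B A c(1)] by (simp add: lat_hom_def)
  also have "\<dots> = snd N g * B * A"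
    using assms(2) g assoc_mult_mat[OF B c(2) A] by (simp add: lat_hom_def)
  finally show "B * A * snd L g = snd N g * (B * A)"
    using assoc_mult_mat[OF c(3) B A] by simp
qed

lemma mult_one_cancel_mid:
  fixes A :: "int mat"
  assumes "A \<in> carrier_mat n m" "B \<in> carrier_mat m k" "C \<in> carrier_mat k m" "D \<in> carrier_mat m n"
    "B * C = 1\<^sub>m m" "A * D = 1\<^sub>m n"
  shows "(A * B) * (C * D) = 1\<^sub>m n"
proof -
  have "(A * B) * (C * D) = A * ((B * C) * D)"
    using assms(1-4) by (simp add: assoc_mult_mat[of _ n m _ k _ n] assoc_mult_mat[of _ m k _ m _ n])
  then show ?thesis using assms by simp
qed

lemma lat_iso_trans:
  assumes "lat_iso G L M" "lat_iso G M N" "G_lattice G L" "G_lattice G M" "G_lattice G N"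
  shows "lat_iso G L N"
proof -
  obtain A B C D where h: "lat_hom G L M A" "lat_hom G M L B" "A * B = 1\<^sub>m (fst M)" "B * A = 1\<^sub>m (fst L)"
    "lat_hom G M N C" "lat_hom G N M D" "C * D = 1\<^sub>m (fst N)" "D * C = 1\<^sub>m (fst M)"
    using assms(1,2) unfolding lat_iso_def by blast
  have "C * A * (B * D) = 1\<^sub>m (fst N)" "B * D * (C * A) = 1\<^sub>m (fst L)"
    using h by (auto intro!: mult_one_cancel_mid simp: lat_hom_def)
  then show ?thesis
    unfolding lat_iso_def
    using lat_hom_comp[OF h(1,5) assms(3,4,5)] lat_hom_comp[OF h(6,2) assms(5,4,3)] by blast
qed

text \<open>Action functions are arbitrary off the carrier, so lattices with the same action need
  not be equal. The identity matrix is then an isomorphism.\<close>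

lemma lat_iso_cong:
  assumes "fst M = fst N" "\<And>g. g \<in> carrier G \<Longrightarrow> snd M g = snd N g" "G_lattice G N"
  shows "lat_iso G M N"
  unfolding lat_iso_def lat_hom_def
  by (rule exI[of _ "1\<^sub>m (fst N)"], rule exI[of _ "1\<^sub>m (fst N)"])
    (use assms G_lattice_carrier[OF assms(3)] in
      \<open>auto simp: left_mult_one_mat[of _ "fst N" "fst N"] right_mult_one_mat[of _ "fst N" "fst N"]\<close>)

lemma lat_iso_refl: "G_lattice G M \<Longrightarrow> lat_iso G M M"
  by (rule lat_iso_cong) auto

lemma mult_diag_block_mat:
  fixes A B C D :: "int mat"
  assumes "A \<in> carrier_mat n m" "B \<in> carrier_mat m k" "C \<in> carrier_mat n' m'" "D \<in> carrier_mat m' k'"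
  shows "four_block_mat A (0\<^sub>m n m') (0\<^sub>m n' m) C * four_block_mat B (0\<^sub>m m k') (0\<^sub>m m' k) D
    = four_block_mat (A * B) (0\<^sub>m n k') (0\<^sub>m n' k) (C * D)"
  by (subst mult_four_block_mat[of _ n m _ m' _ n' _ _ k _ k'])
    (use assms in \<open>simp_all add: left_mult_zero_mat[of _ _ _] right_mult_zero_mat[of _ _ _]\<close>)

lemma G_lattice_dsum:
  assumes "G_lattice G M" "G_lattice G N" "group G"
  shows "G_lattice G (lat_dsum M N)"
  unfolding G_lattice_def
proof (intro conjI ballI)
  interpret group G by fact
  fix g h assume gh: "g \<in> carrier G" "h \<in> carrier G"
  note c = G_lattice_carrier[OF assms(1) gh(1)] G_lattice_carrier[OF assms(2) gh(1)]
    G_lattice_carrier[OF assms(1) gh(2)] G_lattice_carrier[OF assms(2) gh(2)]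
  show "snd (lat_dsum M N) g \<in> carrier_mat (fst (lat_dsum M N)) (fst (lat_dsum M N))"
    using c by (simp add: lat_dsum_def)
  show "snd (lat_dsum M N) (g \<otimes>\<^bsub>G\<^esub> h) = snd (lat_dsum M N) g * snd (lat_dsum M N) h"
    using assms(1,2) gh c
    by (simp add: lat_dsum_def G_lattice_def mult_diag_block_mat[OF c(1,3,2,4)])
next
  have "snd M \<one>\<^bsub>G\<^esub> = 1\<^sub>m (fst M)" "snd N \<one>\<^bsub>G\<^esub> = 1\<^sub>m (fst N)"
    using assms(1,2) by (auto simp: G_lattice_def)
  then show "snd (lat_dsum M N) \<one>\<^bsub>G\<^esub> = 1\<^sub>m (fst (lat_dsum M N))"
    by (simp add: lat_dsum_def)
qed

lemma lat_hom_dsum: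
  assumes "lat_hom G M M' A" "lat_hom G N N' B"
    and "G_lattice G M" "G_lattice G N" "G_lattice G M'" "G_lattice G N'"
  shows "lat_hom G (lat_dsum M N) (lat_dsum M' N')
    (four_block_mat A (0\<^sub>m (fst M') (fst N)) (0\<^sub>m (fst N') (fst M)) B)"
  unfolding lat_hom_def
proof (intro conjI ballI)
  have A: "A \<in> carrier_mat (fst M') (fst M)" and B: "B \<in> carrier_mat (fst N') (fst N)"
    using assms by (auto simp: lat_hom_def)
  then show "four_block_mat A (0\<^sub>m (fst M') (fst N)) (0\<^sub>m (fst N') (fst M)) B
      \<in> carrier_mat (fst (lat_dsum M' N')) (fst (lat_dsum M N))"
    by (simp add: lat_dsum_def)
  fix g assume g: "g \<in> carrier G"
  note c = G_lattice_carrier[OF assms(3) g] G_lattice_carrier[OF assms(4) g]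
    G_lattice_carrier[OF assms(5) g] G_lattice_carrier[OF assms(6) g]
  show "four_block_mat A (0\<^sub>m (fst M') (fst N)) (0\<^sub>m (fst N') (fst M)) B * snd (lat_dsum M N) g
      = snd (lat_dsum M' N') g * four_block_mat A (0\<^sub>m (fst M') (fst N)) (0\<^sub>m (fst N') (fst M)) B"
    using assms(1,2) g c A B
    by (simp add: lat_dsum_def lat_hom_def mult_diag_block_mat[OF A c(1) B c(2)]
        mult_diag_block_mat[OF c(3) A c(4) B])
qed

lemma lat_iso_dsum:
  assumes "lat_iso G M M'" "lat_iso G N N'"
    and "G_lattice G M" "G_lattice G N" "G_lattice G M'" "G_lattice G N'"
  shows "lat_iso G (lat_dsum M N) (lat_dsum M' N')"
proof -
  obtain A B C D where h: "lat_hom G M M' A" "lat_hom G M' M B" "A * B = 1\<^sub>m (fst M')" "B * A = 1\<^sub>m (fst M)"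
    "lat_hom G N N' C" "lat_hom G N' N D" "C * D = 1\<^sub>m (fst N')" "D * C = 1\<^sub>m (fst N)"
    using assms(1,2) unfolding lat_iso_def by blast
  then have c: "A \<in> carrier_mat (fst M') (fst M)" "B \<in> carrier_mat (fst M) (fst M')"
    "C \<in> carrier_mat (fst N') (fst N)" "D \<in> carrier_mat (fst N) (fst N')"
    by (auto simp: lat_hom_def)
  show ?thesis
    unfolding lat_iso_def
  proof (intro exI conjI)
    show "lat_hom G (lat_dsum M N) (lat_dsum M' N')
        (four_block_mat A (0\<^sub>m (fst M') (fst N)) (0\<^sub>m (fst N') (fst M)) C)"
      by (rule lat_hom_dsum) (use h assms in auto)
    show "lat_hom G (lat_dsum M' N') (lat_dsum M N)
        (four_block_mat B (0\<^sub>m (fst M) (fst N')) (0\<^sub>m (fst N) (fst M')) D)"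
      by (rule lat_hom_dsum) (use h assms in auto)
  qed (use h in \<open>simp_all add: lat_dsum_def mult_diag_block_mat[OF c(1-4)]
      mult_diag_block_mat[OF c(2,1,4,3)]\<close>)
qed

lemma lat_dsum_comm:
  assumes "G_lattice G M" "G_lattice G N"
  shows "lat_iso G (lat_dsum M N) (lat_dsum N M)"
proof -
  let ?S = "\<lambda>m n. four_block_mat (0\<^sub>m n m) (1\<^sub>m n) (1\<^sub>m m) (0\<^sub>m m n) :: int mat"
  have hom: "lat_hom G (lat_dsum M N) (lat_dsum N M) (?S (fst M) (fst N))"
    if "G_lattice G M" "G_lattice G N" for M N
    unfolding lat_hom_def
  proof (intro conjI ballI)
    show "?S (fst M) (fst N) \<in> carrier_mat (fst (lat_dsum N M)) (fst (lat_dsum M N))"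
      by (auto simp: lat_dsum_def)
    fix g assume g: "g \<in> carrier G"
    note c = G_lattice_carrier[OF that(1) g] G_lattice_carrier[OF that(2) g]
    have "?S (fst M) (fst N) * snd (lat_dsum M N) g
        = four_block_mat (0\<^sub>m (fst N) (fst M)) (snd N g) (snd M g) (0\<^sub>m (fst M) (fst N))"
      unfolding lat_dsum_def snd_conv
      by (subst mult_four_block_mat[of _ "fst N" "fst M" _ "fst N" _ "fst M" _ _ "fst M" _ "fst N"])
        (use c in auto)
    moreover have "snd (lat_dsum N M) g * ?S (fst M) (fst N)
        = four_block_mat (0\<^sub>m (fst N) (fst M)) (snd N g) (snd M g) (0\<^sub>m (fst M) (fst N))"
      unfolding lat_dsum_def snd_conv
      by (subst mult_four_block_mat[of _ "fst N" "fst N" _ "fst M" _ "fst M" _ _ "fst M" _ "fst N"])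
        (use c in auto)
    ultimately show "?S (fst M) (fst N) * snd (lat_dsum M N) g = snd (lat_dsum N M) g * ?S (fst M) (fst N)"
      by simp
  qed
  have inverse: "?S n m * ?S m n = 1\<^sub>m (m + n)" for m n
    by (subst mult_four_block_mat[of _ m n _ m _ n _ _ m _ n]) simp_all
  show ?thesis
    unfolding lat_iso_def
    using hom[OF assms] hom[OF assms(2,1)] inverse[of "fst M" "fst N"] inverse[of "fst N" "fst M"]
    by (auto simp: lat_dsum_def)
qed

text \<open>\<open>lat_dsum_list\<close> ends every sum in \<open>lat_zero\<close>, which has to be
  absorbed to compare it with binary sums.\<close>

lemma lat_iso_dsum_zero:
  assumes "G_lattice G M"
  shows "lat_iso G (lat_dsum M lat_zero) M"
proof (rule lat_iso_cong)
  fix g assume "g \<in> carrier G"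
  then show "snd (lat_dsum M lat_zero) g = snd M g"
    using G_lattice_carrier[OF assms, of g]
    by (intro eq_matI) (simp_all add: lat_dsum_def lat_zero_def)
qed (simp_all add: assms lat_dsum_def lat_zero_def)

lemma G_lattice_zero: "G_lattice G lat_zero"
  by (simp add: G_lattice_def lat_zero_def)

lemma list_lat_append:
  assumes "acts_on G act (set xs)" "acts_on G act (set ys)" "distinct (xs @ ys)" "group G"
  shows "lat_iso G (list_lat (xs @ ys) act) (lat_dsum (list_lat xs act) (list_lat ys act))"
proof (rule lat_iso_cong)
  fix g assume g: "g \<in> carrier G"
  have "act g (xs ! j) \<noteq> ys ! i" if "j < length xs" "i < length ys" for i j
    using acts_onD(1)[OF assms(1) g, of "xs ! j"] that assms(3) nth_mem by fastforce
  moreover have "act g (ys ! j) \<noteq> xs ! i" if "j < length ys" "i < length xs" for i j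
    using acts_onD(1)[OF assms(2) g, of "ys ! j"] that assms(3) nth_mem by fastforce
  ultimately show "snd (list_lat (xs @ ys) act) g = snd (lat_dsum (list_lat xs act) (list_lat ys act)) g"
    by (intro eq_matI) (auto simp: list_lat_def lat_dsum_def nth_append)
next
  show "G_lattice G (lat_dsum (list_lat xs act) (list_lat ys act))"
    by (intro G_lattice_dsum G_lattice_list_lat) (use assms in auto)
qed (simp add: lat_dsum_def)

section \<open>Kernels of split functionals\<close>

text \<open>The side conditions mention dimensions only, so that simplification can reassociate
  products without being told the carriers.\<close>

lemma mat_assoc:
  fixes A B C :: "int mat"
  shows "dim_col A = dim_row B \<Longrightarrow> dim_col B = dim_row C \<Longrightarrow> (A * B) * C = A * (B * C)"
  by (rule assoc_mult_mat[of _ "dim_row A" "dim_row B" _ "dim_row C" _ "dim_col C"]) auto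

lemma one_mat_mult: "dim_row A = n \<Longrightarrow> 1\<^sub>m n * A = (A :: int mat)"
  using left_mult_one_mat[of A n "dim_col A"] by auto

lemma mat_mult_one: "dim_col A = n \<Longrightarrow> A * 1\<^sub>m n = (A :: int mat)"
  using right_mult_one_mat[of A "dim_row A" n] by auto

text \<open>A partition of the identity applied to \<open>X\<close>. It is mostly used when one of
  the two terms vanishes, so that the other one reproduces \<open>X\<close>.\<close>

lemma split_mult:
  fixes A B C D :: "int mat"
  assumes "A * B + C * D = 1\<^sub>m n" "dim_row A = n" "dim_row C = n" "dim_col B = n" "dim_col D = n"
    and "dim_col A = dim_row B" "dim_col C = dim_row D" "dim_row X = n"
  shows "A * (B * X) + C * (D * X) = X"
proof -
  have "(A * B + C * D) * X = A * B * X + C * D * X"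
    by (rule add_mult_distrib_mat[of _ n n _ _ "dim_col X"]) (use assms(2-) in \<open>auto intro: carrier_matI\<close>)
  moreover have "A * B * X = A * (B * X)" "C * D * X = C * (D * X)"
    using assms(2-) by (simp_all add: mat_assoc)
  ultimately show ?thesis
    using one_mat_mult[OF assms(8)] by (metis assms(1))
qed

lemma split_mult_right:
  fixes A B C D :: "int mat"
  assumes "A * B + C * D = 1\<^sub>m n" "dim_row A = n" "dim_row C = n" "dim_col B = n" "dim_col D = n"
    and "dim_col A = dim_row B" "dim_col C = dim_row D" "dim_col X = n"
  shows "X * A * B + X * C * D = X"
proof -
  have "X * (A * B + C * D) = X * (A * B) + X * (C * D)"
    by (rule mult_add_distrib_mat[of _ "dim_row X" n _ n]) (use assms(2-) in \<open>auto intro: carrier_matI\<close>)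
  moreover have "X * A * B = X * (A * B)" "X * C * D = X * (C * D)"
    using assms(2-) by (simp_all add: mat_assoc)
  ultimately show ?thesis
    using mat_mult_one[OF assms(8)] by (metis assms(1))
qed

text \<open>Since the leading entry is 1, the vectors \<open>e_(j+1) - E_(j+1) e_0\<close> form a
  basis of the kernel of the row. The matrix \<open>r\<close> forgets coordinate 0, and
  \<open>e\<close> is the unit vector of that coordinate.\<close>

lemma unimodular_row_split:
  fixes E :: "int mat"
  assumes "E \<in> carrier_mat 1 (Suc n)" "E $$ (0, 0) = 1"
  obtains i r e where "i \<in> carrier_mat (Suc n) n" "r \<in> carrier_mat n (Suc n)" "e \<in> carrier_mat (Suc n) 1"
    "r * i = 1\<^sub>m n" "i * r + e * E = 1\<^sub>m (Suc n)" "E * i = 0\<^sub>m 1 n"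
proof
  let ?i = "mat (Suc n) n (\<lambda>(k, j). if k = 0 then - E $$ (0, Suc j) else if k = Suc j then 1 else 0)"
  let ?r = "mat n (Suc n) (\<lambda>(k, j). if j = Suc k then 1 else 0) :: int mat"
  let ?e = "mat (Suc n) 1 (\<lambda>(k, j). if k = 0 then 1 else 0) :: int mat"
  show "?i \<in> carrier_mat (Suc n) n" "?r \<in> carrier_mat n (Suc n)" "?e \<in> carrier_mat (Suc n) 1"
    by simp_all
  show "?r * ?i = 1\<^sub>m n"
    by (rule eq_matI) (simp_all add: scalar_prod_def if_distrib[where f="\<lambda>x. x * _"] cong: if_cong)
  show "E * ?i = 0\<^sub>m 1 n"
    using assms by (intro eq_matI)
      (simp_all add: scalar_prod_def if_distrib[where f="\<lambda>x. _ * x"] sum.atLeast0_lessThan_Suc_shift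
        del: sum.op_ivl_Suc cong: if_cong)
  show "?i * ?r + ?e * E = 1\<^sub>m (Suc n)"
  proof (rule eq_matI)
    fix k j assume "k < dim_row (1\<^sub>m (Suc n) :: int mat)" "j < dim_col (1\<^sub>m (Suc n) :: int mat)"
    then have kj: "k < Suc n" "j < Suc n" by auto
    have "(?i * ?r) $$ (k, j)
        = (\<Sum>l = 0..<n. (if k = 0 then - E $$ (0, Suc l) else if k = Suc l then 1 else 0) * (if j = Suc l then 1 else 0))"
      using kj by (simp add: scalar_prod_def)
    also have "\<dots> = (\<Sum>l = 0..<n. if l = j - 1 \<and> j \<noteq> 0 then (if k = 0 then - E $$ (0, j) else if k = j then 1 else 0) else 0)"
      by (rule sum.cong) auto
    also have "\<dots> = (if j = 0 then 0 else if k = 0 then - E $$ (0, j) else if k = j then 1 else 0)"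
      using kj by (cases j) (simp_all cong: if_cong)
    finally show "(?i * ?r + ?e * E) $$ (k, j) = 1\<^sub>m (Suc n) $$ (k, j)"
      using kj assms by (auto simp: scalar_prod_def)
  qed (use assms in auto)
qed

text \<open>The hypothesis \<open>stable\<close> says that \<open>i * r\<close> fixes the columns of
  every translate of \<open>i\<close>, that is, that the image of \<open>i\<close> is closed under
  the group; \<open>r\<close> then reads off coordinates.\<close>

lemma G_lattice_sublattice:
  assumes "G_lattice G M" "i \<in> carrier_mat (fst M) n" "r \<in> carrier_mat n (fst M)" "r * i = 1\<^sub>m n" "group G"
    and stable: "\<And>g. g \<in> carrier G \<Longrightarrow> i * (r * (snd M g * i)) = snd M g * i"
  shows "G_lattice G (n, \<lambda>g. r * (snd M g * i))" "lat_hom G (n, \<lambda>g. r * (snd M g * i)) M i"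
proof -
  interpret group G by fact
  show "lat_hom G (n, \<lambda>g. r * (snd M g * i)) M i"
    using assms by (auto simp: lat_hom_def)
  show "G_lattice G (n, \<lambda>g. r * (snd M g * i))"
    unfolding G_lattice_def fst_conv snd_conv
  proof (intro conjI ballI)
    fix g h assume gh: "g \<in> carrier G" "h \<in> carrier G"
    note d = carrier_matD[OF G_lattice_carrier[OF assms(1) gh(1)]]
      carrier_matD[OF G_lattice_carrier[OF assms(1) gh(2)]] carrier_matD[OF assms(2)] carrier_matD[OF assms(3)]
    show "r * (snd M g * i) \<in> carrier_mat n n" using d by auto
    have "r * (snd M g * i) * (r * (snd M h * i)) = r * (snd M g * (i * (r * (snd M h * i))))"
      using d by (simp add: mat_assoc)
    also have "\<dots> = r * (snd M (g \<otimes>\<^bsub>G\<^esub> h) * i)"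
      using d gh assms(1) by (simp add: stable mat_assoc G_lattice_def)
    finally show "r * (snd M (g \<otimes>\<^bsub>G\<^esub> h) * i) = r * (snd M g * i) * (r * (snd M h * i))" by simp
  next
    show "r * (snd M \<one>\<^bsub>G\<^esub> * i) = 1\<^sub>m n"
      using assms by (simp add: G_lattice_def one_mat_mult)
  qed
qed

text \<open>Invariance gives \<open>E * m * i = E * i = 0\<close>, so in the splitting of
  \<open>m * i\<close> the term through \<open>e\<close> disappears.\<close>

lemma invariant_functional_stable:
  fixes E e i r m :: "int mat"
  assumes "i * r + e * E = 1\<^sub>m N" "E * i = 0\<^sub>m 1 n" "E * m = E" "m \<in> carrier_mat N N"
    and "i \<in> carrier_mat N n" "r \<in> carrier_mat n N" "e \<in> carrier_mat N 1" "E \<in> carrier_mat 1 N"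
  shows "i * (r * (m * i)) = m * i"
proof -
  have "E * (m * i) = 0\<^sub>m 1 n"
    using assms by (simp add: mat_assoc[symmetric])
  then show ?thesis
    using split_mult[OF assms(1), of "m * i"] assms
    by (simp add: right_mult_zero_mat[of e N 1 n])
qed

lemma zero_mult_right:
  fixes A B C :: "int mat"
  assumes "B * C = 0\<^sub>m m k" "A \<in> carrier_mat n m" "C \<in> carrier_mat l k" "B \<in> carrier_mat m l"
  shows "A * B * C = 0\<^sub>m n k"
  using assms by (simp add: mat_assoc right_mult_zero_mat[of A n m k])

lemma kernel_complement:
  fixes E s :: "int mat"
  assumes "group G" "G_lattice G M" "fst M = Suc n"
    and E: "E \<in> carrier_mat 1 (Suc n)" "E $$ (0, 0) = 1" and s: "s \<in> carrier_mat (Suc n) 1"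
    and Es: "E * s = 1\<^sub>m 1"
    and Einv: "\<And>g. g \<in> carrier G \<Longrightarrow> E * snd M g = E"
    and sinv: "\<And>g. g \<in> carrier G \<Longrightarrow> snd M g * s = s"
  obtains F i r where "fst F = n" "G_lattice G F" "lat_hom G F M i" "lat_hom G M F r"
    "r * i = 1\<^sub>m n" "i * r + s * E = 1\<^sub>m (Suc n)" "E * i = 0\<^sub>m 1 n" "r * s = 0\<^sub>m n 1"
    "lat_iso G M (lat_dsum lat_triv F)"
proof -
  obtain i r0 e where i: "i \<in> carrier_mat (Suc n) n" and r0: "r0 \<in> carrier_mat n (Suc n)"
    and e: "e \<in> carrier_mat (Suc n) 1"
    and r0i: "r0 * i = 1\<^sub>m n" and ir0: "i * r0 + e * E = 1\<^sub>m (Suc n)" and Ei: "E * i = 0\<^sub>m 1 n"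
    by (rule unimodular_row_split[OF E])
  \<comment> \<open>The projection \<open>1 - s E\<close> onto the kernel of \<open>E\<close> along
    \<open>s\<close> is inserted before \<open>r0\<close>. Unlike \<open>r0\<close>, the corrected
    coordinates kill \<open>s\<close>, and this makes them equivariant.\<close>
  define r where "r = r0 - r0 * s * E"
  have r: "r \<in> carrier_mat n (Suc n)" using r0 s E by (intro carrier_matI) (auto simp: r_def)
  note d = carrier_matD[OF i] carrier_matD[OF r0] carrier_matD[OF e] carrier_matD[OF s]
    carrier_matD[OF E(1)] carrier_matD[OF r]
  have ri: "r * i = 1\<^sub>m n"
  proof -
    have "r * i = r0 * i - r0 * s * E * i"
      unfolding r_def using r0 s E(1) i by (intro minus_mult_distrib_mat[of _ n "Suc n"]) auto
    moreover have "r0 * s * E * i = 0\<^sub>m n n"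
      using r0 s E(1) i by (intro zero_mult_right[of E i 1 n "r0 * s" n "Suc n"]) (auto simp: Ei)
    moreover have "1\<^sub>m n - 0\<^sub>m n n = (1\<^sub>m n :: int mat)" by (rule eq_matI) auto
    ultimately show ?thesis using r0i by simp
  qed
  have rs: "r * s = 0\<^sub>m n 1"
  proof -
    have "r * s = r0 * s - r0 * s * E * s"
      unfolding r_def using r0 s E(1) i by (intro minus_mult_distrib_mat[of _ n "Suc n"]) auto
    moreover have "r0 * s * E * s = r0 * s"
      using d by (simp add: mat_assoc Es mat_mult_one)
    ultimately show ?thesis using r0 s by (auto intro!: eq_matI)
  qed
  have ir: "i * r + s * E = 1\<^sub>m (Suc n)"
  proof -
    have 1: "i * r = i * r0 - i * (r0 * s * E)"
      unfolding r_def using r0 s E(1) i by (intro mult_minus_distrib_mat[of _ "Suc n" n]) auto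
    have "i * (r0 * s) + e * (E * s) = s"
      using split_mult[OF ir0, of s] d by simp
    then have "i * (r0 * s) + e = s" using d by (simp add: Es mat_mult_one)
    then have "(i * (r0 * s) + e) * E = s * E" by simp
    then have 2: "i * (r0 * s * E) + e * E = s * E"
      using add_mult_distrib_mat[of "i * (r0 * s)" "Suc n" 1 e E "Suc n"] i r0 s e E(1) d
      by (simp add: mat_assoc)
    show ?thesis
      unfolding 1 2[symmetric] ir0[symmetric]
      using i r0 s e E(1) by (auto intro!: eq_matI)
  qed
  define F where "F = (n, \<lambda>g. r * (snd M g * i))"
  have fstF: "fst F = n" by (simp add: F_def)
  note sub = G_lattice_sublattice[OF assms(2), of i n r, unfolded assms(3), OF i r ri assms(1), folded F_def,
      OF invariant_functional_stable[OF ir Ei Einv _ i r s E(1)]]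
  have Mc: "g \<in> carrier G \<Longrightarrow> snd M g \<in> carrier_mat (Suc n) (Suc n)" for g
    using G_lattice_carrier[OF assms(2)] assms(3) by simp
  have F: "G_lattice G F" "lat_hom G F M i" using sub Mc by auto
  have homr: "lat_hom G M F r"
    unfolding lat_hom_def
  proof (intro conjI ballI)
    show "r \<in> carrier_mat (fst F) (fst M)" using r assms(3) fstF by simp
    fix g assume g: "g \<in> carrier G"
    note m = carrier_matD[OF Mc[OF g]]
    \<comment> \<open>Insert \<open>i r + s E = 1\<close> after the action: the term through
      \<open>s\<close> dies because the group fixes \<open>s\<close> and
      \<open>r s = 0\<close>.\<close>
    have "r * snd M g * i * r + r * snd M g * s * E = r * snd M g"
      by (rule split_mult_right[OF ir]) (use d m in auto)
    moreover have "r * snd M g * s * E = 0\<^sub>m n (Suc n)"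
      using d m by (simp add: mat_assoc sinv[OF g]) (simp add: mat_assoc[symmetric] rs left_mult_zero_mat[OF E(1)])
    moreover have "r * snd M g * i * r \<in> carrier_mat n (Suc n)"
      using d m by (intro carrier_matI) simp_all
    ultimately have "r * snd M g * i * r = r * snd M g"
      by (metis right_add_zero_mat)
    then show "r * snd M g = snd F g * r"
      using d m by (simp add: F_def mat_assoc)
  qed
  have iso: "lat_iso G M (lat_dsum lat_triv F)"
    unfolding lat_iso_def
  proof (intro exI conjI)
    \<comment> \<open>Blocks without rows or columns stack \<open>E\<close> over \<open>r\<close>
      and put \<open>s\<close> beside \<open>i\<close>, so that the rule for products of 2 by 2
      block matrices applies.\<close>
    let ?A = "four_block_mat E (0\<^sub>m 1 0) r (0\<^sub>m n 0)" and ?B = "four_block_mat s i (0\<^sub>m 0 1) (0\<^sub>m 0 n)"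
    have "?A * ?B = four_block_mat (E * s) (E * i) (r * s) (r * i)"
      by (subst mult_four_block_mat[of _ 1 "Suc n" _ 0 _ n _ _ 1 _ n]) (use E r s i in auto)
    then show "?A * ?B = 1\<^sub>m (fst (lat_dsum lat_triv F))"
      using ri rs Ei Es four_block_one_mat[of 1 n] by (simp add: lat_dsum_def lat_triv_def fstF)
    have "?B * ?A = four_block_mat (s * E + i * r) (0\<^sub>m (Suc n) 0) (0\<^sub>m 0 (Suc n)) (0\<^sub>m 0 0)"
      by (subst mult_four_block_mat[of _ "Suc n" 1 _ n _ 0 _ _ "Suc n" _ 0])
        (use E r s i in \<open>auto intro!: cong_four_block_mat eq_matI\<close>)
    moreover have "s * E + i * r = 1\<^sub>m (Suc n)"
      using ir comm_add_mat[of "s * E" "Suc n" "Suc n" "i * r"] s E i r by simp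
    ultimately show "?B * ?A = 1\<^sub>m (fst M)"
      using assms(3) by (auto intro!: eq_matI)
    show "lat_hom G M (lat_dsum lat_triv F) ?A"
      unfolding lat_hom_def
    proof (intro conjI ballI)
      show "?A \<in> carrier_mat (fst (lat_dsum lat_triv F)) (fst M)"
        using E r assms(3) by (auto simp: lat_dsum_def lat_triv_def fstF)
      fix g assume g: "g \<in> carrier G"
      note Fg = G_lattice_carrier[OF F(1) g, unfolded fstF]
      have "?A * four_block_mat (snd M g) (0\<^sub>m (Suc n) 0) (0\<^sub>m 0 (Suc n)) (0\<^sub>m 0 0)
          = four_block_mat (E * snd M g) (0\<^sub>m 1 0) (r * snd M g) (0\<^sub>m n 0)"
        by (subst mult_four_block_mat[of _ 1 "Suc n" _ 0 _ n _ _ "Suc n" _ 0])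
          (use E r Mc[OF g] in \<open>auto intro!: cong_four_block_mat eq_matI\<close>)
      moreover have "four_block_mat (snd M g) (0\<^sub>m (Suc n) 0) (0\<^sub>m 0 (Suc n)) (0\<^sub>m 0 0) = snd M g"
        using Mc[OF g] by (auto intro!: eq_matI)
      moreover have "snd (lat_dsum lat_triv F) g * ?A = four_block_mat E (0\<^sub>m 1 0) (snd F g * r) (0\<^sub>m n 0)"
        unfolding lat_dsum_def lat_triv_def snd_conv fst_conv fstF
        by (subst mult_four_block_mat[of _ 1 1 _ n _ n _ _ "Suc n" _ 0])
          (use E r Fg in \<open>auto intro!: cong_four_block_mat eq_matI\<close>)
      ultimately show "?A * snd M g = snd (lat_dsum lat_triv F) g * ?A"
        using Einv[OF g] homr g by (simp add: lat_hom_def)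
    qed
    show "lat_hom G (lat_dsum lat_triv F) M ?B"
      unfolding lat_hom_def
    proof (intro conjI ballI)
      show "?B \<in> carrier_mat (fst M) (fst (lat_dsum lat_triv F))"
        using s i assms(3) by (auto simp: lat_dsum_def lat_triv_def fstF)
      fix g assume g: "g \<in> carrier G"
      note Fg = G_lattice_carrier[OF F(1) g, unfolded fstF]
      have "four_block_mat (snd M g) (0\<^sub>m (Suc n) 0) (0\<^sub>m 0 (Suc n)) (0\<^sub>m 0 0) * ?B
          = four_block_mat (snd M g * s) (snd M g * i) (0\<^sub>m 0 1) (0\<^sub>m 0 n)"
        by (subst mult_four_block_mat[of _ "Suc n" "Suc n" _ 0 _ 0 _ _ 1 _ n])
          (use s i Mc[OF g] in \<open>auto intro!: cong_four_block_mat eq_matI\<close>)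
      moreover have "four_block_mat (snd M g) (0\<^sub>m (Suc n) 0) (0\<^sub>m 0 (Suc n)) (0\<^sub>m 0 0) = snd M g"
        using Mc[OF g] by (auto intro!: eq_matI)
      moreover have "?B * snd (lat_dsum lat_triv F) g = four_block_mat s (i * snd F g) (0\<^sub>m 0 1) (0\<^sub>m 0 n)"
        unfolding lat_dsum_def lat_triv_def snd_conv fst_conv fstF
        by (subst mult_four_block_mat[of _ "Suc n" 1 _ n _ 0 _ _ 1 _ n])
          (use s i Fg in \<open>auto intro!: cong_four_block_mat eq_matI\<close>)
      ultimately show "?B * snd (lat_dsum lat_triv F) g = snd M g * ?B"
        using sinv[OF g] F(2) g by (simp add: lat_hom_def)
    qed
  qed
  show ?thesis
    by (rule that[OF fstF F homr ri ir Ei rs iso])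
qed

section \<open>Coset lattices\<close>

text \<open>Orbit-stabilizer correspondence: a point is matched with the left coset of all elements
  that carry \<open>x0\<close> to it. The list \<open>cs\<close> is the one that \<open>SOME\<close>
  picks inside \<open>perm_lat_of\<close>.\<close>

lemma coset_lat_eq_list_lat:
  assumes "group G" "acts_on G act (set xs)" "x0 \<in> set xs"
    and trans: "\<forall>x\<in>set xs. \<exists>g\<in>carrier G. act g x0 = x"
    and K: "K = {g \<in> carrier G. act g x0 = x0}"
  obtains cs where "coset_lat G K = list_lat cs (\<lambda>g S. g <#\<^bsub>G\<^esub> S)" "distinct cs"
    "acts_on G (\<lambda>g S. g <#\<^bsub>G\<^esub> S) (set cs)" "bij_betw (\<lambda>x. {g \<in> carrier G. act g x0 = x}) (set xs) (set cs)"
    "\<forall>g\<in>carrier G. \<forall>x\<in>set xs.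
      {h \<in> carrier G. act h x0 = act g x} = g <#\<^bsub>G\<^esub> {h \<in> carrier G. act h x0 = x}"
proof -
  interpret group G by fact
  let ?f = "\<lambda>x. {g \<in> carrier G. act g x0 = x}"
  let ?C = "{a <#\<^bsub>G\<^esub> K | a. a \<in> carrier G}"
  have equiv: "?f (act g x) = g <#\<^bsub>G\<^esub> ?f x" if g: "g \<in> carrier G" and x: "x \<in> set xs" for g x
  proof (intro equalityI subsetI)
    fix h assume h: "h \<in> ?f (act g x)"
    then have "act (inv\<^bsub>G\<^esub> g \<otimes>\<^bsub>G\<^esub> h) x0 = x"
      using acts_onD(3)[OF assms(2)] acts_on_inv(1)[OF assms(1,2) g x] g assms(3) by auto
    then have "inv\<^bsub>G\<^esub> g \<otimes>\<^bsub>G\<^esub> h \<in> ?f x" using h g by auto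
    moreover have "h = g \<otimes>\<^bsub>G\<^esub> (inv\<^bsub>G\<^esub> g \<otimes>\<^bsub>G\<^esub> h)"
      using h g by (simp add: m_assoc[symmetric])
    ultimately show "h \<in> g <#\<^bsub>G\<^esub> ?f x" unfolding l_coset_def by blast
  next
    fix h assume "h \<in> g <#\<^bsub>G\<^esub> ?f x"
    then show "h \<in> ?f (act g x)"
      using g acts_onD(3)[OF assms(2)] assms(3) by (auto simp: l_coset_def)
  qed
  have img: "?f ` set xs = ?C"
  proof (intro equalityI subsetI)
    fix S assume "S \<in> ?f ` set xs"
    then obtain x where x: "x \<in> set xs" "S = ?f x" by blast
    then obtain a where "a \<in> carrier G" "act a x0 = x" using trans by blast
    then show "S \<in> ?C" using equiv[of a x0] assms(3) x K by blast
  next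
    fix S assume "S \<in> ?C"
    then obtain a where "a \<in> carrier G" "S = a <#\<^bsub>G\<^esub> K" by blast
    then show "S \<in> ?f ` set xs" using equiv[of a x0] assms(3) K acts_onD(1)[OF assms(2)] by blast
  qed
  have bij: "bij_betw ?f (set xs) ?C"
    unfolding bij_betw_def img
  proof (intro conjI inj_onI refl)
    fix x y assume *: "x \<in> set xs" "y \<in> set xs" "?f x = ?f y"
    obtain a where "a \<in> carrier G" "act a x0 = x" using trans *(1) by blast
    then show "x = y" using *(3) by blast
  qed
  obtain cs where cs: "set cs = ?C" "distinct cs"
    "perm_lat_of ?C (\<lambda>g S. g <#\<^bsub>G\<^esub> S) = list_lat cs (\<lambda>g S. g <#\<^bsub>G\<^esub> S)"
    by (rule perm_lat_of_eq_list_lat[of ?C "\<lambda>g S. g <#\<^bsub>G\<^esub> S"]) (simp_all add: img[symmetric])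
  have sub: "S \<subseteq> carrier G" if "S \<in> ?C" for S
    using that K by (auto simp: l_coset_def)
  have acts: "acts_on G (\<lambda>g S. g <#\<^bsub>G\<^esub> S) (set cs)"
    unfolding cs(1) acts_on_def
  proof (intro conjI ballI)
    fix g S assume g: "g \<in> carrier G" and S: "S \<in> ?C"
    then obtain x where x: "x \<in> set xs" "S = ?f x" using img by blast
    show "g <#\<^bsub>G\<^esub> S \<in> ?C"
      unfolding img[symmetric] x(2) equiv[OF g x(1), symmetric]
      by (rule imageI) (rule acts_onD(1)[OF assms(2) g x(1)])
  next
    fix S assume "S \<in> ?C"
    then show "\<one>\<^bsub>G\<^esub> <#\<^bsub>G\<^esub> S = S" using sub lcos_mult_one by blast
  next
    fix g h S assume "g \<in> carrier G" "h \<in> carrier G" "S \<in> ?C"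
    then show "g \<otimes>\<^bsub>G\<^esub> h <#\<^bsub>G\<^esub> S = g <#\<^bsub>G\<^esub> (h <#\<^bsub>G\<^esub> S)"
      by (simp add: lcos_m_assoc sub)
  qed
  show ?thesis
    by (rule that[of cs]) (use cs acts bij equiv in \<open>auto simp: coset_lat_def\<close>)
qed

lemma coset_lat_iso:
  assumes "group G" "acts_on G act (set xs)" "distinct xs" "x0 \<in> set xs"
    and "\<forall>x\<in>set xs. \<exists>g\<in>carrier G. act g x0 = x"
    and "K = {g \<in> carrier G. act g x0 = x0}"
  shows "lat_iso G (list_lat xs act) (coset_lat G K)" "G_lattice G (coset_lat G K)"
proof -
  obtain cs where cs: "coset_lat G K = list_lat cs (\<lambda>g S. g <#\<^bsub>G\<^esub> S)" "distinct cs"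
    "acts_on G (\<lambda>g S. g <#\<^bsub>G\<^esub> S) (set cs)" "bij_betw (\<lambda>x. {g \<in> carrier G. act g x0 = x}) (set xs) (set cs)"
    "\<forall>g\<in>carrier G. \<forall>x\<in>set xs.
      {h \<in> carrier G. act h x0 = act g x} = g <#\<^bsub>G\<^esub> {h \<in> carrier G. act h x0 = x}"
    by (rule coset_lat_eq_list_lat[of G act xs x0 K, OF assms(1,2,4,5,6)])
  show "G_lattice G (coset_lat G K)"
    unfolding cs(1) by (rule G_lattice_list_lat[OF cs(3,2)])
  show "lat_iso G (list_lat xs act) (coset_lat G K)"
    unfolding cs(1)
    by (rule lat_iso_bij[of G act xs "\<lambda>g S. g <#\<^bsub>G\<^esub> S" cs "\<lambda>x. {g \<in> carrier G. act g x0 = x}",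
          OF assms(1,2) cs(3) assms(3) cs(2,4)]) (use cs(5) in blast)
qed

lemma stabilizer_subgroup:
  assumes "group G" "acts_on G act X" "x \<in> X"
  shows "subgroup {g \<in> carrier G. act g x = x} G"
proof -
  interpret group G by fact
  show ?thesis
  proof (rule subgroupI)
    fix g assume "g \<in> {g \<in> carrier G. act g x = x}"
    then show "inv\<^bsub>G\<^esub> g \<in> {g \<in> carrier G. act g x = x}"
      using acts_on_inv(1)[OF assms(1,2), of g x] assms(3) by auto
  next
    have "\<one>\<^bsub>G\<^esub> \<in> {g \<in> carrier G. act g x = x}" using acts_onD(2)[OF assms(2,3)] by auto
    then show "{g \<in> carrier G. act g x = x} \<noteq> {}" by blast
  qed (use acts_onD(3)[OF assms(2)] assms(3) in auto)
qed

section \<open>Tate cohomology in degree -1\<close>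

lemma mult_mat_vec_index_sum:
  fixes A :: "int mat"
  assumes "A \<in> carrier_mat n m" "v \<in> carrier_vec m" "k < n"
  shows "(A *\<^sub>v v) $ k = (\<Sum>l<m. A $$ (k, l) * v $ l)"
  using assms by (simp add: scalar_prod_def atLeast0LessThan)

text \<open>Push \<open>x\<close> forward along \<open>i\<close>, write it as a sum of terms
  \<open>h y - y\<close> in \<open>Q\<close>, and return along \<open>r\<close>. Both maps commute
  with the action and hence with norms and differences.\<close>

lemma tate_minus1_zero_retract:
  assumes "G_lattice G F" "G_lattice G Q" "lat_hom G F Q i" "lat_hom G Q F r" "r * i = 1\<^sub>m (fst F)"
    and "H \<subseteq> carrier G" "tate_minus1_zero G H Q"
  shows "tate_minus1_zero G H F"
  unfolding tate_minus1_zero_def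
proof (intro ballI impI)
  fix x assume x: "x \<in> carrier_vec (fst F)"
    and x0: "\<forall>k<fst F. (\<Sum>h\<in>H. (snd F h *\<^sub>v x) $ k) = 0"
  have i: "i \<in> carrier_mat (fst Q) (fst F)" and r: "r \<in> carrier_mat (fst F) (fst Q)"
    using assms by (auto simp: lat_hom_def)
  have F: "snd F h \<in> carrier_mat (fst F) (fst F)" and Q: "snd Q h \<in> carrier_mat (fst Q) (fst Q)"
    if "h \<in> H" for h
    using that assms(6) G_lattice_carrier[OF assms(1)] G_lattice_carrier[OF assms(2)] by auto
  have iF: "i * snd F h = snd Q h * i" and rQ: "r * snd Q h = snd F h * r" if "h \<in> H" for h
    using that assms(3,4,6) by (auto simp: lat_hom_def)
  have "(\<Sum>h\<in>H. (snd Q h *\<^sub>v (i *\<^sub>v x)) $ k) = 0" if k: "k < fst Q" for k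
  proof -
    have "(snd Q h *\<^sub>v (i *\<^sub>v x)) $ k = (\<Sum>l<fst F. i $$ (k, l) * (snd F h *\<^sub>v x) $ l)" if h: "h \<in> H" for h
    proof -
      have "snd Q h *\<^sub>v (i *\<^sub>v x) = i *\<^sub>v (snd F h *\<^sub>v x)"
        using iF[OF h] assoc_mult_mat_vec[OF Q[OF h] i x] assoc_mult_mat_vec[OF i F[OF h] x] by simp
      then show ?thesis
        using mult_mat_vec_index_sum[OF i _ k, of "snd F h *\<^sub>v x"] F[OF h] x by simp
    qed
    then have "(\<Sum>h\<in>H. (snd Q h *\<^sub>v (i *\<^sub>v x)) $ k)
        = (\<Sum>h\<in>H. \<Sum>l<fst F. i $$ (k, l) * (snd F h *\<^sub>v x) $ l)" by simp
    also have "\<dots> = (\<Sum>l<fst F. i $$ (k, l) * (\<Sum>h\<in>H. (snd F h *\<^sub>v x) $ l))"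
      by (subst sum.swap) (simp add: sum_distrib_left)
    also have "\<dots> = 0" using x0 by simp
    finally show ?thesis .
  qed
  then obtain y where y: "\<forall>h\<in>H. y h \<in> carrier_vec (fst Q)"
    "\<forall>k<fst Q. (i *\<^sub>v x) $ k = (\<Sum>h\<in>H. (snd Q h *\<^sub>v y h) $ k - y h $ k)"
    using assms(7) mult_mat_vec_carrier[OF i x] unfolding tate_minus1_zero_def by blast
  show "\<exists>y. (\<forall>h\<in>H. y h \<in> carrier_vec (fst F)) \<and>
      (\<forall>k<fst F. x $ k = (\<Sum>h\<in>H. (snd F h *\<^sub>v y h) $ k - y h $ k))"
  proof (intro exI conjI ballI allI impI)
    fix h assume "h \<in> H" then show "r *\<^sub>v y h \<in> carrier_vec (fst F)" using y(1) r by auto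
  next
    fix k assume k: "k < fst F"
    have "x = r *\<^sub>v (i *\<^sub>v x)"
      using assoc_mult_mat_vec[OF r i x] assms(5) x by simp
    then have "x $ k = (\<Sum>l<fst Q. r $$ (k, l) * (i *\<^sub>v x) $ l)"
      using mult_mat_vec_index_sum[OF r _ k, of "i *\<^sub>v x"] i x by simp
    also have "\<dots> = (\<Sum>l<fst Q. r $$ (k, l) * (\<Sum>h\<in>H. (snd Q h *\<^sub>v y h) $ l - y h $ l))"
      using y(2) by simp
    also have "\<dots> = (\<Sum>h\<in>H. \<Sum>l<fst Q. r $$ (k, l) * ((snd Q h *\<^sub>v y h) $ l - y h $ l))"
      by (subst sum.swap) (simp add: sum_distrib_left)
    also have "\<dots> = (\<Sum>h\<in>H. (snd F h *\<^sub>v (r *\<^sub>v y h)) $ k - (r *\<^sub>v y h) $ k)"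
    proof (rule sum.cong[OF refl])
      fix h assume h: "h \<in> H"
      have "snd F h *\<^sub>v (r *\<^sub>v y h) = r *\<^sub>v (snd Q h *\<^sub>v y h)"
        using rQ[OF h] assoc_mult_mat_vec[OF F[OF h] r] assoc_mult_mat_vec[OF r Q[OF h]] y(1) h by metis
      then show "(\<Sum>l<fst Q. r $$ (k, l) * ((snd Q h *\<^sub>v y h) $ l - y h $ l))
          = (snd F h *\<^sub>v (r *\<^sub>v y h)) $ k - (r *\<^sub>v y h) $ k"
        using mult_mat_vec_index_sum[OF r _ k, of "y h"] mult_mat_vec_index_sum[OF r _ k, of "snd Q h *\<^sub>v y h"]
          y(1) h Q[OF h] by (simp add: right_diff_distrib sum_subtractf del: index_mult_mat_vec)
    qed
    finally show "x $ k = (\<Sum>h\<in>H. (snd F h *\<^sub>v (r *\<^sub>v y h)) $ k - (r *\<^sub>v y h) $ k)" .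
  qed
qed

lemma kmat_mult_vec:
  assumes "distinct xs"
  shows "kmat F ys xs *\<^sub>v vec (length xs) (\<lambda>j. f (xs ! j)) = vec (length ys) (\<lambda>i. \<Sum>x\<in>set xs. F (ys ! i) x * f x)"
proof (rule eq_vecI)
  fix i assume "i < dim_vec (vec (length ys) (\<lambda>i. \<Sum>x\<in>set xs. F (ys ! i) x * f x))"
  then have i: "i < length ys" by simp
  then show "(kmat F ys xs *\<^sub>v vec (length xs) (\<lambda>j. f (xs ! j))) $ i
      = vec (length ys) (\<lambda>i. \<Sum>x\<in>set xs. F (ys ! i) x * f x) $ i"
    using sum_nth_distinct[OF assms, of "\<lambda>x. F (ys ! i) x * f x"]
    by (simp add: scalar_prod_def atLeast0LessThan)
qed simp

text \<open>Distinctness recovers the position from the point, so a vector may be treated as a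
  function on points.\<close>

lemma vec_as_function:
  assumes "distinct xs" "v \<in> carrier_vec (length xs)"
  shows "v = vec (length xs) (\<lambda>j. v $ (THE i. i < length xs \<and> xs ! i = xs ! j))"
proof (rule eq_vecI)
  fix j assume "j < dim_vec (vec (length xs) (\<lambda>j. v $ (THE i. i < length xs \<and> xs ! i = xs ! j)))"
  then have j: "j < length xs" by simp
  then have "(THE i. i < length xs \<and> xs ! i = xs ! j) = j"
    using assms(1) by (auto simp: nth_eq_iff_index_eq)
  then show "v $ j = vec (length xs) (\<lambda>j. v $ (THE i. i < length xs \<and> xs ! i = xs ! j)) $ j"
    using j by simp
qed (use assms in auto)

text \<open>A cycle killed by the norm has sum zero on every orbit, and moving all its mass in an orbit
  to one representative writes it as a sum of terms \<open>h y - y\<close>.\<close>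

lemma tate_minus1_zero_list_lat:
  assumes "group G" "acts_on G act (set xs)" "distinct xs" "subgroup H G" "finite H"
  shows "tate_minus1_zero G H (list_lat xs act)"
  unfolding tate_minus1_zero_def fst_list_lat
proof (intro ballI impI)
  interpret group G by fact
  note HG = subgroup.mem_carrier[OF assms(4)]
  let ?X = "set xs"
  fix v assume v: "v \<in> carrier_vec (length xs)"
    and norm: "\<forall>i<length xs. (\<Sum>h\<in>H. (snd (list_lat xs act) h *\<^sub>v v) $ i) = 0"
  define f where "f p = v $ (THE i. i < length xs \<and> xs ! i = p)" for p
  have f: "v = vec (length xs) (\<lambda>j. f (xs ! j))"
    unfolding f_def by (rule vec_as_function[OF assms(3) v])
  have norm': "(\<Sum>h\<in>H. \<Sum>x\<in>?X. of_bool (act h x = p) * f x) = 0" if p: "p \<in> ?X" for p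
  proof -
    obtain i where i: "i < length xs" "p = xs ! i" using p by (auto simp: in_set_conv_nth)
    then have "(snd (list_lat xs act) h *\<^sub>v v) $ i = (\<Sum>x\<in>?X. of_bool (act h x = p) * f x)" for h
      unfolding list_lat_def snd_conv f kmat_mult_vec[OF assms(3)] by simp
    then have "(\<Sum>h\<in>H. \<Sum>x\<in>?X. of_bool (act h x = p) * f x)
        = (\<Sum>h\<in>H. (snd (list_lat xs act) h *\<^sub>v v) $ i)"
      by (simp only:)
    also have "\<dots> = 0" using norm i(1) by blast
    finally show ?thesis .
  qed
  define orb where "orb x = {act h x | h. h \<in> H}" for x
  \<comment> \<open>The choice depends on the orbit as a set and not on the point, which makes
    \<open>rep\<close> constant on orbits.\<close>
  define rep where "rep x = (SOME y. y \<in> orb x)" for x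
  have self: "x \<in> orb x" if "x \<in> ?X" for x
    unfolding orb_def using acts_onD(2)[OF assms(2) that] subgroup.one_closed[OF assms(4)] by force
  have rep_orb: "rep x \<in> orb x" if "x \<in> ?X" for x
    unfolding rep_def using self[OF that] by (rule someI)
  have orb_eq: "orb (act h x) = orb x" if "h \<in> H" "x \<in> ?X" for h x
  proof (intro equalityI subsetI)
    fix y assume "y \<in> orb (act h x)"
    then obtain k where "k \<in> H" "y = act k (act h x)" by (auto simp: orb_def)
    then show "y \<in> orb x"
      unfolding orb_def using that HG acts_onD(3)[OF assms(2)] subgroup.m_closed[OF assms(4)]
      by (metis (mono_tags, lifting) mem_Collect_eq)
  next
    fix y assume "y \<in> orb x"
    then obtain k where k: "k \<in> H" "y = act k x" by (auto simp: orb_def)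
    have "k \<otimes>\<^bsub>G\<^esub> inv\<^bsub>G\<^esub> h \<in> H"
      using k that subgroup.m_closed[OF assms(4)] subgroup.m_inv_closed[OF assms(4)] by simp
    moreover have "y = act (k \<otimes>\<^bsub>G\<^esub> inv\<^bsub>G\<^esub> h) (act h x)"
      using k that HG acts_onD(1,3)[OF assms(2)] acts_on_inv(1)[OF assms(1,2)] by simp
    ultimately show "y \<in> orb (act h x)" unfolding orb_def by blast
  qed
  have rep_act: "rep (act h x) = rep x" if "h \<in> H" "x \<in> ?X" for h x
    using orb_eq[OF that] by (simp add: rep_def)
  have repX: "rep x \<in> ?X" if "x \<in> ?X" for x
    using rep_orb[OF that] acts_onD(1)[OF assms(2)] HG that by (auto simp: orb_def)
  have "\<exists>k. k \<in> H \<and> act k (rep x) = x" if x: "x \<in> ?X" for x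
  proof -
    obtain h where h: "h \<in> H" "rep x = act h x" using rep_orb[OF x] by (auto simp: orb_def)
    then show ?thesis
      using acts_on_inv(1)[OF assms(1,2) HG[OF h(1)] x] subgroup.m_inv_closed[OF assms(4)] by metis
  qed
  then obtain k where k: "\<And>x. x \<in> ?X \<Longrightarrow> k x \<in> H" "\<And>x. x \<in> ?X \<Longrightarrow> act (k x) (rep x) = x"
    by metis
  have rep_sum: "(\<Sum>x\<in>?X. of_bool (rep x = p) * f x) = 0" if p: "p \<in> ?X" for p
  proof (cases "rep p = p")
    case False
    have "rep x \<noteq> p" if x: "x \<in> ?X" for x
    proof
      assume "rep x = p"
      moreover obtain h where "h \<in> H" "rep x = act h x" using rep_orb[OF x] by (auto simp: orb_def)
      ultimately show False using rep_act[of h x] x False by simp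
    qed
    then show ?thesis by simp
  next
    case True
    let ?c = "card {h \<in> H. act h p = p}"
    \<comment> \<open>If \<open>x\<close> lies in the orbit of \<open>p\<close>, right translation
      by \<open>k x\<close> matches the elements carrying \<open>x\<close> to \<open>p\<close> with
      the stabilizer of \<open>p\<close>. The norm at \<open>p\<close> is therefore the order of the
      stabilizer times the orbit sum, and this nonzero factor cancels over the integers.\<close>
    have count: "(\<Sum>h\<in>H. of_bool (act h x = p)) = (int ?c * of_bool (rep x = p) :: int)" if x: "x \<in> ?X" for x
    proof (cases "rep x = p")
      case True
      have "bij_betw (\<lambda>h. h \<otimes>\<^bsub>G\<^esub> k x) {h \<in> H. act h x = p} {h \<in> H. act h p = p}"
      proof (rule bij_betw_byWitness[where f' = "\<lambda>h. h \<otimes>\<^bsub>G\<^esub> inv\<^bsub>G\<^esub> (k x)"])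
        show "\<forall>h\<in>{h \<in> H. act h x = p}. h \<otimes>\<^bsub>G\<^esub> k x \<otimes>\<^bsub>G\<^esub> inv\<^bsub>G\<^esub> k x = h"
          using HG k(1)[OF x] by (auto simp: m_assoc)
        show "\<forall>h\<in>{h \<in> H. act h p = p}. h \<otimes>\<^bsub>G\<^esub> inv\<^bsub>G\<^esub> k x \<otimes>\<^bsub>G\<^esub> k x = h"
          using HG k(1)[OF x] by (auto simp: m_assoc)
        show "(\<lambda>h. h \<otimes>\<^bsub>G\<^esub> k x) ` {h \<in> H. act h x = p} \<subseteq> {h \<in> H. act h p = p}"
          using k[OF x] True p HG acts_onD(3)[OF assms(2)] subgroup.m_closed[OF assms(4)] by auto
        have "act (inv\<^bsub>G\<^esub> k x) x = p"
          using acts_on_inv(1)[OF assms(1,2) HG[OF k(1)[OF x]] p] k(2)[OF x] True by simp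
        then show "(\<lambda>h. h \<otimes>\<^bsub>G\<^esub> inv\<^bsub>G\<^esub> k x) ` {h \<in> H. act h p = p} \<subseteq> {h \<in> H. act h x = p}"
          using k(1)[OF x] x HG acts_onD(3)[OF assms(2)] subgroup.m_closed[OF assms(4)]
            subgroup.m_inv_closed[OF assms(4)] by auto
      qed
      then have "card {h \<in> H. act h x = p} = ?c" by (rule bij_betw_same_card)
      then show ?thesis using True assms(5) by (simp add: of_bool_def sum.If_cases Int_def)
    next
      case False
      then have "act h x \<noteq> p" if "h \<in> H" for h
        using rep_act[OF that x] \<open>rep p = p\<close> by auto
      then show ?thesis using False by simp
    qed
    have "0 = (\<Sum>x\<in>?X. (\<Sum>h\<in>H. of_bool (act h x = p)) * f x)"
      using norm'[OF p] by (subst (asm) sum.swap) (simp add: sum_distrib_right)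
    also have "\<dots> = (\<Sum>x\<in>?X. int ?c * (of_bool (rep x = p) * f x))"
      by (rule sum.cong) (simp_all only: count mult.assoc)
    also have "\<dots> = int ?c * (\<Sum>x\<in>?X. of_bool (rep x = p) * f x)"
      by (simp only: sum_distrib_left)
    finally have "int ?c * (\<Sum>x\<in>?X. of_bool (rep x = p) * f x) = 0" by simp
    moreover have "\<one>\<^bsub>G\<^esub> \<in> {h \<in> H. act h p = p}"
      using subgroup.one_closed[OF assms(4)] acts_onD(2)[OF assms(2) p] by simp
    then have "?c \<noteq> 0" using assms(5) by auto
    ultimately show ?thesis by simp
  qed
  \<comment> \<open>The mass \<open>f x\<close> is placed at \<open>rep x\<close> under the index
    \<open>k x\<close>. Acting by \<open>k x\<close> returns it to \<open>x\<close>, so the sum of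
    the differences is \<open>f\<close> minus the orbit sums sitting at the representatives, and
    those vanish by \<open>rep_sum\<close>.\<close>
  define y where "y h p = (\<Sum>x\<in>?X. of_bool (k x = h \<and> rep x = p) * f x)" for h p
  have act_y: "(\<Sum>q\<in>?X. of_bool (act h q = p) * y h q) = (\<Sum>x\<in>?X. of_bool (k x = h \<and> x = p) * f x)"
    if "h \<in> H" "p \<in> ?X" for h p
  proof -
    have "(\<Sum>q\<in>?X. of_bool (act h q = p) * y h q)
        = (\<Sum>x\<in>?X. \<Sum>q\<in>?X. of_bool (act h q = p) * (of_bool (k x = h \<and> rep x = q) * f x))"
      unfolding y_def sum_distrib_left by (rule sum.swap)
    also have "\<dots> = (\<Sum>x\<in>?X. of_bool (k x = h \<and> x = p) * f x)"
    proof (rule sum.cong[OF refl])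
      fix x assume x: "x \<in> ?X"
      have "(\<Sum>q\<in>?X. of_bool (act h q = p) * (of_bool (k x = h \<and> rep x = q) * f x))
          = (\<Sum>q\<in>?X. if q = rep x then of_bool (k x = h \<and> x = p) * f x else 0)"
        by (rule sum.cong) (use k(2)[OF x] in auto)
      then show "(\<Sum>q\<in>?X. of_bool (act h q = p) * (of_bool (k x = h \<and> rep x = q) * f x))
          = of_bool (k x = h \<and> x = p) * f x"
        using repX[OF x] by simp
    qed
    finally show ?thesis .
  qed
  have main: "(\<Sum>h\<in>H. (\<Sum>q\<in>?X. of_bool (act h q = p) * y h q) - y h p) = f p" if p: "p \<in> ?X" for p
  proof -
    have single: "(\<Sum>h\<in>H. \<Sum>x\<in>?X. of_bool (k x = h \<and> P x) * f x) = (\<Sum>x\<in>?X. of_bool (P x) * f x)" for P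
    proof (subst sum.swap, rule sum.cong[OF refl])
      fix x assume x: "x \<in> ?X"
      have "(\<Sum>h\<in>H. of_bool (k x = h \<and> P x) * f x) = (\<Sum>h\<in>H. if h = k x then of_bool (P x) * f x else 0)"
        by (rule sum.cong) auto
      then show "(\<Sum>h\<in>H. of_bool (k x = h \<and> P x) * f x) = of_bool (P x) * f x"
        using assms(5) k(1)[OF x] by simp
    qed
    have 1: "(\<Sum>h\<in>H. \<Sum>q\<in>?X. of_bool (act h q = p) * y h q) = (\<Sum>x\<in>?X. of_bool (x = p) * f x)"
      unfolding single[of "\<lambda>x. x = p", symmetric] by (rule sum.cong[OF refl act_y[OF _ p]])
    have 2: "(\<Sum>h\<in>H. y h p) = (\<Sum>x\<in>?X. of_bool (rep x = p) * f x)"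
      unfolding y_def by (rule single)
    have "(\<Sum>h\<in>H. (\<Sum>q\<in>?X. of_bool (act h q = p) * y h q) - y h p)
        = (\<Sum>x\<in>?X. of_bool (x = p) * f x) - (\<Sum>x\<in>?X. of_bool (rep x = p) * f x)"
      unfolding sum_subtractf 1 2 ..
    also have "(\<Sum>x\<in>?X. of_bool (x = p) * f x) = (\<Sum>x\<in>?X. if x = p then f x else 0)"
      by (rule sum.cong) auto
    finally show ?thesis using rep_sum[OF p] p by simp
  qed
  show "\<exists>y. (\<forall>h\<in>H. y h \<in> carrier_vec (length xs)) \<and>
      (\<forall>i<length xs. v $ i = (\<Sum>h\<in>H. (snd (list_lat xs act) h *\<^sub>v y h) $ i - y h $ i))"
  proof (intro exI conjI ballI allI impI)
    fix i assume "i < length xs"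
    then show "v $ i = (\<Sum>h\<in>H. (snd (list_lat xs act) h *\<^sub>v vec (length xs) (\<lambda>j. y h (xs ! j))) $ i
        - vec (length xs) (\<lambda>j. y h (xs ! j)) $ i)"
      unfolding list_lat_def snd_conv kmat_mult_vec[OF assms(3)] f using main[of "xs ! i"] by simp
  qed simp
qed

lemma flabby_retract:
  assumes "group G" "finite (carrier G)" "acts_on G act (set xs)" "distinct xs" "G_lattice G F"
    and "lat_hom G F (list_lat xs act) i" "lat_hom G (list_lat xs act) F r" "r * i = 1\<^sub>m (fst F)"
  shows "flabby G F"
  unfolding flabby_def
proof (intro conjI allI impI)
  fix H assume H: "subgroup H G"
  then have "H \<subseteq> carrier G" "finite H"
    using subgroup.subset assms(2) finite_subset by blast+
  then show "tate_minus1_zero G H F"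
    using tate_minus1_zero_retract[OF assms(5) G_lattice_list_lat[OF assms(3,4)] assms(6-8)]
      tate_minus1_zero_list_lat[OF assms(1,3,4) H] by blast
qed (rule assms(5))

section \<open>The Chevalley module\<close>

lemma G_lattice_dual:
  assumes "group G" "G_lattice G M"
  shows "G_lattice G (lat_dual G M)"
  unfolding G_lattice_def lat_dual_def fst_conv snd_conv
proof (intro conjI ballI)
  interpret group G by fact
  fix g h assume gh: "g \<in> carrier G" "h \<in> carrier G"
  note c = G_lattice_carrier[OF assms(2) inv_closed[OF gh(1)]] G_lattice_carrier[OF assms(2) inv_closed[OF gh(2)]]
  show "transpose_mat (snd M (inv\<^bsub>G\<^esub> g)) \<in> carrier_mat (fst M) (fst M)" using c by simp
  show "transpose_mat (snd M (inv\<^bsub>G\<^esub> (g \<otimes>\<^bsub>G\<^esub> h)))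
      = transpose_mat (snd M (inv\<^bsub>G\<^esub> g)) * transpose_mat (snd M (inv\<^bsub>G\<^esub> h))"
    using assms(2) gh transpose_mult[OF c(2,1)] by (simp add: inv_mult_group G_lattice_def)
next
  interpret group G by fact
  show "transpose_mat (snd M (inv\<^bsub>G\<^esub> \<one>\<^bsub>G\<^esub>)) = 1\<^sub>m (fst M)"
    using assms(2) by (simp add: G_lattice_def transpose_one)
qed

lemma inj_mat_cancel:
  fixes A X Y :: "int mat"
  assumes inj: "\<forall>u\<in>carrier_vec m. A *\<^sub>v u = 0\<^sub>v n \<longrightarrow> u = 0\<^sub>v m"
    and "A \<in> carrier_mat n m" "X \<in> carrier_mat m k" "Y \<in> carrier_mat m k" "A * X = A * Y"
  shows "X = Y"
proof (rule eq_matI)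
  fix a b assume ab: "a < dim_row Y" "b < dim_col Y"
  then have b: "b < k" using assms(4) by simp
  have cX: "col X b \<in> carrier_vec m" and cY: "col Y b \<in> carrier_vec m"
    using assms(3,4) b by auto
  have "A *\<^sub>v (col X b - col Y b) = A *\<^sub>v col X b - A *\<^sub>v col Y b"
    by (rule mult_minus_distrib_mat_vec[OF assms(2) cX cY])
  also have "A *\<^sub>v col X b = A *\<^sub>v col Y b"
    using col_mult2[OF assms(2,3) b] col_mult2[OF assms(2,4) b] assms(5) by simp
  also have "A *\<^sub>v col Y b - A *\<^sub>v col Y b = 0\<^sub>v n"
    using assms(2) by (intro eq_vecI) auto
  finally have "col X b - col Y b = 0\<^sub>v m"
    using inj cX cY by simp
  then have "(col X b - col Y b) $ a = 0" using ab assms(4) by simp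
  then show "X $$ (a, b) = Y $$ (a, b)"
    using ab assms(3,4) by simp
qed (use assms in auto)

text \<open>This holds for every model \<open>I\<close> of the augmentation kernel, as required by
  the unspecified choice in \<open>aug_ideal\<close>. Column \<open>j\<close> of \<open>r\<close> is
  a preimage of the sum-zero vector \<open>e_j - e_0\<close>, and \<open>e\<close> is the first unit
  vector.\<close>

lemma aug_kernel_splitting:
  assumes "aug_kernel G H I \<iota>" "0 < fst (coset_lat G H)"
  defines "n \<equiv> fst (coset_lat G H)" and "k \<equiv> fst I"
  defines "O1 \<equiv> mat 1 n (\<lambda>_. 1) :: int mat"
  obtains r e where "r \<in> carrier_mat k n" "e \<in> carrier_mat n 1" "\<iota> \<in> carrier_mat n k"
    "r * \<iota> = 1\<^sub>m k" "\<iota> * r + e * O1 = 1\<^sub>m n" "O1 * \<iota> = 0\<^sub>m 1 k"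
proof -
  have i: "\<iota> \<in> carrier_mat n k" and inj: "\<forall>u\<in>carrier_vec k. \<iota> *\<^sub>v u = 0\<^sub>v n \<longrightarrow> u = 0\<^sub>v k"
    and img: "\<forall>v\<in>carrier_vec n. (\<Sum>l<n. v $ l) = 0 \<longleftrightarrow> (\<exists>u\<in>carrier_vec k. \<iota> *\<^sub>v u = v)"
    using assms(1) unfolding aug_kernel_def lat_hom_def n_def k_def by auto
  let ?v = "\<lambda>j. vec n (\<lambda>l. of_bool (l = j) - of_bool (l = 0)) :: int vec"
  have "\<exists>u\<in>carrier_vec k. \<iota> *\<^sub>v u = ?v j" if "j < n" for j
  proof -
    have "(\<Sum>l<n. ?v j $ l) = (\<Sum>l<n. if l = j then 1 else 0) - (\<Sum>l<n. if l = 0 then 1 else 0)"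
      unfolding sum_subtractf[symmetric] by (rule sum.cong) auto
    also have "\<dots> = 0" using that by simp
    finally show ?thesis using img by (meson vec_carrier)
  qed
  then obtain u where u: "\<And>j. j < n \<Longrightarrow> u j \<in> carrier_vec k" "\<And>j. j < n \<Longrightarrow> \<iota> *\<^sub>v u j = ?v j"
    by metis
  define r where "r = mat k n (\<lambda>(l, j). u j $ l)"
  define e where "e = (mat n 1 (\<lambda>(l, _). of_bool (l = 0)) :: int mat)"
  have r: "r \<in> carrier_mat k n" and e: "e \<in> carrier_mat n 1" and O1: "O1 \<in> carrier_mat 1 n"
    by (simp_all add: r_def e_def O1_def)
  have eO: "(e * O1) $$ (l, j) = of_bool (l = 0)" if "l < n" "j < n" for l j
    using that by (simp add: e_def O1_def scalar_prod_def)
  have ir: "\<iota> * r + e * O1 = 1\<^sub>m n"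
  proof (rule eq_matI)
    fix l j assume "l < dim_row (1\<^sub>m n :: int mat)" "j < dim_col (1\<^sub>m n :: int mat)"
    then have lj: "l < n" "j < n" by auto
    have "col r j = u j" using lj u(1)[OF lj(2)] by (intro eq_vecI) (auto simp: r_def)
    then have "(\<iota> * r) $$ (l, j) = ?v j $ l"
      using col_mult2[OF i r lj(2)] u(2)[OF lj(2)] lj i r by (metis carrier_matD index_col index_mult_mat(2,3))
    then show "(\<iota> * r + e * O1) $$ (l, j) = 1\<^sub>m n $$ (l, j)"
      using lj eO[OF lj] i r e O1 by (auto simp del: index_mult_mat(1))
  qed (use i r e O1 in auto)
  have Oi: "O1 * \<iota> = 0\<^sub>m 1 k"
  proof (rule eq_matI)
    fix l j assume "l < dim_row (0\<^sub>m 1 k :: int mat)" "j < dim_col (0\<^sub>m 1 k :: int mat)"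
    then have lj: "l = 0" "j < k" by auto
    have "\<iota> *\<^sub>v unit_vec k j = col \<iota> j"
      using i lj by (intro eq_vecI) (auto simp: scalar_prod_right_unit)
    then have "(\<Sum>l<n. col \<iota> j $ l) = 0"
      using img lj i by (metis col_carrier_vec unit_vec_carrier carrier_matD)
    then show "(O1 * \<iota>) $$ (l, j) = 0\<^sub>m 1 k $$ (l, j)"
      using lj i by (simp add: O1_def scalar_prod_def atLeast0LessThan)
  qed (use i in \<open>auto simp: O1_def\<close>)
  have "\<iota> * (r * \<iota>) + e * (O1 * \<iota>) = \<iota>"
    by (rule split_mult[OF ir]) (use i r e O1 in auto)
  moreover have "e * (O1 * \<iota>) = 0\<^sub>m n k" unfolding Oi using e by (rule right_mult_zero_mat)
  ultimately have "\<iota> * (r * \<iota>) = \<iota>"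
    using i r by (metis mult_carrier_mat right_add_zero_mat)
  then have ri: "r * \<iota> = 1\<^sub>m k"
    using i r by (subst inj_mat_cancel[OF inj i, of "r * \<iota>" k "1\<^sub>m k"]) auto
  show ?thesis by (rule that[OF r e i ri ir Oi])
qed

text \<open>Existence gives meaning to the \<open>SOME\<close> in \<open>aug_ideal\<close>; the
  kernel of the all-ones row is an explicit model.\<close>

lemma aug_kernel_exists:
  assumes "group G" "coset_lat G H = list_lat cs act" "acts_on G act (set cs)" "distinct cs" "cs \<noteq> []"
  shows "\<exists>I \<iota>. aug_kernel G H I \<iota>"
proof -
  obtain n where n: "length cs = Suc n" using assms(5) by (metis length_Suc_conv list.exhaust)
  let ?E = "mat 1 (Suc n) (\<lambda>_. 1) :: int mat"
  have E: "?E \<in> carrier_mat 1 (Suc n)" "?E $$ (0, 0) = 1" by simp_all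
  obtain i r e where i: "i \<in> carrier_mat (Suc n) n" and r: "r \<in> carrier_mat n (Suc n)"
    and e: "e \<in> carrier_mat (Suc n) 1"
    and ri: "r * i = 1\<^sub>m n" and ir: "i * r + e * ?E = 1\<^sub>m (Suc n)" and Ei: "?E * i = 0\<^sub>m 1 n"
    by (rule unimodular_row_split[OF E])
  let ?M = "list_lat cs act"
  have M: "G_lattice G ?M" by (rule G_lattice_list_lat[OF assms(3,4)])
  have Mc: "snd ?M g \<in> carrier_mat (Suc n) (Suc n)" if "g \<in> carrier G" for g
    using G_lattice_carrier[OF M that] n by simp
  have EM: "?E * snd ?M g = ?E" if g: "g \<in> carrier G" for g
  proof -
    have "?E = kmat (\<lambda>_ _. 1) [()] cs" by (auto simp: kmat_def n)
    then show ?thesis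
      using acts_onD(1)[OF assms(3) g] by (simp add: list_lat_def kmat_mult_graph[OF assms(4)])
  qed
  have Ev: "(\<Sum>l<Suc n. v $ l) = (?E *\<^sub>v v) $ 0" if "v \<in> carrier_vec (Suc n)" for v :: "int vec"
    using that by (simp add: scalar_prod_def atLeast0LessThan del: sum.lessThan_Suc)
  let ?I = "(n, \<lambda>g. r * (snd ?M g * i))"
  have I: "G_lattice G ?I" "lat_hom G ?I ?M i"
    using G_lattice_sublattice[OF M, of i n r] i r ri assms(1) n
      invariant_functional_stable[OF ir Ei EM _ i r e E(1)] Mc by auto
  have "aug_kernel G H ?I i"
    unfolding aug_kernel_def assms(2)
  proof (intro conjI ballI impI I)
    fix u assume "u \<in> carrier_vec (fst ?I)" "i *\<^sub>v u = 0\<^sub>v (fst ?M)"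
    then show "u = 0\<^sub>v (fst ?I)"
      using assoc_mult_mat_vec[OF r i, of u] ri r n by (auto simp: right_mult_zero_mat)
  next
    fix v :: "int vec" assume "v \<in> carrier_vec (fst ?M)"
    then have v: "v \<in> carrier_vec (Suc n)" by (simp add: n)
    show "(\<Sum>l<fst ?M. v $ l) = 0 \<longleftrightarrow> (\<exists>u\<in>carrier_vec (fst ?I). i *\<^sub>v u = v)"
    proof
      assume "(\<Sum>l<fst ?M. v $ l) = 0"
      then have "(?E *\<^sub>v v) $ 0 = 0" using Ev[OF v] by (simp add: n del: sum.lessThan_Suc)
      then have E0: "?E *\<^sub>v v = 0\<^sub>v 1" by (intro eq_vecI) auto
      have "v = (i * r + e * ?E) *\<^sub>v v" unfolding ir using v by simp
      also have "\<dots> = (i * r) *\<^sub>v v + (e * ?E) *\<^sub>v v"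
        using i r e v by (intro add_mult_distrib_mat_vec[of _ "Suc n" "Suc n"]) auto
      also have "(e * ?E) *\<^sub>v v = e *\<^sub>v (?E *\<^sub>v v)"
        by (rule assoc_mult_mat_vec[OF e E(1) v])
      also have "\<dots> = 0\<^sub>v (Suc n)" unfolding E0 using e by (intro eq_vecI) (auto simp: scalar_prod_def)
      also have "(i * r) *\<^sub>v v = i *\<^sub>v (r *\<^sub>v v)"
        by (rule assoc_mult_mat_vec[OF i r v])
      finally have "i *\<^sub>v (r *\<^sub>v v) = v" using i r v by simp
      then show "\<exists>u\<in>carrier_vec (fst ?I). i *\<^sub>v u = v" using r v by (intro bexI[of _ "r *\<^sub>v v"]) auto
    next
      assume "\<exists>u\<in>carrier_vec (fst ?I). i *\<^sub>v u = v"
      then obtain u where u: "u \<in> carrier_vec n" "i *\<^sub>v u = v" by auto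
      have "?E *\<^sub>v v = 0\<^sub>m 1 n *\<^sub>v u"
        using assoc_mult_mat_vec[OF E(1) i u(1)] u(2) Ei by simp
      then have "(?E *\<^sub>v v) $ 0 = 0" using u(1) by (simp add: scalar_prod_def)
      then show "(\<Sum>l<fst ?M. v $ l) = 0" using Ev[OF v] by (simp add: n del: sum.lessThan_Suc)
    qed
  qed
  then show ?thesis by blast
qed

text \<open>The Chevalley module is the quotient of the coset lattice by the line of the all-ones
  vector, with the transposed inclusion of the augmentation kernel as quotient map. By
  \<open>D0\<close> the map \<open>D\<close> factors through this quotient, and by
  \<open>hom\<close> its kernel is exactly that line, so the factor is injective with the same
  image.\<close>

lemma chevalley_short_exact:
  assumes "group G" "coset_lat G H = list_lat cs act" "acts_on G act (set cs)" "distinct cs" "cs \<noteq> []"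
    and P: "G_lattice G P" and F: "G_lattice G F"
    and D: "lat_hom G (list_lat cs act) P D" and B: "lat_hom G P F B"
    and surj: "\<forall>w\<in>carrier_vec (fst F). \<exists>v\<in>carrier_vec (fst P). B *\<^sub>v v = w"
    and exact: "\<forall>v\<in>carrier_vec (fst P). B *\<^sub>v v = 0\<^sub>v (fst F) \<longleftrightarrow>
      (\<exists>w\<in>carrier_vec (length cs). D *\<^sub>v w = v)"
    and K: "K \<in> carrier_mat (length cs) (fst P)" and q: "q \<in> carrier_mat 1 (length cs)"
    and D0: "D * mat (length cs) 1 (\<lambda>_. 1) = 0\<^sub>m (fst P) 1"
    and hom: "K * D + mat (length cs) 1 (\<lambda>_. 1) * q = 1\<^sub>m (length cs)"
  shows "\<exists>A. short_exact G (chevalley_J G H) A P B F"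
proof -
  interpret group G by fact
  let ?n = "length cs" and ?M = "list_lat cs act" and ?N = "mat (length cs) 1 (\<lambda>_. 1) :: int mat"
  let ?O = "mat 1 (length cs) (\<lambda>_. 1) :: int mat"
  define I where "I = aug_ideal G H"
  have "\<exists>\<iota>. aug_kernel G H I \<iota>"
    unfolding I_def aug_ideal_def by (rule someI_ex[OF aug_kernel_exists[OF assms(1-5)]])
  then obtain \<iota> where \<iota>: "aug_kernel G H I \<iota>" by blast
  have nM: "fst (coset_lat G H) = ?n" by (simp add: assms(2))
  define k where "k = fst I"
  obtain r e where r: "r \<in> carrier_mat k ?n" and e: "e \<in> carrier_mat ?n 1" and i: "\<iota> \<in> carrier_mat ?n k"
    and ri: "r * \<iota> = 1\<^sub>m k" and ir: "\<iota> * r + e * ?O = 1\<^sub>m ?n" and Oi: "?O * \<iota> = 0\<^sub>m 1 k"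
    using aug_kernel_splitting[OF \<iota>] assms(5) unfolding nM k_def by auto
  have I: "G_lattice G I" and \<iota>hom: "lat_hom G I ?M \<iota>"
    using \<iota> unfolding aug_kernel_def assms(2) by auto
  have J: "chevalley_J G H = lat_dual G I" by (simp add: chevalley_J_def I_def)
  have fstJ: "fst (lat_dual G I) = k" by (simp add: lat_dual_def k_def)
  have M: "G_lattice G ?M" by (rule G_lattice_list_lat[OF assms(3,4)])
  let ?p = "fst P"
  have Dc: "D \<in> carrier_mat ?p ?n" using D by (simp add: lat_hom_def)
  have ON: "transpose_mat ?O = ?N" by (rule eq_matI) auto
  \<comment> \<open>The transpose of \<open>r\<close> is a section of the quotient map, in general
    not an equivariant one. Composition with \<open>D\<close> removes the dependence on the
    section.\<close>
  let ?A = "D * transpose_mat r"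
  have rT: "transpose_mat r \<in> carrier_mat ?n k" and iT: "transpose_mat \<iota> \<in> carrier_mat k ?n"
    using r i by auto
  have Ac: "?A \<in> carrier_mat ?p k" using Dc rT by simp
  have hA: "lat_hom G (lat_dual G I) P ?A"
    unfolding lat_hom_def fstJ
  proof (intro conjI ballI Ac)
    fix g assume g: "g \<in> carrier G"
    let ?g = "inv\<^bsub>G\<^esub> g"
    have Ig: "snd I ?g \<in> carrier_mat k k" and Mg: "snd ?M ?g \<in> carrier_mat ?n ?n"
      and Mg': "snd ?M g \<in> carrier_mat ?n ?n" and Pg: "snd P g \<in> carrier_mat ?p ?p"
      using G_lattice_carrier[OF I, of ?g] G_lattice_carrier[OF M, of ?g] G_lattice_carrier[OF M, of g]
        G_lattice_carrier[OF P g] g by (auto simp: k_def)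
    \<comment> \<open>Permutation matrices are orthogonal, so in this basis the coset lattice is its
      own dual.\<close>
    have MT: "snd ?M g = transpose_mat (snd ?M ?g)"
      unfolding list_lat_def snd_conv kmat_transpose
      by (rule kmat_cong) (use acts_on_eq_iff[OF assms(1,3) g] in auto)
    have "r * snd ?M ?g * \<iota> * r + r * snd ?M ?g * e * ?O = r * snd ?M ?g"
      by (rule split_mult_right[OF ir]) (use r e i Mg in auto)
    moreover have "r * snd ?M ?g * \<iota> = snd I ?g"
    proof -
      have "r * snd ?M ?g * \<iota> = r * (\<iota> * snd I ?g)"
        using \<iota>hom g r Mg i by (simp add: mat_assoc lat_hom_def)
      also have "\<dots> = snd I ?g" using assoc_mult_mat[OF r i Ig] ri Ig by simp
      finally show ?thesis .
    qed
    ultimately have *: "snd I ?g * r + r * snd ?M ?g * e * ?O = r * snd ?M ?g" by simp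
    have "snd P g * ?A = D * snd ?M g * transpose_mat r"
      using D g assoc_mult_mat[OF Pg Dc rT] by (simp add: lat_hom_def)
    also have "\<dots> = D * transpose_mat (r * snd ?M ?g)"
      using transpose_mult[OF r Mg] MT assoc_mult_mat[OF Dc Mg' rT] by simp
    also have "transpose_mat (r * snd ?M ?g)
        = transpose_mat (snd I ?g * r) + transpose_mat (r * snd ?M ?g * e * ?O)"
      by (subst *[symmetric], rule transpose_add[of _ k ?n]) (use r e Ig Mg in auto)
    also have "D * (transpose_mat (snd I ?g * r) + transpose_mat (r * snd ?M ?g * e * ?O))
        = D * transpose_mat (snd I ?g * r) + D * transpose_mat (r * snd ?M ?g * e * ?O)"
      using Dc r e Ig Mg by (intro mult_add_distrib_mat[of _ ?p ?n _ k]) auto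
    \<comment> \<open>The failure of \<open>r\<close> to be equivariant transposes to multiples of
      the all-ones vector, and \<open>D\<close> kills these.\<close>
    also have "D * transpose_mat (r * snd ?M ?g * e * ?O) = D * (?N * transpose_mat (r * snd ?M ?g * e))"
      unfolding ON[symmetric]
      by (rule arg_cong[where f="\<lambda>X. D * X"], rule transpose_mult[of _ k 1]) (use r e Mg in auto)
    also have "\<dots> = D * ?N * transpose_mat (r * snd ?M ?g * e)"
      using r e Mg Dc by (intro assoc_mult_mat[symmetric, of _ ?p ?n _ 1 _ k]) auto
    also have "\<dots> = 0\<^sub>m ?p k"
      unfolding D0 using r e Mg by (intro left_mult_zero_mat) auto
    also have "D * transpose_mat (snd I ?g * r) = ?A * transpose_mat (snd I ?g)"
      using transpose_mult[OF Ig r] assoc_mult_mat[OF Dc rT, of "transpose_mat (snd I ?g)" k] Ig by simp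
    also have "?A * transpose_mat (snd I ?g) + 0\<^sub>m ?p k = ?A * transpose_mat (snd I ?g)"
      using Ac Ig by (intro right_add_zero_mat) auto
    finally show "?A * snd (lat_dual G I) g = snd P g * ?A"
      by (simp add: lat_dual_def)
  qed
  have id_vec: "transpose_mat \<iota> *\<^sub>v (transpose_mat r *\<^sub>v u) = u" if u: "u \<in> carrier_vec k" for u
  proof -
    have "transpose_mat \<iota> * transpose_mat r = 1\<^sub>m k"
      using transpose_mult[OF r i] ri by (simp add: transpose_one)
    then show ?thesis using assoc_mult_mat_vec[OF iT rT u] u by simp
  qed
  have N: "?N \<in> carrier_mat ?n 1" by simp
  have iN: "transpose_mat \<iota> * ?N = 0\<^sub>m k 1"
  proof -
    have "transpose_mat (?O * \<iota>) = transpose_mat \<iota> * ?N"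
      unfolding ON[symmetric] by (rule transpose_mult[of _ 1 ?n]) (use i in auto)
    then show ?thesis unfolding Oi by simp
  qed
  have D_ker: "w = ?N *\<^sub>v (q *\<^sub>v w)" if w: "w \<in> carrier_vec ?n" and "D *\<^sub>v w = 0\<^sub>v ?p" for w
  proof -
    have "w = (K * D + ?N * q) *\<^sub>v w" unfolding hom using w by simp
    also have "\<dots> = (K * D) *\<^sub>v w + (?N * q) *\<^sub>v w"
      using K Dc q w by (intro add_mult_distrib_mat_vec[of _ ?n ?n]) auto
    also have "(K * D) *\<^sub>v w = K *\<^sub>v (D *\<^sub>v w)" by (rule assoc_mult_mat_vec[OF K Dc w])
    also have "\<dots> = 0\<^sub>v ?n" unfolding that(2) using K by (intro eq_vecI) (auto simp: scalar_prod_def)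
    also have "(?N * q) *\<^sub>v w = ?N *\<^sub>v (q *\<^sub>v w)" by (rule assoc_mult_mat_vec[OF N q w])
    also have "0\<^sub>v ?n + ?N *\<^sub>v (q *\<^sub>v w) = ?N *\<^sub>v (q *\<^sub>v w)"
      by (rule left_zero_vec[OF mult_mat_vec_carrier[OF N mult_mat_vec_carrier[OF q w]]])
    finally show ?thesis .
  qed
  \<comment> \<open>The lift of \<open>u\<close> by the transpose of \<open>r\<close> lies in the
    kernel of \<open>D\<close>, so it is a multiple of the all-ones vector. The quotient map sends
    it to zero, but also back to \<open>u\<close>.\<close>
  have inj: "u = 0\<^sub>v k" if u: "u \<in> carrier_vec k" and 0: "?A *\<^sub>v u = 0\<^sub>v ?p" for u
  proof -
    let ?w = "transpose_mat r *\<^sub>v u"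
    have w: "?w \<in> carrier_vec ?n" using rT u by simp
    have "D *\<^sub>v ?w = 0\<^sub>v ?p" using 0 assoc_mult_mat_vec[OF Dc rT u] by simp
    then have "?w = ?N *\<^sub>v (q *\<^sub>v ?w)" by (rule D_ker[OF w])
    then have "u = transpose_mat \<iota> *\<^sub>v (?N *\<^sub>v (q *\<^sub>v ?w))" using id_vec[OF u] by simp
    also have "\<dots> = (transpose_mat \<iota> * ?N) *\<^sub>v (q *\<^sub>v ?w)"
      using assoc_mult_mat_vec[OF iT N, of "q *\<^sub>v ?w"] q w by simp
    also have "\<dots> = 0\<^sub>v k" unfolding iN using q w by (intro eq_vecI) (auto simp: scalar_prod_def)
    finally show ?thesis .
  qed
  \<comment> \<open>Transposing the splitting of the augmentation kernel shows that \<open>D\<close>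
    is \<open>?A\<close> after the quotient map, because \<open>D\<close> kills the all-ones
    part.\<close>
  have DA: "D *\<^sub>v w = ?A *\<^sub>v (transpose_mat \<iota> *\<^sub>v w)" if w: "w \<in> carrier_vec ?n" for w
  proof -
    have "transpose_mat (\<iota> * r + e * ?O) = 1\<^sub>m ?n" unfolding ir by (rule transpose_one)
    moreover have "transpose_mat (\<iota> * r + e * ?O) = transpose_mat (\<iota> * r) + transpose_mat (e * ?O)"
      by (rule transpose_add[of _ ?n ?n]) (use i r e in auto)
    moreover have "transpose_mat (e * ?O) = ?N * transpose_mat e"
      unfolding ON[symmetric] by (rule transpose_mult[OF e, of _ ?n]) simp
    ultimately have 1: "transpose_mat r * transpose_mat \<iota> + ?N * transpose_mat e = 1\<^sub>m ?n"
      unfolding transpose_mult[OF i r] by metis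
    have "D * (transpose_mat r * transpose_mat \<iota> + ?N * transpose_mat e)
        = D * (transpose_mat r * transpose_mat \<iota>) + D * (?N * transpose_mat e)"
      using Dc rT iT e by (intro mult_add_distrib_mat[of _ ?p ?n _ ?n]) auto
    also have "D * (?N * transpose_mat e) = D * ?N * transpose_mat e"
      using Dc e by (intro assoc_mult_mat[symmetric, of _ ?p ?n _ 1 _ ?n]) auto
    also have "\<dots> = 0\<^sub>m ?p ?n" unfolding D0 using e by (intro left_mult_zero_mat) auto
    also have "D * (transpose_mat r * transpose_mat \<iota>) + 0\<^sub>m ?p ?n = ?A * transpose_mat \<iota>"
      using assoc_mult_mat[OF Dc rT iT] Dc rT iT by simp
    finally have "D = ?A * transpose_mat \<iota>" unfolding 1 using Dc by simp
    then show ?thesis using assoc_mult_mat_vec[OF Ac iT w] by simp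
  qed
  have AD: "?A *\<^sub>v u = D *\<^sub>v (transpose_mat r *\<^sub>v u)" if "u \<in> carrier_vec k" for u
    by (rule assoc_mult_mat_vec[OF Dc rT that])
  have exact': "(\<exists>w\<in>carrier_vec ?n. D *\<^sub>v w = v) \<longleftrightarrow> (\<exists>u\<in>carrier_vec k. ?A *\<^sub>v u = v)" for v
  proof
    assume "\<exists>w\<in>carrier_vec ?n. D *\<^sub>v w = v"
    then obtain w where w: "w \<in> carrier_vec ?n" "D *\<^sub>v w = v" by blast
    show "\<exists>u\<in>carrier_vec k. ?A *\<^sub>v u = v"
      by (rule bexI[of _ "transpose_mat \<iota> *\<^sub>v w"]) (use w DA[OF w(1)] iT in auto)
  next
    assume "\<exists>u\<in>carrier_vec k. ?A *\<^sub>v u = v"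
    then obtain u where u: "u \<in> carrier_vec k" "?A *\<^sub>v u = v" by blast
    show "\<exists>w\<in>carrier_vec ?n. D *\<^sub>v w = v"
      by (rule bexI[of _ "transpose_mat r *\<^sub>v u"]) (use u AD[OF u(1)] rT in auto)
  qed
  have "short_exact G (lat_dual G I) ?A P B F"
    unfolding short_exact_def fstJ
  proof (intro conjI ballI impI)
    show "G_lattice G (lat_dual G I)" by (rule G_lattice_dual[OF assms(1) I])
    fix w :: "int vec" assume "w \<in> carrier_vec (fst F)"
    then show "\<exists>v\<in>carrier_vec (fst P). B *\<^sub>v v = w" using surj by blast
  next
    fix v :: "int vec" assume "v \<in> carrier_vec (fst P)"
    then show "(B *\<^sub>v v = 0\<^sub>v (fst F)) = (\<exists>u\<in>carrier_vec k. ?A *\<^sub>v u = v)"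
      using exact exact' by blast
  qed (use P F hA B inj in auto)
  then show ?thesis unfolding J by blast
qed

section \<open>Permutations and self-maps of six points as lists\<close>

text \<open>A list of length six is the self-map sending \<open>i\<close> to its \<open>i\<close>-th
  entry. Position 0 is a dummy: it keeps the points 1, ..., 5 of \<open>alt_group 5\<close> at their
  own positions and leaves room for two disjoint encodings of the same action.\<close>

definition lcomp :: "nat list \<Rightarrow> nat list \<Rightarrow> nat list" where
  "lcomp l m = map ((!) l) m"

definition linv :: "nat list \<Rightarrow> nat list" where
  "linv l = map (\<lambda>i. length (takeWhile (\<lambda>j. j \<noteq> i) l)) [0..<6]"

definition lconj :: "nat list \<Rightarrow> nat list \<Rightarrow> nat list" where
  "lconj g x = lcomp g (lcomp x (linv g))"

text \<open>The exact factorization \<open>C\<^sub>5 C\<^sub>3 V\<^sub>4\<close> of the alternating group on the points 1, ..., 5.\<close>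

definition V4_list :: "nat list list" where
  "V4_list = [[0, 1, 2, 3, 4, 5], [0, 2, 1, 4, 3, 5], [0, 3, 4, 1, 2, 5], [0, 4, 3, 2, 1, 5]]"

definition C3_list :: "nat list list" where
  "C3_list = [[0, 1, 2, 3, 4, 5], [0, 2, 3, 1, 4, 5], [0, 3, 1, 2, 4, 5]]"

definition C5_list :: "nat list list" where
  "C5_list = [[0, 1, 2, 3, 4, 5], [0, 2, 3, 4, 5, 1], [0, 3, 4, 5, 1, 2], [0, 4, 5, 1, 2, 3], [0, 5, 1, 2, 3, 4]]"

definition lprod :: "nat list list \<Rightarrow> nat list list \<Rightarrow> nat list list" where
  "lprod A B = [lcomp a b. a \<leftarrow> A, b \<leftarrow> B]"

definition A5_list :: "nat list list" where
  "A5_list = lprod C5_list (lprod C3_list V4_list)"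

text \<open>Every G-set used below is a conjugacy orbit of self-maps of \<open>{0, ..., 5}\<close>. Besides classes of
  permutations this gives two copies of the natural 5-point action: the maps constant on
  \<open>{1, ..., 5}\<close> that fix 0, and the constant maps. By the factorization above and
  \<open>C\<^sub>3 V\<^sub>4 = V\<^sub>4 C\<^sub>3\<close>, the lists \<open>R\<close> are transversals of the stabilizers.\<close>

definition t0 :: "nat list" where "t0 = [0, 2, 1, 4, 3, 5]"
definition c0 :: "nat list" where "c0 = [0, 2, 3, 1, 4, 5]"
definition R15 :: "nat list list" where "R15 = lprod C5_list C3_list"
definition R20 :: "nat list list" where "R20 = lprod C5_list V4_list"
definition R12 :: "nat list list" where "R12 = lprod C3_list V4_list"

definition X15 :: "nat list list" where "X15 = map (\<lambda>g. lconj g t0) R15"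
definition X20 :: "nat list list" where "X20 = map (\<lambda>g. lconj g c0) R20"
definition X12 :: "nat list list" where "X12 = map (\<lambda>g. lconj g [0, 2, 3, 4, 5, 1]) R12"
definition X5 :: "nat list list" where "X5 = map (\<lambda>g. lconj g [0, 5, 5, 5, 5, 5]) C5_list"
definition X5' :: "nat list list" where "X5' = map (\<lambda>g. lconj g [5, 5, 5, 5, 5, 5]) C5_list"

definition P_list :: "nat list list" where "P_list = X15 @ X20"
definition Q_list :: "nat list list" where "Q_list = X12 @ X5 @ X5'"

section \<open>The differentials and their contracting homotopy\<close>

text \<open>Orbits of the group on pairs with first component in the orbit of \<open>x\<close>
  correspond to orbits of the stabilizer of \<open>x\<close> on second components. Combinations of
  their sums are the possible images of the base point under equivariant maps.\<close>

definition stab_orbit :: "nat list \<Rightarrow> nat list \<Rightarrow> nat list list" where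
  "stab_orbit x y = remdups (map (\<lambda>g. lconj g y) (filter (\<lambda>g. lconj g x = x) A5_list))"

text \<open>The image of the base point determines an equivariant map on its orbit; the translates
  of that image along the transversal \<open>R\<close> are the columns.\<close>

definition orbital_rows :: "(int \<times> nat list) list \<Rightarrow> nat list \<Rightarrow> nat list list \<Rightarrow> nat list list \<Rightarrow> int list list" where
  "orbital_rows T x R ys = (let Ss = map (\<lambda>(c, y). (c, stab_orbit x y)) T;
     ims = map (\<lambda>g. map (\<lambda>(c, S). (c, map (lconj g) S)) Ss) R
     in map (\<lambda>y. map (\<lambda>im. \<Sum>(c, zs)\<leftarrow>im. if y \<in> set zs then c else 0) ims) ys)"

text \<open>An entry \<open>(c, y)\<close> of a table contributes \<open>c\<close> times the sum over the stabilizer orbit of \<open>y\<close> to the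
  image of the base point: \<open>T1\<close> and \<open>T2\<close> give the images of \<open>t0\<close>, \<open>T3\<close> that of \<open>c0\<close>. The tables were found
  by a computer search.\<close>

definition T1 :: "(int \<times> nat list) list" where
  "T1 = [(1, [0, 2, 1, 4, 3, 5]), (-1, [0, 4, 3, 2, 1, 5]), (1, [0, 2, 3, 1, 4, 5]), (-1, [0, 1, 3, 5, 4, 2])]"

definition T2 :: "(int \<times> nat list) list" where
  "T2 = [(1, [0, 4, 3, 1, 5, 2]), (1, [0, 5, 5, 5, 5, 5])]"

definition T3 :: "(int \<times> nat list) list" where
  "T3 = [(1, [0, 2, 3, 4, 5, 1]), (1, [4, 4, 4, 4, 4, 4])]"

definition D1 :: "int list list" where
  "D1 = [[1, 0, -1, 0, 0, 0, 0, 0, 0, 0, 0, 0, 0, 0, 0],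
   [-1, 1, 0, 0, 0, 0, 0, 0, 0, 0, 0, 0, 0, 0, 0],
   [0, -1, 1, 0, 0, 0, 0, 0, 0, 0, 0, 0, 0, 0, 0],
   [0, 0, 0, 1, 0, -1, 0, 0, 0, 0, 0, 0, 0, 0, 0],
   [0, 0, 0, -1, 1, 0, 0, 0, 0, 0, 0, 0, 0, 0, 0],
   [0, 0, 0, 0, -1, 1, 0, 0, 0, 0, 0, 0, 0, 0, 0],
   [0, 0, 0, 0, 0, 0, 1, 0, -1, 0, 0, 0, 0, 0, 0],
   [0, 0, 0, 0, 0, 0, -1, 1, 0, 0, 0, 0, 0, 0, 0],
   [0, 0, 0, 0, 0, 0, 0, -1, 1, 0, 0, 0, 0, 0, 0],
   [0, 0, 0, 0, 0, 0, 0, 0, 0, 1, 0, -1, 0, 0, 0],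
   [0, 0, 0, 0, 0, 0, 0, 0, 0, -1, 1, 0, 0, 0, 0],
   [0, 0, 0, 0, 0, 0, 0, 0, 0, 0, -1, 1, 0, 0, 0],
   [0, 0, 0, 0, 0, 0, 0, 0, 0, 0, 0, 0, 1, 0, -1],
   [0, 0, 0, 0, 0, 0, 0, 0, 0, 0, 0, 0, -1, 1, 0],
   [0, 0, 0, 0, 0, 0, 0, 0, 0, 0, 0, 0, 0, -1, 1],
   [1, 1, 1, 0, 0, -1, -1, 0, 0, 0, 0, -1, 0, 0, 0],
   [1, 1, 1, 0, -1, 0, 0, -1, 0, 0, 0, 0, -1, 0, 0],
   [1, 1, 1, -1, 0, 0, 0, 0, 0, 0, -1, 0, 0, -1, 0],
   [1, 1, 1, 0, 0, 0, 0, 0, -1, -1, 0, 0, 0, 0, -1],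
   [0, 0, 0, 1, 1, 1, 0, 0, -1, -1, 0, 0, 0, 0, -1],
   [-1, 0, 0, 1, 1, 1, 0, -1, 0, 0, -1, 0, 0, 0, 0],
   [0, -1, 0, 1, 1, 1, -1, 0, 0, 0, 0, 0, 0, -1, 0],
   [0, 0, -1, 1, 1, 1, 0, 0, 0, 0, 0, -1, -1, 0, 0],
   [0, 0, -1, 0, 0, 0, 1, 1, 1, 0, 0, -1, -1, 0, 0],
   [0, 0, 0, -1, 0, 0, 1, 1, 1, 0, -1, 0, 0, -1, 0],
   [0, -1, 0, 0, -1, 0, 1, 1, 1, -1, 0, 0, 0, 0, 0],
   [-1, 0, 0, 0, 0, -1, 1, 1, 1, 0, 0, 0, 0, 0, -1],
   [-1, 0, 0, 0, 0, -1, 0, 0, 0, 1, 1, 1, 0, 0, -1],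
   [0, -1, 0, 0, 0, 0, -1, 0, 0, 1, 1, 1, 0, -1, 0],
   [0, 0, 0, 0, -1, 0, 0, -1, 0, 1, 1, 1, -1, 0, 0],
   [0, 0, -1, -1, 0, 0, 0, 0, -1, 1, 1, 1, 0, 0, 0],
   [0, 0, -1, -1, 0, 0, 0, 0, -1, 0, 0, 0, 1, 1, 1],
   [0, -1, 0, 0, -1, 0, 0, 0, 0, -1, 0, 0, 1, 1, 1],
   [-1, 0, 0, 0, 0, 0, 0, -1, 0, 0, -1, 0, 1, 1, 1],
   [0, 0, 0, 0, 0, -1, -1, 0, 0, 0, 0, -1, 1, 1, 1]]"

definition D2 :: "int list list" where
  "D2 = [[0, 0, 1, 0, 0, 1, 0, 0, 1, 0, 0, 1, 0, 0, 1, 1, 0, 0, 0, 1, 0, 0, 0, 1, 0, 0, 0, 1, 0, 0, 0, 1, 0, 0, 0],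
   [0, 0, 1, 1, 0, 0, 0, 1, 0, 0, 1, 0, 1, 0, 0, 0, 1, 0, 0, 0, 0, 0, 1, 0, 1, 0, 0, 0, 0, 0, 1, 0, 0, 1, 0],
   [0, 0, 1, 1, 0, 0, 0, 1, 0, 0, 1, 0, 1, 0, 0, 0, 0, 1, 0, 0, 1, 0, 0, 1, 0, 0, 0, 0, 0, 1, 0, 1, 0, 0, 0],
   [0, 0, 1, 0, 0, 1, 0, 0, 1, 0, 0, 1, 0, 0, 1, 0, 0, 0, 1, 0, 0, 0, 1, 0, 0, 0, 1, 0, 0, 0, 1, 0, 0, 0, 1],
   [1, 0, 0, 0, 0, 1, 1, 0, 0, 0, 1, 0, 0, 1, 0, 1, 0, 0, 0, 0, 0, 1, 0, 0, 1, 0, 0, 1, 0, 0, 0, 0, 0, 1, 0],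
   [1, 0, 0, 0, 1, 0, 0, 1, 0, 1, 0, 0, 0, 0, 1, 0, 0, 0, 1, 0, 1, 0, 0, 0, 0, 0, 1, 0, 0, 1, 0, 0, 1, 0, 0],
   [1, 0, 0, 0, 1, 0, 0, 1, 0, 1, 0, 0, 0, 0, 1, 0, 1, 0, 0, 1, 0, 0, 0, 0, 0, 1, 0, 1, 0, 0, 0, 0, 0, 1, 0],
   [1, 0, 0, 0, 0, 1, 1, 0, 0, 0, 1, 0, 0, 1, 0, 0, 0, 1, 0, 0, 1, 0, 0, 0, 0, 0, 1, 0, 1, 0, 0, 0, 0, 0, 1],
   [0, 1, 0, 0, 1, 0, 1, 0, 0, 0, 0, 1, 1, 0, 0, 1, 0, 0, 0, 0, 0, 1, 0, 1, 0, 0, 0, 0, 0, 1, 0, 0, 1, 0, 0],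
   [0, 1, 0, 1, 0, 0, 0, 0, 1, 1, 0, 0, 0, 1, 0, 0, 0, 1, 0, 1, 0, 0, 0, 0, 0, 1, 0, 0, 1, 0, 0, 1, 0, 0, 0],
   [0, 1, 0, 1, 0, 0, 0, 0, 1, 1, 0, 0, 0, 1, 0, 0, 0, 0, 1, 0, 0, 1, 0, 0, 1, 0, 0, 0, 0, 0, 1, 0, 1, 0, 0],
   [0, 1, 0, 0, 1, 0, 1, 0, 0, 0, 0, 1, 1, 0, 0, 0, 1, 0, 0, 0, 0, 0, 1, 0, 0, 1, 0, 0, 1, 0, 0, 0, 0, 0, 1],
   [1, 1, 1, 0, 0, 0, 0, 0, 0, 0, 0, 0, 0, 0, 0, 0, 0, 0, 0, 0, 0, 0, 0, 0, 0, 0, 0, 0, 0, 0, 0, 0, 0, 0, 0],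
   [0, 0, 0, 1, 1, 1, 0, 0, 0, 0, 0, 0, 0, 0, 0, 0, 0, 0, 0, 0, 0, 0, 0, 0, 0, 0, 0, 0, 0, 0, 0, 0, 0, 0, 0],
   [0, 0, 0, 0, 0, 0, 1, 1, 1, 0, 0, 0, 0, 0, 0, 0, 0, 0, 0, 0, 0, 0, 0, 0, 0, 0, 0, 0, 0, 0, 0, 0, 0, 0, 0],
   [0, 0, 0, 0, 0, 0, 0, 0, 0, 1, 1, 1, 0, 0, 0, 0, 0, 0, 0, 0, 0, 0, 0, 0, 0, 0, 0, 0, 0, 0, 0, 0, 0, 0, 0],
   [0, 0, 0, 0, 0, 0, 0, 0, 0, 0, 0, 0, 1, 1, 1, 0, 0, 0, 0, 0, 0, 0, 0, 0, 0, 0, 0, 0, 0, 0, 0, 0, 0, 0, 0],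
   [0, 0, 0, 0, 0, 0, 0, 0, 0, 0, 0, 0, 0, 0, 0, 0, 0, 0, 0, 1, 0, 0, 0, 0, 1, 0, 0, 0, 0, 1, 0, 0, 0, 0, 1],
   [0, 0, 0, 0, 0, 0, 0, 0, 0, 0, 0, 0, 0, 0, 0, 0, 0, 0, 1, 0, 0, 0, 0, 1, 0, 0, 0, 0, 1, 0, 0, 0, 0, 1, 0],
   [0, 0, 0, 0, 0, 0, 0, 0, 0, 0, 0, 0, 0, 0, 0, 0, 0, 1, 0, 0, 0, 0, 1, 0, 0, 0, 0, 1, 0, 0, 0, 0, 1, 0, 0],
   [0, 0, 0, 0, 0, 0, 0, 0, 0, 0, 0, 0, 0, 0, 0, 0, 1, 0, 0, 0, 0, 1, 0, 0, 0, 0, 1, 0, 0, 0, 0, 1, 0, 0, 0],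
   [0, 0, 0, 0, 0, 0, 0, 0, 0, 0, 0, 0, 0, 0, 0, 1, 0, 0, 0, 0, 1, 0, 0, 0, 0, 1, 0, 0, 0, 0, 1, 0, 0, 0, 0]]"

lemma D1_rows: "orbital_rows T1 t0 R15 P_list = D1"
  by code_simp

lemma D2_rows: "map2 (@) (orbital_rows T2 t0 R15 Q_list) (orbital_rows T3 c0 R20 Q_list) = D2"
  by code_simp

text \<open>The homotopies are the inverses of a unimodular minor of \<open>D1\<close> (without its first column) and of the
  complementary minor of \<open>D2\<close> (without its first row), extended by zero.\<close>

definition H1 :: "int list list" where
  "H1 = [[0, 0, 0, 0, 0, 0, 0, 0, 0, 0, 0, 0, 0, 0, 0, 0, 0, 0, 0, 0, 0, 0, 0, 0, 0, 0, 0, 0, 0, 0, 0, 0, 0, 0, 0],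
   [0, 1, 0, 0, 0, 0, 0, 0, 0, 0, 0, 0, 0, 0, 0, 0, 0, 0, 0, 0, 0, 0, 0, 0, 0, 0, 0, 0, 0, 0, 0, 0, 0, 0, 0],
   [-1, 0, 0, 0, 0, 0, 0, 0, 0, 0, 0, 0, 0, 0, 0, 0, 0, 0, 0, 0, 0, 0, 0, 0, 0, 0, 0, 0, 0, 0, 0, 0, 0, 0, 0],
   [0, 1, 0, 1, 0, 1, 1, 0, 1, 0, 0, 0, 0, 1, 0, 0, 0, 0, 0, 0, 0, 0, 0, 0, 0, 0, 0, 0, 1, -1, 0, 0, 0, 0, 0],
   [0, 1, 0, 0, 0, 0, 1, 0, 1, 0, 0, 0, 0, 1, 0, 0, 0, 0, 0, 0, 0, 0, 0, 0, 0, 0, 0, 0, 1, -1, 0, 0, 0, 0, 0],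
   [0, 1, 0, 0, 0, 1, 1, 0, 1, 0, 0, 0, 0, 1, 0, 0, 0, 0, 0, 0, 0, 0, 0, 0, 0, 0, 0, 0, 1, -1, 0, 0, 0, 0, 0],
   [0, 0, 0, 0, 0, 1, 1, 0, 1, 0, 0, 0, -1, 0, 0, 0, 0, 0, 0, 0, 0, 0, 0, 0, 0, 0, 0, 1, 0, -1, 0, 0, 0, 0, 0],
   [0, 0, 0, 0, 0, 1, 0, 0, 0, 0, 0, 0, -1, 0, 0, 0, 0, 0, 0, 0, 0, 0, 0, 0, 0, 0, 0, 1, 0, -1, 0, 0, 0, 0, 0],
   [0, 0, 0, 0, 0, 1, 0, 0, 1, 0, 0, 0, -1, 0, 0, 0, 0, 0, 0, 0, 0, 0, 0, 0, 0, 0, 0, 1, 0, -1, 0, 0, 0, 0, 0],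
   [-3, -2, 0, 3, 0, 3, -1, 0, 2, 0, 0, 0, -1, 0, 0, 0, 0, 0, 0, 0, 0, 0, 0, 0, 0, 0, 0, 0, -1, -2, 3, 0, -1, 0, 0],
   [-3, 0, 0, 3, 0, 2, 0, 0, 3, 0, 0, 0, 0, 1, 0, 0, 0, 0, 0, 0, 0, 0, 0, 0, 0, 0, 0, -1, 0, -2, 3, 0, 0, -1, 0],
   [5, 3, 0, -5, 0, -3, 2, 0, -3, 0, 0, 0, 0, 0, 0, 0, 0, 0, 0, 0, 0, 0, 0, 0, 0, 0, 0, 2, 2, 2, -5, 0, 1, 1, 0],
   [-1, 0, 0, 1, 0, 1, 0, 0, 1, 0, 0, 0, 0, 0, 0, 0, 0, 0, 0, 0, 0, 0, 0, 0, 0, 0, 0, 0, 0, -1, 1, 0, 0, 0, 0],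
   [-1, 0, 0, 1, 0, 1, 0, 0, 1, 0, 0, 0, 0, 1, 0, 0, 0, 0, 0, 0, 0, 0, 0, 0, 0, 0, 0, 0, 0, -1, 1, 0, 0, 0, 0],
   [-1, 0, 0, 1, 0, 1, 0, 0, 1, 0, 0, 0, -1, 0, 0, 0, 0, 0, 0, 0, 0, 0, 0, 0, 0, 0, 0, 0, 0, -1, 1, 0, 0, 0, 0]]"

definition H2 :: "int list list" where
  "H2 = [[0, 0, 0, 0, 0, 0, 0, 0, 0, 0, 0, 0, 0, 0, 0, 0, 0, 0, 0, 0, 0, 0],
   [0, 0, 0, 0, 0, 0, 0, 0, 0, 0, 0, 0, 0, 0, 0, 0, 0, 0, 0, 0, 0, 0],
   [0, 0, 0, 0, 0, 0, 0, 0, 0, 0, 0, 0, 1, 0, 0, 0, 0, 0, 0, 0, 0, 0],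
   [0, 0, 0, 0, 0, 0, 0, 0, 0, 0, 0, 0, 0, 0, 0, 0, 0, 0, 0, 0, 0, 0],
   [0, 0, 0, 0, 0, 0, 0, 0, 0, 0, 0, 0, 0, 1, 0, 0, 0, 0, 0, 0, 0, 0],
   [0, 0, 0, 0, 0, 0, 0, 0, 0, 0, 0, 0, 0, 0, 0, 0, 0, 0, 0, 0, 0, 0],
   [0, 0, 0, 0, 0, 0, 0, 0, 0, 0, 0, 0, 0, 0, 0, 0, 0, 0, 0, 0, 0, 0],
   [0, 0, 0, 0, 0, 0, 0, 0, 0, 0, 0, 0, 0, 0, 1, 0, 0, 0, 0, 0, 0, 0],
   [0, 0, 0, 0, 0, 0, 0, 0, 0, 0, 0, 0, 0, 0, 0, 0, 0, 0, 0, 0, 0, 0],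
   [0, -1, 0, -2, 3, 4, -1, -1, 0, 1, -2, 3, 3, -6, -2, -1, -1, 0, 0, 0, -1, -3],
   [0, 0, 1, 1, 1, 0, 1, 0, 0, 0, 0, 0, -2, -1, -2, -1, -2, -1, -1, -1, -1, -1],
   [0, 1, -1, 1, -4, -4, 0, 1, 0, -1, 2, -3, -1, 7, 4, 3, 3, 1, 1, 1, 2, 4],
   [0, 0, 0, 0, 0, 0, 0, 0, 0, 0, 0, 0, 0, 0, 0, 0, 0, 0, 0, 0, 0, 0],
   [0, 0, 0, 0, 0, 0, 0, 0, 0, 0, 0, 0, 0, 0, 0, 0, 0, 0, 0, 0, 0, 0],
   [0, 0, 0, 0, 0, 0, 0, 0, 0, 0, 0, 0, 0, 0, 0, 0, 1, 0, 0, 0, 0, 0],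
   [0, -2, -2, -3, 1, 1, -2, -1, -2, -1, -2, 1, 7, 2, 5, 4, 4, 3, 4, 4, 3, 2],
   [0, -1, -2, -2, -2, -2, -1, 0, -2, -2, 0, -1, 5, 6, 6, 5, 5, 3, 4, 4, 4, 4],
   [0, 0, -2, -1, -3, -3, -1, 1, -1, -1, 1, -2, 3, 7, 6, 4, 5, 2, 3, 3, 3, 4],
   [0, -1, -1, 0, -2, -3, 0, 0, -2, -2, 1, -2, 2, 7, 5, 4, 3, 2, 3, 3, 3, 4],
   [0, 0, 1, 2, -1, -2, 2, 0, 0, -1, 1, -2, -3, 2, -1, 0, -2, 0, -1, 0, 0, 1],
   [0, 0, 1, 1, -1, -1, 1, 0, 0, -1, 1, -1, -2, 1, -1, 0, -1, 0, -1, 0, 0, 1],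
   [0, 0, 2, 2, 1, 0, 2, 0, 1, 0, 1, 0, -4, -3, -4, -3, -4, -2, -3, -2, -2, -2],
   [0, 0, 2, 1, 3, 3, 1, -1, 1, 1, -1, 2, -3, -7, -6, -4, -5, -2, -3, -2, -3, -4],
   [0, 1, 1, 0, 2, 3, 0, 0, 2, 2, -1, 2, -2, -7, -5, -4, -3, -2, -2, -3, -3, -4],
   [0, 2, -1, 0, -2, -1, -1, 1, 1, 1, 1, -1, -1, 2, 1, 0, 2, 0, 0, -1, 0, 1],
   [0, 2, 1, 2, 0, 0, 1, 1, 2, 2, 1, 0, -5, -3, -4, -4, -3, -3, -3, -4, -3, -2],
   [0, 2, 0, 1, 0, 1, 0, 1, 2, 2, 0, 0, -3, -3, -3, -3, -2, -2, -2, -3, -2, -2],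
   [0, 0, 0, 0, 0, 0, 0, 0, 0, 0, 0, 0, 0, 0, 0, 0, 0, 0, 0, 0, 0, 0],
   [0, 0, 0, 0, 0, 0, 0, 0, 0, 0, 0, 0, 0, 0, 0, 0, 0, 0, 0, 0, 0, 0],
   [0, 0, 0, 0, 0, 0, 0, 0, 0, 0, 0, 0, 0, 0, 0, 0, 0, 0, 0, 0, 0, 0],
   [0, 0, 0, 0, 0, 0, 0, 0, 0, 0, 0, 0, 0, 0, 0, 0, 0, 0, 0, 0, 0, 0],
   [0, -1, 0, -1, 1, 1, -1, -1, -1, 0, -1, 1, 2, 0, 1, 1, 1, 1, 1, 1, 1, 0],
   [0, 0, 0, 0, 0, 0, 0, 0, 0, 0, 0, 0, 0, 0, 0, 0, 0, 0, 0, 0, 0, 0],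
   [0, 0, 0, 0, 0, 0, 0, 0, 0, 0, 0, 0, 0, 0, 0, 0, 0, 0, 0, 0, 0, 0],
   [0, -2, 0, -2, 3, 3, -1, -1, -1, 0, -2, 3, 4, -4, 0, 0, 0, 1, 1, 1, 0, -2]]"

text \<open>The weights are forced up to a factor. A column of \<open>D2\<close> over
  \<open>X15\<close> has four entries 1 in the rows of \<open>X12\<close> and one in those of
  \<open>X5\<close>; a column over \<open>X20\<close> has three in the rows of \<open>X12\<close>
  and one in those of \<open>X5'\<close>. An invariant functional that kills both kinds is a
  multiple of (1, -4, -3).\<close>

definition E_row :: "int list list" where
  "E_row = [replicate 12 1 @ replicate 5 (- 4) @ replicate 5 (- 3)]"

definition S_col :: "int list list" where
  "S_col = replicate 12 [3] @ replicate 10 [1]"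

text \<open>The argument \<open>n\<close> supplies the width of an empty combination. Zero
  coefficients are skipped because the matrices are sparse.\<close>

fun lrow :: "nat \<Rightarrow> int list \<Rightarrow> int list list \<Rightarrow> int list" where
  "lrow n (a # r) (b # B) = (if a = 0 then lrow n r B else map2 (\<lambda>x y. a * x + y) b (lrow n r B))"
| "lrow n _ _ = replicate n 0"

definition lmul :: "nat \<Rightarrow> int list list \<Rightarrow> int list list \<Rightarrow> int list list" where
  "lmul n A B = map (\<lambda>r. lrow n r B) A"

definition ladd :: "int list list \<Rightarrow> int list list \<Rightarrow> int list list" where
  "ladd A B = map2 (map2 (+)) A B"

definition lone :: "nat \<Rightarrow> int list list" where
  "lone n = map (\<lambda>i. map (\<lambda>j. if i = j then 1 else 0) [0..<n]) [0..<n]"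

text \<open>As a row, the first unit vector reads off the coordinate whose column is left out of the
  minor of \<open>D1\<close>. As a column, it is a section of \<open>E_row\<close>, supported on the
  row left out of the minor of \<open>D2\<close>, where the weight is 1.\<close>

definition lunit :: "nat \<Rightarrow> int list" where
  "lunit n = 1 # replicate (n - 1) 0"

definition dims :: "nat \<Rightarrow> nat \<Rightarrow> 'a list list \<Rightarrow> bool" where
  "dims m n A \<longleftrightarrow> length A = m \<and> (\<forall>r\<in>set A. length r = n)"

lemma dims_data: "dims 35 15 D1" "dims 22 35 D2" "dims 15 35 H1" "dims 35 22 H2" "dims 1 22 E_row" "dims 22 1 S_col"
  by code_simp+

lemma lengths: "length X15 = 15" "length P_list = 35" "length Q_list = 22"
  by code_simp+

lemma complex_identities:
  "lmul 1 D1 (replicate 15 [1]) = replicate 35 [0]"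
  "lmul 15 D2 D1 = replicate 22 (replicate 15 0)"
  "lmul 35 E_row D2 = [replicate 35 0]"
  "lmul 1 E_row S_col = [[1]]"
  by code_simp+

text \<open>One identity for each of the terms of rank 15, 35 and 22. They give, in this order, the
  kernel of the first differential, exactness in the middle, and surjectivity onto the kernel of the
  weights.\<close>

lemma homotopy_identities:
  "ladd (lmul 15 H1 D1) (lmul 15 (replicate 15 [1]) [lunit 15]) = lone 15"
  "ladd (lmul 35 D1 H1) (lmul 35 H2 D2) = lone 35"
  "ladd (lmul 22 D2 H2) (lmul 22 (map (\<lambda>a. [a]) (lunit 22)) E_row) = lone 22"
  by code_simp+

text \<open>Describing weights by membership in orbits makes their invariance a consequence of the
  invariance of the orbits. On \<open>Q_list\<close> the last branch stands for
  \<open>X5'\<close>.\<close>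

definition weight_E :: "nat list \<Rightarrow> int" where
  "weight_E y = (if y \<in> set X12 then 1 else if y \<in> set X5 then - 4 else - 3)"

definition weight_S :: "nat list \<Rightarrow> int" where
  "weight_S y = (if y \<in> set X12 then 3 else 1)"

lemma weights: "[map weight_E Q_list] = E_row" "map (\<lambda>y. [weight_S y]) Q_list = S_col"
  by code_simp+

section \<open>Finite checks in the alternating group\<close>

text \<open>\<open>linv\<close> merely searches for positions, so the check includes that it yields
  a two-sided inverse.\<close>

definition is_perm :: "nat list \<Rightarrow> bool" where
  "is_perm p \<longleftrightarrow> length p = 6 \<and> p ! 0 = 0 \<and> list_all (\<lambda>i. i < 6) p \<and> list_all (\<lambda>i. i < 6) (linv p) \<and>
     lcomp p (linv p) = [0..<6] \<and> lcomp (linv p) p = [0..<6]"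

lemma A5_perms: "list_all is_perm A5_list"
  by code_simp

lemma A5_distinct: "length A5_list = 60" "distinct A5_list"
  by code_simp+

text \<open>Evenness without computing signs: every factor in the factorization of the group is the
  square of a permutation.\<close>

lemma square_roots:
  "list_all is_perm ([[0, 3, 4, 2, 1, 5], [0, 2, 3, 4, 1, 5], [0, 2, 4, 1, 3, 5]] @ C3_list @ C5_list)"
  "V4_list = map (\<lambda>p. lcomp p p) [[0, 1, 2, 3, 4, 5], [0, 3, 4, 2, 1, 5], [0, 2, 3, 4, 1, 5], [0, 2, 4, 1, 3, 5]]"
  "C3_list = map (\<lambda>p. lcomp p p) [[0, 1, 2, 3, 4, 5], [0, 3, 1, 2, 4, 5], [0, 2, 3, 1, 4, 5]]"
  "C5_list = map (\<lambda>p. lcomp p p)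
     [[0, 1, 2, 3, 4, 5], [0, 4, 5, 1, 2, 3], [0, 2, 3, 4, 5, 1], [0, 5, 1, 2, 3, 4], [0, 3, 4, 5, 1, 2]]"
  by code_simp+

lemma orbit_closed:
  "list_all (\<lambda>g. lconj g t0 \<in> set X15) A5_list" "list_all (\<lambda>g. lconj g c0 \<in> set X20) A5_list"
  "list_all (\<lambda>g. lconj g [0, 2, 3, 4, 5, 1] \<in> set X12) A5_list"
  "list_all (\<lambda>g. lconj g [0, 5, 5, 5, 5, 5] \<in> set X5) A5_list"
  "list_all (\<lambda>g. lconj g [5, 5, 5, 5, 5, 5] \<in> set X5') A5_list"
  by code_simp+

lemma transversals:
  "set R15 \<subseteq> set A5_list" "set R20 \<subseteq> set A5_list" "set R12 \<subseteq> set A5_list" "set C5_list \<subseteq> set A5_list"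
  by code_simp+

lemma Q_distinct: "distinct Q_list" "distinct P_list"
  by code_simp+

definition lcentralizer :: "nat list list \<Rightarrow> nat list \<Rightarrow> nat list list" where
  "lcentralizer L x = filter (\<lambda>g. lcomp g x = lcomp x g) L"

lemma involutions: "list_all (\<lambda>l. lcomp l l = [0..<6] \<longrightarrow> l = [0..<6] \<or> l \<in> set X15) A5_list"
  by code_simp

lemma involution_centralizers: "list_all (\<lambda>l. length (lcentralizer A5_list l) = 4) X15"
  by code_simp

lemma five_cycle_centralizers: "list_all (\<lambda>l. length (lcentralizer A5_list l) = 5) X12"
  by code_simp

text \<open>A nontrivial element of A5 commuting with at least five elements is a 5-cycle. The
  5-cycles form two classes of twelve, which squaring exchanges, so \<open>X12\<close> contains the
  element or its square.\<close>

lemma large_centralizers: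
  "list_all (\<lambda>l. 5 \<le> length (lcentralizer A5_list l) \<longrightarrow> l = [0..<6] \<or> l \<in> set X12 \<or> lcomp l l \<in> set X12) A5_list"
  by code_simp

lemma involution_fixed_points: "list_all (\<lambda>l. length (filter (\<lambda>i. l ! i = i) [1..<6]) = 1) X15"
  by code_simp

lemma point_stabilizers: "list_all (\<lambda>i. length (filter (\<lambda>g. g ! i = i) A5_list) = 12) [1..<6]"
  by code_simp

lemma constants: "set X5 = set (map (\<lambda>i. [0, i, i, i, i, i]) [1..<6])" "set X5' = set (map (\<lambda>i. [i, i, i, i, i, i]) [1..<6])"
  by code_simp+

text \<open>The element \<open>u\<close> is the conjugate of \<open>t0\<close> by \<open>g\<close>,
  expressed without inverses. It lies in the normal Klein four-group of the stabilizer of 5, which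
  is abelian and contains \<open>t0\<close>.\<close>

lemma A4_conjugates:
  "list_all (\<lambda>g. g ! 5 = 5 \<longrightarrow>
     list_ex (\<lambda>u. u ! 5 = 5 \<and> lcomp u g = lcomp g [0, 2, 1, 4, 3, 5]
       \<and> lcomp u [0, 2, 1, 4, 3, 5] = lcomp [0, 2, 1, 4, 3, 5] u) A5_list) A5_list"
  by code_simp

section \<open>Lists and the alternating group\<close>

definition fn :: "nat list \<Rightarrow> nat \<Rightarrow> nat" where
  "fn l i = (if i < length l then l ! i else i)"

text \<open>Conjugation by genuine group elements, restricted to six points; \<open>lconj\<close> is
  the executable counterpart.\<close>

definition conj_act :: "(nat \<Rightarrow> nat) \<Rightarrow> nat list \<Rightarrow> nat list" where
  "conj_act g x = map (\<lambda>i. g (x ! inv' g i)) [0..<6]"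

definition self_maps :: "nat list set" where
  "self_maps = {x. length x = 6 \<and> (\<forall>i<6. x ! i < 6)}"

lemma fn_eq_iff: "length l = 6 \<Longrightarrow> length m = 6 \<Longrightarrow> fn l = fn m \<longleftrightarrow> l = m"
  by (metis fn_def list_eq_iff_nth_eq)

lemma fn_lcomp: "length l = 6 \<Longrightarrow> m \<in> self_maps \<Longrightarrow> fn (lcomp l m) = fn l \<circ> fn m"
  by (auto simp: fn_def lcomp_def self_maps_def)

lemma fn_upt: "fn [0..<6] = id"
  by (auto simp: fn_def)

lemma length_lcomp [simp]: "length (lcomp l m) = length m"
  by (simp add: lcomp_def)

lemma length_linv [simp]: "length (linv l) = 6"
  by (simp add: linv_def)

lemma lcomp_self_maps: "l \<in> self_maps \<Longrightarrow> m \<in> self_maps \<Longrightarrow> lcomp l m \<in> self_maps"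
  by (auto simp: self_maps_def lcomp_def)

lemma is_permD:
  assumes "is_perm p"
  shows "p \<in> self_maps" "linv p \<in> self_maps" "fn p \<circ> fn (linv p) = id" "fn (linv p) \<circ> fn p = id"
    "fn p permutes {1..5}" "inv' (fn p) = fn (linv p)"
proof -
  show p: "p \<in> self_maps" and q: "linv p \<in> self_maps"
    using assms by (auto simp: is_perm_def self_maps_def list_all_length)
  have l: "length p = 6" using p by (simp add: self_maps_def)
  show 1: "fn p \<circ> fn (linv p) = id" and 2: "fn (linv p) \<circ> fn p = id"
    using fn_lcomp[OF l q] fn_lcomp[of "linv p" p] p assms by (simp_all add: is_perm_def fn_upt)
  show "inv' (fn p) = fn (linv p)" by (rule inv_unique_comp[OF 1 2])
  have "bij (fn p)" using 1 2 o_bij by blast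
  then have "\<exists>!x. fn p x = y" for y by (simp add: bij_iff)
  moreover have "fn p x = x" if "x \<notin> {1..5}" for x
  proof (cases "x = 0")
    case False
    then have "6 \<le> x" using that by auto
    then show ?thesis using l by (simp add: fn_def)
  qed (use assms in \<open>simp add: fn_def is_perm_def\<close>)
  ultimately show "fn p permutes {1..5}" by (auto simp: permutes_def)
qed

lemma alt5D:
  assumes "g \<in> carrier (alt_group 5)"
  shows "bij g" "g 0 = 0" "6 \<le> i \<Longrightarrow> g i = i" "i < 6 \<Longrightarrow> g i < 6" "i \<in> {1..5} \<Longrightarrow> g i \<in> {1..5}"
    "g (inv' g i) = i" "inv' g (g i) = i" "inv' g \<in> carrier (alt_group 5)"
proof -
  have g: "g permutes {1..5}" using assms by (simp add: alt_group_carrier)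
  show "bij g" by (rule permutes_bij[OF g])
  show 0: "g 0 = 0" by (rule permutes_not_in[OF g]) simp
  show "6 \<le> i \<Longrightarrow> g i = i" by (rule permutes_not_in[OF g]) simp
  show 1: "i \<in> {1..5} \<Longrightarrow> g i \<in> {1..5}" by (simp only: permutes_in_image[OF g])
  show "i < 6 \<Longrightarrow> g i < 6" using 0 1 by (cases "i = 0") auto
  show "g (inv' g i) = i" "inv' g (g i) = i" by (rule permutes_inverses[OF g])+
  show "inv' g \<in> carrier (alt_group 5)" by (rule alt_group_inv_closed[OF assms])
qed

lemma conj_act_self_maps:
  "g \<in> carrier (alt_group 5) \<Longrightarrow> x \<in> self_maps \<Longrightarrow> conj_act g x \<in> self_maps"
  using alt5D(4) alt5D(4)[OF alt5D(8)] by (auto simp: conj_act_def self_maps_def)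

lemma acts_on_self_maps: "acts_on (alt_group 5) conj_act self_maps"
  unfolding acts_on_def
proof (intro conjI ballI conj_act_self_maps)
  fix x assume x: "x \<in> self_maps"
  show "conj_act \<one>\<^bsub>alt_group 5\<^esub> x = x"
    using x by (auto simp: conj_act_def alt_group_one self_maps_def intro!: nth_equalityI)
  fix g h assume g: "g \<in> carrier (alt_group 5)" and h: "h \<in> carrier (alt_group 5)"
  have "inv' (g \<circ> h) = inv' h \<circ> inv' g" using o_inv_distrib[OF alt5D(1)[OF g] alt5D(1)[OF h]] .
  then show "conj_act (g \<otimes>\<^bsub>alt_group 5\<^esub> h) x = conj_act g (conj_act h x)"
    using alt5D(4)[OF alt5D(8)[OF g]] by (auto simp: conj_act_def alt_group_mult)
qed

lemma conj_act_fn: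
  assumes "is_perm p" "x \<in> self_maps"
  shows "conj_act (fn p) x = lconj p x"
proof (rule nth_equalityI)
  note p = is_permD[OF assms(1)]
  fix i assume "i < length (conj_act (fn p) x)"
  then have i: "i < 6" by (simp add: conj_act_def)
  then have "linv p ! i < 6" using p(2) by (simp add: self_maps_def)
  then show "conj_act (fn p) x ! i = lconj p x ! i"
    using i assms(2) p(1) by (simp add: conj_act_def lconj_def lcomp_def p(6) fn_def self_maps_def)
qed (simp add: conj_act_def lconj_def)

lemma A5_list_perm: "l \<in> set A5_list \<Longrightarrow> is_perm l"
  using A5_perms by (simp add: list_all_iff)

lemma A5_list_self_maps: "l \<in> set A5_list \<Longrightarrow> l \<in> self_maps"
  by (rule is_permD(1)[OF A5_list_perm])

lemma square_even:
  assumes "is_perm p"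
  shows "fn (lcomp p p) \<in> carrier (alt_group 5)"
proof -
  note p = is_permD[OF assms]
  have "permutation (fn p)" using p(5) permutation_permutes by blast
  then show ?thesis
    using p fn_lcomp[of p p] permutes_compose[OF p(5,5)] evenperm_comp[of "fn p" "fn p"]
    by (simp add: alt_group_carrier self_maps_def)
qed

text \<open>Counting replaces a proof of surjectivity: the sixty lists are distinct, they represent
  even permutations as products of squares, and A5 has order 60.\<close>

lemma fn_A5_list: "fn ` set A5_list = carrier (alt_group 5)"
proof (rule card_subset_eq)
  interpret group "alt_group 5" by (rule alt_group_is_group)
  have two: "2 * card (carrier (alt_group 5)) = fact 5" by (rule alt_group_card_carrier) simp
  then have card: "card (carrier (alt_group 5)) = 60" by (simp add: fact_numeral)
  then show "finite (carrier (alt_group 5))" using card.infinite by fastforce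
  have "inj_on fn (set A5_list)"
    using A5_list_self_maps fn_eq_iff by (auto simp: inj_on_def self_maps_def)
  then show "card (fn ` set A5_list) = card (carrier (alt_group 5))"
    using A5_distinct by (simp add: card card_image distinct_card)
  have perms: "is_perm [0, 1, 2, 3, 4, 5]" "is_perm [0, 3, 4, 2, 1, 5]" "is_perm [0, 2, 3, 4, 1, 5]"
    "is_perm [0, 2, 4, 1, 3, 5]" "is_perm [0, 2, 3, 1, 4, 5]" "is_perm [0, 3, 1, 2, 4, 5]"
    "is_perm [0, 2, 3, 4, 5, 1]" "is_perm [0, 3, 4, 5, 1, 2]" "is_perm [0, 4, 5, 1, 2, 3]" "is_perm [0, 5, 1, 2, 3, 4]"
    using square_roots(1) by (simp_all add: C3_list_def C5_list_def)
  have mem: "fn v \<in> carrier (alt_group 5) \<and> v \<in> self_maps"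
    if "v \<in> set V4_list \<union> set C3_list \<union> set C5_list" for v
    using that perms square_even is_permD(1) lcomp_self_maps unfolding square_roots(2-4) by auto
  show "fn ` set A5_list \<subseteq> carrier (alt_group 5)"
  proof
    fix g assume "g \<in> fn ` set A5_list"
    then obtain d c v where "g = fn (lcomp d (lcomp c v))"
      and m: "d \<in> set C5_list" "c \<in> set C3_list" "v \<in> set V4_list"
      by (auto simp: A5_list_def lprod_def)
    then have "g = fn d \<otimes>\<^bsub>alt_group 5\<^esub> (fn c \<otimes>\<^bsub>alt_group 5\<^esub> fn v)"
      using fn_lcomp[of d "lcomp c v"] fn_lcomp[of c v] lcomp_self_maps[of c v] mem
      by (auto simp: alt_group_mult self_maps_def)
    then show "g \<in> carrier (alt_group 5)" using mem m by simp
  qed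
qed

lemma finite_alt5: "finite (carrier (alt_group 5))"
  by (metis fn_A5_list finite_imageI List.finite_set)

lemma alt5_fnE:
  assumes "g \<in> carrier (alt_group 5)"
  obtains l where "l \<in> set A5_list" "g = fn l"
  using assms fn_A5_list by blast

lemma fn_carrier: "l \<in> set A5_list \<Longrightarrow> fn l \<in> carrier (alt_group 5)"
  using fn_A5_list by blast

section \<open>Conjugacy orbits\<close>

definition is_orbit :: "nat list list \<Rightarrow> nat list \<Rightarrow> bool" where
  "is_orbit X x \<longleftrightarrow> x \<in> self_maps \<and> set X = (\<lambda>g. conj_act g x) ` carrier (alt_group 5)"

lemma is_orbitI:
  assumes "x \<in> self_maps" "X = map (\<lambda>g. lconj g x) R" "set R \<subseteq> set A5_list"
    and "list_all (\<lambda>g. lconj g x \<in> set X) A5_list"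
  shows "is_orbit X x"
proof -
  have "set X \<subseteq> (\<lambda>g. conj_act g x) ` carrier (alt_group 5)"
  proof
    fix y assume "y \<in> set X"
    then obtain l where l: "l \<in> set A5_list" "y = lconj l x" using assms(2,3) by auto
    then show "y \<in> (\<lambda>g. conj_act g x) ` carrier (alt_group 5)"
      using conj_act_fn[OF A5_list_perm[OF l(1)] assms(1)] fn_carrier[OF l(1)]
      by (intro image_eqI[of _ _ "fn l"]) simp_all
  qed
  moreover have "(\<lambda>g. conj_act g x) ` carrier (alt_group 5) \<subseteq> set X"
    unfolding fn_A5_list[symmetric] using assms(1,4) conj_act_fn[OF A5_list_perm]
    by (auto simp: list_all_iff)
  ultimately show ?thesis using assms(1) by (simp add: is_orbit_def)
qed

lemma orbits:
  "is_orbit X15 t0" "is_orbit X20 c0" "is_orbit X12 [0, 2, 3, 4, 5, 1]"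
  "is_orbit X5 [0, 5, 5, 5, 5, 5]" "is_orbit X5' [5, 5, 5, 5, 5, 5]"
proof -
  have *: "x \<in> self_maps" if "length x = 6" "list_all (\<lambda>i. i < 6) x" for x
    using that by (auto simp: self_maps_def list_all_length)
  show "is_orbit X15 t0" "is_orbit X20 c0" "is_orbit X12 [0, 2, 3, 4, 5, 1]"
    "is_orbit X5 [0, 5, 5, 5, 5, 5]" "is_orbit X5' [5, 5, 5, 5, 5, 5]"
    by (rule is_orbitI[OF _ X15_def transversals(1) orbit_closed(1)]
        is_orbitI[OF _ X20_def transversals(2) orbit_closed(2)]
        is_orbitI[OF _ X12_def transversals(3) orbit_closed(3)]
        is_orbitI[OF _ X5_def transversals(4) orbit_closed(4)]
        is_orbitI[OF _ X5'_def transversals(4) orbit_closed(5)], rule *;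
        simp add: t0_def c0_def)+
qed

lemma orbit_acts:
  assumes "is_orbit X x"
  shows "set X \<subseteq> self_maps" "acts_on (alt_group 5) conj_act (set X)"
    "x0 \<in> set X \<Longrightarrow> \<forall>y\<in>set X. \<exists>g\<in>carrier (alt_group 5). conj_act g x0 = y"
proof -
  interpret group "alt_group 5" by (rule alt_group_is_group)
  have x: "x \<in> self_maps" and X: "set X = (\<lambda>g. conj_act g x) ` carrier (alt_group 5)"
    using assms by (auto simp: is_orbit_def)
  show sub: "set X \<subseteq> self_maps" using X x conj_act_self_maps by auto
  show "acts_on (alt_group 5) conj_act (set X)"
  proof (rule acts_on_subset[OF acts_on_self_maps sub])
    fix g y assume g: "g \<in> carrier (alt_group 5)" and "y \<in> set X"
    then obtain h where h: "h \<in> carrier (alt_group 5)" "y = conj_act h x" using X by blast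
    then have "conj_act g y = conj_act (g \<otimes>\<^bsub>alt_group 5\<^esub> h) x"
      using acts_onD(3)[OF acts_on_self_maps g h(1) x] by simp
    then show "conj_act g y \<in> set X" using X g h(1) by blast
  qed
  show "\<forall>y\<in>set X. \<exists>g\<in>carrier (alt_group 5). conj_act g x0 = y" if x0: "x0 \<in> set X"
  proof
    fix y assume "y \<in> set X"
    then obtain h where h: "h \<in> carrier (alt_group 5)" "y = conj_act h x" using X by blast
    obtain k where k: "k \<in> carrier (alt_group 5)" "x0 = conj_act k x" using X x0 by blast
    have "conj_act (h \<otimes>\<^bsub>alt_group 5\<^esub> inv\<^bsub>alt_group 5\<^esub> k) x0 = y"
      using acts_onD(3)[OF acts_on_self_maps h(1), of "inv\<^bsub>alt_group 5\<^esub> k" x0] h k sub x0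
        acts_on_inv(1)[OF alt_group_is_group acts_on_self_maps k(1) x] by auto
    then show "\<exists>g\<in>carrier (alt_group 5). conj_act g x0 = y" using h(1) k(1) by blast
  qed
qed

lemma acts_on_P: "acts_on (alt_group 5) conj_act (set P_list)"
  and acts_on_Q: "acts_on (alt_group 5) conj_act (set Q_list)"
  using orbit_acts(2)[OF orbits(1)] orbit_acts(2)[OF orbits(2)] orbit_acts(2)[OF orbits(3)]
    orbit_acts(2)[OF orbits(4)] orbit_acts(2)[OF orbits(5)]
  by (simp_all add: P_list_def Q_list_def acts_on_Un)

abbreviation stab :: "nat list \<Rightarrow> (nat \<Rightarrow> nat) set" where
  "stab x \<equiv> {g \<in> carrier (alt_group 5). conj_act g x = x}"

lemma orbit_coset_lat:
  assumes "is_orbit X x" "distinct X" "x0 \<in> set X"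
  shows "lat_iso (alt_group 5) (list_lat X conj_act) (coset_lat (alt_group 5) (stab x0))"
    "G_lattice (alt_group 5) (coset_lat (alt_group 5) (stab x0))"
    "subgroup (stab x0) (alt_group 5)"
    "G_lattice (alt_group 5) (list_lat X conj_act)"
  using coset_lat_iso[OF alt_group_is_group orbit_acts(2)[OF assms(1)] assms(2,3)
      orbit_acts(3)[OF assms(1,3)] refl]
    stabilizer_subgroup[OF alt_group_is_group orbit_acts(2)[OF assms(1)] assms(3)]
    G_lattice_list_lat[OF orbit_acts(2)[OF assms(1)] assms(2)]
  by auto

section \<open>Subgroups as stabilizers\<close>

text \<open>The self-map \<open>l\<close> may fail to be invertible: for a constant map, commuting
  with \<open>g\<close> means that \<open>g\<close> fixes its value.\<close>

lemma conj_act_eq_iff_commute: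
  assumes "g \<in> carrier (alt_group 5)" "l \<in> self_maps"
  shows "conj_act g l = l \<longleftrightarrow> g \<circ> fn l = fn l \<circ> g"
proof
  have len: "length l = 6" using assms(2) by (simp add: self_maps_def)
  assume eq: "conj_act g l = l"
  show "g \<circ> fn l = fn l \<circ> g"
  proof
    fix i show "(g \<circ> fn l) i = (fn l \<circ> g) i"
    proof (cases "i < 6")
      case True
      then have "conj_act g l ! g i = g (l ! i)"
        using alt5D[OF assms(1)] by (simp add: conj_act_def)
      then show ?thesis using True eq alt5D(4)[OF assms(1)] len by (simp add: fn_def)
    qed (use alt5D(3)[OF assms(1)] len in \<open>simp add: fn_def\<close>)
  qed
next
  have len: "length l = 6" using assms(2) by (simp add: self_maps_def)
  assume eq: "g \<circ> fn l = fn l \<circ> g"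
  show "conj_act g l = l"
  proof (rule nth_equalityI)
    fix i assume "i < length (conj_act g l)"
    then have i: "i < 6" by (simp add: conj_act_def)
    have "g (fn l (inv' g i)) = fn l (g (inv' g i))" using eq by (metis comp_apply)
    then show "conj_act g l ! i = l ! i"
      using i alt5D(4)[OF alt5D(8)[OF assms(1)] i] alt5D(6)[OF assms(1)] len
      by (simp add: conj_act_def fn_def)
  qed (simp add: conj_act_def len)
qed

lemma card_fn_filter: "card (fn ` set (filter Pr A5_list)) = length (filter Pr A5_list)"
proof -
  have "inj_on fn (set (filter Pr A5_list))"
    using A5_list_self_maps fn_eq_iff by (auto simp: inj_on_def self_maps_def)
  then show ?thesis using A5_distinct(2) by (simp add: card_image distinct_card del: set_filter)
qed

lemma stab_eq_lcentralizer:
  assumes "x \<in> self_maps"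
  shows "stab x = fn ` set (lcentralizer A5_list x)"
proof -
  have "conj_act (fn l) x = x \<longleftrightarrow> lcomp l x = lcomp x l" if l: "l \<in> set A5_list" for l
  proof -
    have s: "l \<in> self_maps" by (rule A5_list_self_maps[OF l])
    then show ?thesis
      using conj_act_eq_iff_commute[OF fn_carrier[OF l] assms] fn_lcomp[of l x] fn_lcomp[of x l] assms
        fn_eq_iff[of "lcomp l x" "lcomp x l"]
      by (auto simp: self_maps_def)
  qed
  then show ?thesis unfolding fn_A5_list[symmetric] lcentralizer_def by auto
qed

lemma card_stab: "x \<in> self_maps \<Longrightarrow> card (stab x) = length (lcentralizer A5_list x)"
  using stab_eq_lcentralizer card_fn_filter unfolding lcentralizer_def by simp

lemma commuting_subset_stab:
  assumes "subgroup H (alt_group 5)" "l \<in> set A5_list" "\<And>h. h \<in> H \<Longrightarrow> h \<circ> fn l = fn l \<circ> h"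
  shows "H \<subseteq> stab l"
  using assms subgroup.mem_carrier[OF assms(1)] conj_act_eq_iff_commute[OF _ A5_list_self_maps[OF assms(2)]]
  by blast

lemma subgroup_isoE:
  assumes "(alt_group 5)\<lparr>carrier := H\<rparr> \<cong> K"
  obtains f where "inj_on f H" "f ` H = carrier K"
    "\<forall>x\<in>H. \<forall>y\<in>H. f (x \<circ> y) = f x \<otimes>\<^bsub>K\<^esub> f y" "card H = card (carrier K)"
  using assms iso_same_card[OF assms]
  by (auto simp: is_iso_def iso_def hom_def bij_betw_def alt_group_mult)

lemma subgroup_comp_closed:
  "subgroup H (alt_group 5) \<Longrightarrow> x \<in> H \<Longrightarrow> y \<in> H \<Longrightarrow> x \<circ> y \<in> H"
  using subgroup.m_closed[of H "alt_group 5" x y] by (simp add: alt_group_mult)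

text \<open>\<open>H\<close> is abelian of exponent 2, so any nontrivial \<open>t\<close> in it is
  an involution whose centralizer contains \<open>H\<close>. Centralizers of involutions in A5 have
  order 4, hence equality.\<close>

lemma klein_subgroup_stab:
  assumes "subgroup H (alt_group 5)"
    and "(alt_group 5)\<lparr>carrier := H\<rparr> \<cong> DirProd (integer_mod_group 2) (integer_mod_group 2)"
  shows "\<exists>x\<in>set X15. H = stab x"
proof -
  obtain f where inj: "inj_on f H" and img: "f ` H = carrier (DirProd (integer_mod_group 2) (integer_mod_group 2))"
    and hom: "\<forall>x\<in>H. \<forall>y\<in>H. f (x \<circ> y) = f x \<otimes>\<^bsub>DirProd (integer_mod_group 2) (integer_mod_group 2)\<^esub> f y"
    and "card H = card (carrier (DirProd (integer_mod_group 2) (integer_mod_group 2)))"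
    by (rule subgroup_isoE[OF assms(2)])
  then have card: "card H = 4" by (simp add: DirProd_def carrier_integer_mod_group card_cartesian_product)
  have id: "id \<in> H" using subgroup.one_closed[OF assms(1)] by (simp add: alt_group_one)
  have sq: "x \<circ> x = id" if x: "x \<in> H" for x
  proof -
    \<comment> \<open>Both sides are doubles in a group of exponent 2 and therefore equal to the
      neutral element; this way the value of \<open>f id\<close> need not be computed.\<close>
    have "f (x \<circ> x) = f (id \<circ> id)"
      unfolding hom[rule_format, OF x x] hom[rule_format, OF id id]
      by (cases "f x"; cases "f id") (simp add: mult_2[symmetric])
    then show ?thesis
      using inj subgroup_comp_closed[OF assms(1) x x] id by (simp add: inj_on_def)
  qed
  have comm: "x \<circ> y = y \<circ> x" if "x \<in> H" "y \<in> H" for x y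
  proof -
    have "f (x \<circ> y) = f (y \<circ> x)"
      using that hom by (cases "f x"; cases "f y") (simp add: add.commute)
    then show ?thesis
      using inj that subgroup_comp_closed[OF assms(1)] by (simp add: inj_on_def)
  qed
  have "H \<noteq> {id}" using card by auto
  then obtain t where t: "t \<in> H" "t \<noteq> id" using id by blast
  obtain l where l: "l \<in> set A5_list" "t = fn l"
    using alt5_fnE subgroup.mem_carrier[OF assms(1) t(1)] by blast
  have ls: "l \<in> self_maps" by (rule A5_list_self_maps[OF l(1)])
  have "fn (lcomp l l) = fn [0..<6]"
    using sq[OF t(1)] ls l fn_lcomp[of l l] by (simp add: self_maps_def fn_upt del: upt_conv_Cons_Cons)
  then have "lcomp l l = [0..<6]"
    using ls by (subst fn_eq_iff[symmetric]) (auto simp: self_maps_def)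
  moreover have "l \<noteq> [0..<6]" using t(2) l(2) fn_upt by metis
  ultimately have lX: "l \<in> set X15" using involutions l(1) unfolding list_all_iff by blast
  have "H \<subseteq> stab l"
    by (rule commuting_subset_stab[OF assms(1) l(1)]) (use comm t(1) l(2) in auto)
  moreover have "card (stab l) = 4"
    using card_stab[OF ls] involution_centralizers lX unfolding list_all_iff by simp
  ultimately have "H = stab l"
    using card finite_alt5 by (intro card_subset_eq) auto
  then show ?thesis using lX by blast
qed

text \<open>A nontrivial element of the abelian group \<open>H\<close> has a centralizer of order at
  least 5. That element or its square lies in the class \<open>X12\<close>, and the centralizer of
  the latter has order exactly 5, so it equals \<open>H\<close>.\<close>

lemma cyclic5_subgroup_stab:
  assumes "subgroup H (alt_group 5)" "(alt_group 5)\<lparr>carrier := H\<rparr> \<cong> integer_mod_group 5"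
  shows "\<exists>x\<in>set X12. H = stab x"
proof -
  obtain f where inj: "inj_on f H" and img: "f ` H = carrier (integer_mod_group 5)"
    and hom: "\<forall>x\<in>H. \<forall>y\<in>H. f (x \<circ> y) = f x \<otimes>\<^bsub>integer_mod_group 5\<^esub> f y"
    and "card H = card (carrier (integer_mod_group 5))"
    by (rule subgroup_isoE[OF assms(2)])
  then have card: "card H = 5" by (simp add: carrier_integer_mod_group)
  have id: "id \<in> H" using subgroup.one_closed[OF assms(1)] by (simp add: alt_group_one)
  have comm: "x \<circ> y = y \<circ> x" if "x \<in> H" "y \<in> H" for x y
  proof -
    have "f (x \<circ> y) = f (y \<circ> x)"
      using that hom by (simp add: add.commute)
    then show ?thesis
      using inj that subgroup_comp_closed[OF assms(1)] by (simp add: inj_on_def)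
  qed
  have "H \<noteq> {id}" using card by auto
  then obtain t where t: "t \<in> H" "t \<noteq> id" using id by blast
  obtain l where l: "l \<in> set A5_list" "t = fn l"
    using alt5_fnE subgroup.mem_carrier[OF assms(1) t(1)] by blast
  have ls: "l \<in> self_maps" by (rule A5_list_self_maps[OF l(1)])
  have "H \<subseteq> stab l"
    by (rule commuting_subset_stab[OF assms(1) l(1)]) (use comm t(1) l(2) in auto)
  then have "5 \<le> length (lcentralizer A5_list l)"
    using card_mono[of "stab l" H] finite_alt5 card card_stab[OF ls] by simp
  moreover have "l \<noteq> [0..<6]" using t(2) l(2) fn_upt by metis
  ultimately have "l \<in> set X12 \<or> lcomp l l \<in> set X12"
    using large_centralizers l(1) unfolding list_all_iff by blast
  then obtain k where k: "k \<in> set X12" "fn k \<in> H"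
    using t(1) l(2) ls fn_lcomp[of l l] subgroup_comp_closed[OF assms(1) t(1) t(1)]
    by (auto simp: self_maps_def)
  then have kA: "k \<in> set A5_list"
  proof -
    obtain m where m: "m \<in> set A5_list" "fn k = fn m"
      using alt5_fnE subgroup.mem_carrier[OF assms(1) k(2)] by metis
    have "k \<in> self_maps" using k(1) orbit_acts(1)[OF orbits(3)] by blast
    then have "k = m" using m A5_list_self_maps[OF m(1)] fn_eq_iff[of k m] by (simp add: self_maps_def)
    then show ?thesis using m(1) by simp
  qed
  have "H \<subseteq> stab k"
    by (rule commuting_subset_stab[OF assms(1) kA]) (use comm k(2) in auto)
  moreover have "card (stab k) = 5"
    using card_stab[OF A5_list_self_maps[OF kA]] five_cycle_centralizers k(1) unfolding list_all_iff by simp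
  ultimately have "H = stab k"
    using card finite_alt5 by (intro card_subset_eq) auto
  then show ?thesis using k(1) by blast
qed

lemma stab_constant:
  assumes "i \<in> {1..5}"
  shows "stab [0, i, i, i, i, i] = {g \<in> carrier (alt_group 5). g i = i}"
    "stab [i, i, i, i, i, i] = {g \<in> carrier (alt_group 5). g i = i}"
proof -
  have "conj_act g [0, i, i, i, i, i] = [0, g i, g i, g i, g i, g i]"
    and "conj_act g [i, i, i, i, i, i] = [g i, g i, g i, g i, g i, g i]"
    if g: "g \<in> carrier (alt_group 5)" for g
  proof -
    note h = alt5D[OF alt5D(8)[OF g]]
    have c: "[0, i, i, i, i, i] ! j = i" "[i, i, i, i, i, i] ! j = i" if "j \<in> {1..5}" for j
    proof -
      have "j = 1 \<or> j = 2 \<or> j = 3 \<or> j = 4 \<or> j = 5" using that by auto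
      then show "[0, i, i, i, i, i] ! j = i" "[i, i, i, i, i, i] ! j = i" by auto
    qed
    have u: "[0..<6] = [0, 1, 2, 3, 4, 5]" by (simp add: upt_rec)
    have d: "[0, i, i, i, i, i] ! inv' g j = i" "[i, i, i, i, i, i] ! inv' g j = i" if "j \<in> {1..5}" for j
      using c h(5)[OF that] by auto
    show "conj_act g [0, i, i, i, i, i] = [0, g i, g i, g i, g i, g i]"
      using d(1)[of 1] d(1)[of 2] d(1)[of 3] d(1)[of 4] d(1)[of 5] h(2) alt5D(2)[OF g]
      unfolding conj_act_def u by simp
    show "conj_act g [i, i, i, i, i, i] = [g i, g i, g i, g i, g i, g i]"
      using d(2)[of 1] d(2)[of 2] d(2)[of 3] d(2)[of 4] d(2)[of 5] h(2)
      unfolding conj_act_def u by simp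
  qed
  then show "stab [0, i, i, i, i, i] = {g \<in> carrier (alt_group 5). g i = i}"
    "stab [i, i, i, i, i, i] = {g \<in> carrier (alt_group 5). g i = i}"
    by auto
qed

lemma card_point_stabilizer:
  assumes "i \<in> {1..5}"
  shows "card {g \<in> carrier (alt_group 5). g i = i} = 12"
proof -
  have "fn l i = l ! i" if "l \<in> set A5_list" for l
    using A5_list_self_maps[OF that] assms by (simp add: fn_def self_maps_def)
  then have "{g \<in> carrier (alt_group 5). g i = i} = fn ` set (filter (\<lambda>g. g ! i = i) A5_list)"
    unfolding fn_A5_list[symmetric] by auto
  moreover have "i \<in> set [1..<6]" using assms by auto
  ultimately show ?thesis
    using point_stabilizers card_fn_filter[of "\<lambda>g. g ! i = i"] unfolding list_all_iff by metis
qed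

lemma alt4_subset_alt5: "carrier (alt_group 4) \<subseteq> carrier (alt_group 5)"
  using permutes_subset[of _ "{1..4}" "{1..5::nat}"] by (auto simp: alt_group_carrier)

lemma alt4_iff: "g \<in> carrier (alt_group 4) \<longleftrightarrow> g \<in> carrier (alt_group 5) \<and> g 5 = 5"
proof
  assume g: "g \<in> carrier (alt_group 4)"
  then have "g permutes {1..4}" by (simp add: alt_group_carrier)
  then have "g 5 = 5" by (rule permutes_not_in) simp
  then show "g \<in> carrier (alt_group 5) \<and> g 5 = 5" using alt4_subset_alt5 g by blast
next
  assume g: "g \<in> carrier (alt_group 5) \<and> g 5 = 5"
  have "x = 5" if "x \<in> {1..5} - {1..4::nat}" for x using that by auto
  then have "g permutes {1..4}"
    using g permutes_superset[of g "{1..5}" "{1..4}"] by (metis alt_group_carrier)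
  then show "g \<in> carrier (alt_group 4)" using g by (simp add: alt_group_carrier)
qed

text \<open>All conjugates of an involution in \<open>A\<^sub>4\<close> commute with it, so a copy of \<open>A\<^sub>4\<close> fixes the unique
  fixed point of any of its involutions.\<close>

lemma alt4_subgroup_point_stabilizer:
  assumes "subgroup H (alt_group 5)" "(alt_group 5)\<lparr>carrier := H\<rparr> \<cong> alt_group 4"
  shows "\<exists>i\<in>{1..5}. H = {g \<in> carrier (alt_group 5). g i = i}"
proof -
  obtain f where inj: "inj_on f H" and img: "f ` H = carrier (alt_group 4)"
    and hom: "\<forall>x\<in>H. \<forall>y\<in>H. f (x \<circ> y) = f x \<otimes>\<^bsub>alt_group 4\<^esub> f y"
    and card: "card H = card (carrier (alt_group 4))"
    by (rule subgroup_isoE[OF assms(2)])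
  have hom': "f (x \<circ> y) = f x \<circ> f y" if "x \<in> H" "y \<in> H" for x y
    using hom that by (simp add: alt_group_mult)
  have card12: "card H = 12"
    using card alt_group_card_carrier[of 4] by (simp add: fact_numeral)
  have t0A: "t0 \<in> set A5_list" by code_simp
  have t0s: "t0 \<in> self_maps" by (rule A5_list_self_maps[OF t0A])
  have "fn t0 \<in> carrier (alt_group 4)"
    unfolding alt4_iff using fn_carrier[OF t0A] by (simp add: fn_def t0_def)
  then obtain t where t: "t \<in> H" "f t = fn t0" using img by (metis imageE)
  have id: "id \<in> H" using subgroup.one_closed[OF assms(1)] by (simp add: alt_group_one)
  have fid: "f id = id"
  proof -
    have "f id \<circ> f id = f id" using hom'[OF id id] by simp
    moreover have "bij (f id)" using img id alt4_subset_alt5 alt5D(1) by blast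
    ultimately show ?thesis by (metis bij_betw_def comp_apply eq_id_iff inj_eq)
  qed
  have "lcomp t0 t0 = [0..<6]" by code_simp
  then have "fn t0 \<circ> fn t0 = id" using fn_lcomp[OF _ t0s, of t0] t0s fn_upt by (simp add: self_maps_def)
  then have "f (t \<circ> t) = f id" using hom'[OF t(1) t(1)] t(2) fid by simp
  then have tt: "t \<circ> t = id"
    using inj subgroup_comp_closed[OF assms(1) t(1) t(1)] id by (simp add: inj_on_def)
  have "fn t0 1 = 2" by (simp add: fn_def t0_def)
  then have "t \<noteq> id" using t(2) fid by auto
  obtain l where l: "l \<in> set A5_list" "t = fn l"
    using alt5_fnE subgroup.mem_carrier[OF assms(1) t(1)] by blast
  have ls: "l \<in> self_maps" by (rule A5_list_self_maps[OF l(1)])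
  have "fn (lcomp l l) = fn [0..<6]"
    using tt ls l fn_lcomp[of l l] fn_upt by (simp add: self_maps_def)
  then have "lcomp l l = [0..<6]"
    using ls by (subst fn_eq_iff[symmetric]) (auto simp: self_maps_def)
  moreover have "l \<noteq> [0..<6]" using \<open>t \<noteq> id\<close> l(2) fn_upt by metis
  ultimately have "l \<in> set X15" using involutions l(1) unfolding list_all_iff by blast
  then have "length (filter (\<lambda>i. l ! i = i) [1..<6]) = 1"
    using involution_fixed_points unfolding list_all_iff by blast
  then obtain i where "filter (\<lambda>i. l ! i = i) [1..<6] = [i]"
    unfolding One_nat_def length_Suc_conv length_0_conv by blast
  then have "set (filter (\<lambda>i. l ! i = i) [1..<6]) = {i}" by simp
  then have fixes_set: "{j \<in> {1..<6}. l ! j = j} = {i}" unfolding set_filter set_upt .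
  have fix_iff: "t j = j \<longleftrightarrow> j = i" if "j \<in> {1..5}" for j
  proof -
    have "t j = l ! j" using that ls l(2) by (simp add: fn_def self_maps_def)
    moreover have "j \<in> {j \<in> {1..<6}. l ! j = j} \<longleftrightarrow> j \<in> {i}" unfolding fixes_set ..
    ultimately show ?thesis using that by simp
  qed
  have "i \<in> {j \<in> {1..<6}. l ! j = j}" unfolding fixes_set by simp
  then have i: "i \<in> {1..5}" by simp
  have "g i = i" if g: "g \<in> H" for g
  proof -
    have fg: "f g \<in> carrier (alt_group 4)" using img g by blast
    obtain m where m: "m \<in> set A5_list" "f g = fn m" using alt5_fnE fg alt4_subset_alt5 by blast
    have "m ! 5 = 5"
      using fg m A5_list_self_maps[OF m(1)] unfolding alt4_iff by (simp add: fn_def self_maps_def)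
    \<comment> \<open>The conjugate of \<open>t0\<close> by \<open>m\<close> is pulled back through
      \<open>f\<close>: the resulting \<open>h\<close> is the conjugate of \<open>t\<close> by
      \<open>g\<close> and commutes with \<open>t\<close>.\<close>
    then obtain u where u: "u \<in> set A5_list" "u ! 5 = 5" "lcomp u m = lcomp m t0" "lcomp u t0 = lcomp t0 u"
      using A4_conjugates m(1) unfolding list_all_iff list_ex_iff t0_def by blast
    have us: "u \<in> self_maps" and ms: "m \<in> self_maps" using A5_list_self_maps u m by auto
    have "fn u \<in> carrier (alt_group 4)"
      unfolding alt4_iff using u fn_carrier us by (simp add: fn_def self_maps_def)
    then obtain h where h: "h \<in> H" "f h = fn u" using img by (metis imageE)
    have "fn u \<circ> fn m = fn m \<circ> fn t0" "fn u \<circ> fn t0 = fn t0 \<circ> fn u"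
      using u(3,4) us ms t0s by (simp_all add: fn_lcomp[symmetric] self_maps_def)
    then have "f (h \<circ> g) = f (g \<circ> t)" "f (h \<circ> t) = f (t \<circ> h)"
      using hom' h g t m(2) by simp_all
    then have hg: "h \<circ> g = g \<circ> t" and ht: "h \<circ> t = t \<circ> h"
      using inj h(1) g t(1) subgroup_comp_closed[OF assms(1)] by (simp_all add: inj_on_def)
    have hc: "h \<in> carrier (alt_group 5)" and gc: "g \<in> carrier (alt_group 5)"
      using subgroup.mem_carrier[OF assms(1)] h(1) g by auto
    \<comment> \<open>Commuting with \<open>t\<close>, the element \<open>h\<close> permutes the
      fixed points of \<open>t\<close> among 1, ..., 5, and \<open>i\<close> is the only
      one.\<close>
    have "t (h i) = h i" using ht fix_iff[OF i] by (metis comp_apply)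
    then have hi: "h i = i" using fix_iff[OF alt5D(5)[OF hc i]] by simp
    \<comment> \<open>From \<open>h g = g t\<close> and \<open>h i = i\<close> it follows that
      \<open>t\<close> fixes the preimage of \<open>i\<close> under \<open>g\<close>; so this
      preimage is \<open>i\<close> again.\<close>
    let ?j = "inv' g i"
    have "g (t ?j) = h (g ?j)" using hg by (metis comp_apply)
    then have "g (t ?j) = g ?j" using hi alt5D(6)[OF gc] by simp
    then have "t ?j = ?j" using alt5D(7)[OF gc] by metis
    then have "?j = i" using fix_iff[OF alt5D(5)[OF alt5D(8)[OF gc] i]] by simp
    then show "g i = i" using alt5D(6)[OF gc, of i] by simp
  qed
  then have "H \<subseteq> {g \<in> carrier (alt_group 5). g i = i}"
    using subgroup.mem_carrier[OF assms(1)] by blast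
  then have "H = {g \<in> carrier (alt_group 5). g i = i}"
    using card12 card_point_stabilizer[OF i] finite_alt5 by (intro card_subset_eq) auto
  then show ?thesis using i by blast
qed

lemma alt4_subgroup_stab:
  assumes "subgroup H (alt_group 5)" "(alt_group 5)\<lparr>carrier := H\<rparr> \<cong> alt_group 4"
  shows "(\<exists>x\<in>set X5. H = stab x) \<and> (\<exists>x\<in>set X5'. H = stab x)"
proof -
  obtain i where i: "i \<in> {1..5}" "H = {g \<in> carrier (alt_group 5). g i = i}"
    using alt4_subgroup_point_stabilizer[OF assms] by blast
  have "i \<in> set [1..<6]" using i(1) by auto
  then have "[0, i, i, i, i, i] \<in> set X5" "[i, i, i, i, i, i] \<in> set X5'"
    unfolding constants by auto
  then show ?thesis using i(2) stab_constant[OF i(1)] by blast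
qed

section \<open>Integer matrices as lists of rows\<close>

lemma lrow_nth:
  assumes "length r = length B" "\<forall>b\<in>set B. length b = n"
  shows "length (lrow n r B) = n" "j < n \<Longrightarrow> lrow n r B ! j = (\<Sum>i<length B. r ! i * B ! i ! j)"
proof -
  have "length (lrow n r B) = n \<and> (\<forall>j<n. lrow n r B ! j = (\<Sum>i<length B. r ! i * B ! i ! j))"
    using assms
  proof (induction r B rule: list_induct2)
    case (Cons a r b B)
    then show ?case by (auto simp: sum.lessThan_Suc_shift simp del: sum.lessThan_Suc)
  qed simp
  then show "length (lrow n r B) = n" "j < n \<Longrightarrow> lrow n r B ! j = (\<Sum>i<length B. r ! i * B ! i ! j)"
    by auto
qed

lemma dims_mat: "dims m n A \<Longrightarrow> mat_of_rows_list n A \<in> carrier_mat m n"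
  by (simp add: dims_def mat_of_rows_list_def)

lemma mat_lmul:
  assumes "dims m k A" "dims k n B"
  shows "mat_of_rows_list n (lmul n A B) = mat_of_rows_list k A * mat_of_rows_list n B"
proof (rule eq_matI)
  fix i j assume "i < dim_row (mat_of_rows_list k A * mat_of_rows_list n B)"
    "j < dim_col (mat_of_rows_list k A * mat_of_rows_list n B)"
  then have ij: "i < length A" "j < n" by (simp_all add: mat_of_rows_list_def)
  have "length (A ! i) = length B" using assms ij(1) by (simp add: dims_def)
  then have "lrow n (A ! i) B ! j = (\<Sum>l<length B. A ! i ! l * B ! l ! j)"
    using lrow_nth(2)[of "A ! i" B n j] assms(2) ij(2) by (simp add: dims_def)
  then show "mat_of_rows_list n (lmul n A B) $$ (i, j) = (mat_of_rows_list k A * mat_of_rows_list n B) $$ (i, j)"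
    using ij assms by (simp add: mat_of_rows_list_def lmul_def scalar_prod_def dims_def atLeast0LessThan)
qed (simp_all add: mat_of_rows_list_def lmul_def)

lemma dims_lmul: "dims m k A \<Longrightarrow> dims k n B \<Longrightarrow> dims m n (lmul n A B)"
  using lrow_nth(1) by (auto simp: dims_def lmul_def)

lemma mat_ladd:
  assumes "dims m n A" "dims m n B"
  shows "mat_of_rows_list n (ladd A B) = mat_of_rows_list n A + mat_of_rows_list n B"
  using assms by (intro eq_matI) (auto simp: mat_of_rows_list_def ladd_def dims_def)

lemma mat_lone: "mat_of_rows_list n (lone n) = 1\<^sub>m n"
  by (intro eq_matI) (auto simp: mat_of_rows_list_def lone_def)

lemma mat_replicate: "mat_of_rows_list n (replicate m (replicate n a)) = mat m n (\<lambda>_. a)"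
  by (intro eq_matI) (auto simp: mat_of_rows_list_def)

lemma mat_zero_eq: "mat m n (\<lambda>_. 0) = 0\<^sub>m m n"
  by (intro eq_matI) auto

lemma kmat_rows: "kmat F ys xs = mat_of_rows_list (length xs) (map (\<lambda>y. map (F y) xs) ys)"
  by (intro eq_matI) (auto simp: mat_of_rows_list_def)

abbreviation "mD1 \<equiv> mat_of_rows_list 15 D1"
abbreviation "mD2 \<equiv> mat_of_rows_list 35 D2"
abbreviation "mH1 \<equiv> mat_of_rows_list 35 H1"
abbreviation "mH2 \<equiv> mat_of_rows_list 22 H2"
abbreviation "mE \<equiv> mat_of_rows_list 22 E_row"
abbreviation "mS \<equiv> mat_of_rows_list 1 S_col"

lemma matrix_identities:
  "mD1 * mat 15 1 (\<lambda>_. 1) = 0\<^sub>m 35 1" "mD2 * mD1 = 0\<^sub>m 22 15" "mE * mD2 = 0\<^sub>m 1 35" "mE * mS = 1\<^sub>m 1"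
proof -
  have "dims 15 1 (replicate 15 [1 :: int])" by (simp add: dims_def)
  from mat_lmul[OF dims_data(1) this] show "mD1 * mat 15 1 (\<lambda>_. 1) = 0\<^sub>m 35 1"
    unfolding complex_identities using mat_replicate[of 1 15 "1 :: int"] mat_replicate[of 1 35 "0 :: int"]
    by (simp add: mat_zero_eq)
  show "mD2 * mD1 = 0\<^sub>m 22 15"
    using mat_lmul[OF dims_data(2,1)] mat_replicate[of 15 22 "0 :: int"]
    unfolding complex_identities by (simp add: mat_zero_eq)
  show "mE * mD2 = 0\<^sub>m 1 35"
    using mat_lmul[OF dims_data(5,2)] mat_replicate[of 35 1 "0 :: int"]
    unfolding complex_identities by (simp add: mat_zero_eq)
  have "mat_of_rows_list 1 [[1 :: int]] = 1\<^sub>m 1"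
    by (intro eq_matI) (auto simp: mat_of_rows_list_def)
  then show "mE * mS = 1\<^sub>m 1"
    using mat_lmul[OF dims_data(5,6)] unfolding complex_identities by simp
qed

lemma matrix_homotopy:
  obtains q e where "q \<in> carrier_mat 1 15" "e \<in> carrier_mat 22 1"
    "mH1 * mD1 + mat 15 1 (\<lambda>_. 1) * q = 1\<^sub>m 15"
    "mD1 * mH1 + mH2 * mD2 = 1\<^sub>m 35" "mD2 * mH2 + e * mE = 1\<^sub>m 22"
proof
  have 1: "dims 15 1 (replicate 15 [1 :: int])" by (simp add: dims_def)
  have 2: "dims 1 15 [lunit 15]" "dims 22 1 (map (\<lambda>a. [a]) (lunit 22))"
    by (auto simp: dims_def lunit_def)
  show "mat_of_rows_list 15 [lunit 15] \<in> carrier_mat 1 15"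
    "mat_of_rows_list 1 (map (\<lambda>a. [a]) (lunit 22)) \<in> carrier_mat 22 1"
    using dims_mat[OF 2(1)] dims_mat[OF 2(2)] .
  show "mH1 * mD1 + mat 15 1 (\<lambda>_. 1) * mat_of_rows_list 15 [lunit 15] = 1\<^sub>m 15"
    using mat_ladd[OF dims_lmul[OF dims_data(3,1)] dims_lmul[OF 1 2(1)]]
    unfolding homotopy_identities mat_lone mat_lmul[OF dims_data(3,1)] mat_lmul[OF 1 2(1)]
    using mat_replicate[of 1 15 "1 :: int"] by simp
  show "mD1 * mH1 + mH2 * mD2 = 1\<^sub>m 35"
    using mat_ladd[OF dims_lmul[OF dims_data(1,3)] dims_lmul[OF dims_data(4,2)]]
    unfolding homotopy_identities mat_lone mat_lmul[OF dims_data(1,3)] mat_lmul[OF dims_data(4,2)] by simp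
  show "mD2 * mH2 + mat_of_rows_list 1 (map (\<lambda>a. [a]) (lunit 22)) * mE = 1\<^sub>m 22"
    using mat_ladd[OF dims_lmul[OF dims_data(2,4)] dims_lmul[OF 2(2) dims_data(5)]]
    unfolding homotopy_identities mat_lone mat_lmul[OF dims_data(2,4)] mat_lmul[OF 2(2) dims_data(5)] by simp
qed

section \<open>Equivariance of the differentials\<close>

text \<open>A combination of indicator functions of orbits on pairs, hence invariant by
  construction; it defines the same matrices as \<open>orbital_rows\<close> but without reference to
  a transversal.\<close>

definition orbital :: "(int \<times> nat list) list \<Rightarrow> nat list \<Rightarrow> nat list \<Rightarrow> nat list \<Rightarrow> int" where
  "orbital T x0 y x = (\<Sum>(c, y0)\<leftarrow>T.
     if \<exists>g\<in>carrier (alt_group 5). conj_act g y0 = y \<and> conj_act g x0 = x then c else 0)"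

lemma orbital_invariant:
  assumes T: "\<forall>(c, y0)\<in>set T. y0 \<in> self_maps" and x0: "x0 \<in> self_maps"
    and g: "g \<in> carrier (alt_group 5)" and y: "y \<in> self_maps" and x: "x \<in> self_maps"
  shows "orbital T x0 (conj_act g y) (conj_act g x) = orbital T x0 y x"
proof -
  interpret group "alt_group 5" by (rule alt_group_is_group)
  let ?i = "inv\<^bsub>alt_group 5\<^esub> g"
  note comp = acts_onD(3)[OF acts_on_self_maps]
  note cancel = acts_on_inv[OF alt_group_is_group acts_on_self_maps g]
  have "(\<exists>h\<in>carrier (alt_group 5). conj_act h y0 = conj_act g y \<and> conj_act h x0 = conj_act g x)
      \<longleftrightarrow> (\<exists>h\<in>carrier (alt_group 5). conj_act h y0 = y \<and> conj_act h x0 = x)" (is "?L \<longleftrightarrow> ?R")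
    if y0: "y0 \<in> self_maps" for y0
  proof
    assume ?L
    then obtain h where h: "h \<in> carrier (alt_group 5)" "conj_act h y0 = conj_act g y" "conj_act h x0 = conj_act g x"
      by blast
    then have "conj_act (?i \<otimes>\<^bsub>alt_group 5\<^esub> h) y0 = y \<and> conj_act (?i \<otimes>\<^bsub>alt_group 5\<^esub> h) x0 = x"
      using comp[of ?i h] y0 x0 g cancel(1) x y by simp
    then show ?R using h(1) g by blast
  next
    assume ?R
    then obtain h where h: "h \<in> carrier (alt_group 5)" "conj_act h y0 = y" "conj_act h x0 = x"
      by blast
    then have "conj_act (g \<otimes>\<^bsub>alt_group 5\<^esub> h) y0 = conj_act g y \<and> conj_act (g \<otimes>\<^bsub>alt_group 5\<^esub> h) x0 = conj_act g x"
      using comp[OF g h(1)] y0 x0 by simp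
    then show ?L using h(1) g by blast
  qed
  then show ?thesis
    unfolding orbital_def using T by (intro arg_cong[of _ _ sum_list] map_cong) auto
qed

text \<open>Translating by the inverse of \<open>l\<close> reduces the pair to one with second
  component \<open>x0\<close>, and the elements fixing \<open>x0\<close> are those used in
  \<open>stab_orbit\<close>.\<close>

lemma stab_orbit_iff:
  assumes y0: "y0 \<in> self_maps" and x0: "x0 \<in> self_maps" and l: "l \<in> set A5_list"
  shows "(\<exists>g\<in>carrier (alt_group 5). conj_act g y0 = y \<and> conj_act g x0 = lconj l x0)
    \<longleftrightarrow> y \<in> set (map (lconj l) (stab_orbit x0 y0))"
proof -
  interpret group "alt_group 5" by (rule alt_group_is_group)
  note comp = acts_onD(3)[OF acts_on_self_maps]
  have lc: "lconj k z = conj_act (fn k) z" if "k \<in> set A5_list" "z \<in> self_maps" for k z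
    using conj_act_fn[OF A5_list_perm] that by simp
  have S: "set (stab_orbit x0 y0) = (\<lambda>h. conj_act h y0) ` {h \<in> carrier (alt_group 5). conj_act h x0 = x0}"
    unfolding stab_orbit_def fn_A5_list[symmetric] using lc x0 y0 by force
  have S_self: "z \<in> self_maps" if "z \<in> set (stab_orbit x0 y0)" for z
    using that conj_act_self_maps y0 unfolding S by auto
  let ?l = "fn l" and ?i = "inv\<^bsub>alt_group 5\<^esub> (fn l)"
  have fl: "?l \<in> carrier (alt_group 5)" by (rule fn_carrier[OF l])
  show ?thesis
  proof
    assume "\<exists>g\<in>carrier (alt_group 5). conj_act g y0 = y \<and> conj_act g x0 = lconj l x0"
    then obtain g where g: "g \<in> carrier (alt_group 5)" "conj_act g y0 = y" "conj_act g x0 = conj_act ?l x0"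
      using lc[OF l x0] by auto
    let ?h = "?i \<otimes>\<^bsub>alt_group 5\<^esub> g"
    have h: "?h \<in> carrier (alt_group 5)" using fl g(1) by simp
    have "conj_act ?h x0 = x0"
      using comp[OF _ g(1) x0, of ?i] fl g(3) acts_on_inv(1)[OF alt_group_is_group acts_on_self_maps fl x0] by simp
    then have m: "conj_act ?h y0 \<in> set (stab_orbit x0 y0)" unfolding S using h by blast
    have "conj_act ?l (conj_act ?h y0) = y"
      using comp[OF _ g(1) y0, of ?i] fl g(1,2)
        acts_on_inv(2)[OF alt_group_is_group acts_on_self_maps fl] conj_act_self_maps[OF g(1) y0] by simp
    then have "y = lconj l (conj_act ?h y0)" using lc[OF l S_self[OF m]] by simp
    then show "y \<in> set (map (lconj l) (stab_orbit x0 y0))" using m by simp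
  next
    assume "y \<in> set (map (lconj l) (stab_orbit x0 y0))"
    then obtain z where z: "z \<in> set (stab_orbit x0 y0)" "y = lconj l z" by auto
    then obtain h where h: "h \<in> carrier (alt_group 5)" "conj_act h x0 = x0" "z = conj_act h y0"
      unfolding S by blast
    have "conj_act (?l \<otimes>\<^bsub>alt_group 5\<^esub> h) y0 = y \<and> conj_act (?l \<otimes>\<^bsub>alt_group 5\<^esub> h) x0 = lconj l x0"
      using comp[OF fl h(1)] x0 y0 h(2,3) z(2) lc[OF l S_self[OF z(1)]] lc[OF l x0] by simp
    then show "\<exists>g\<in>carrier (alt_group 5). conj_act g y0 = y \<and> conj_act g x0 = lconj l x0"
      using fl h(1) by blast
  qed
qed

text \<open>This identifies the evaluated rows with an invariant kernel. The literal matrices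
  thereby inherit equivariance, with no commutation check over the group.\<close>

lemma orbital_rows_eq:
  assumes T: "\<forall>(c, y0)\<in>set T. y0 \<in> self_maps" and x0: "x0 \<in> self_maps" and R: "set R \<subseteq> set A5_list"
  shows "orbital_rows T x0 R ys = map (\<lambda>y. map (orbital T x0 y) (map (\<lambda>g. lconj g x0) R)) ys"
proof -
  have "orbital T x0 y (lconj l x0)
      = (\<Sum>(c, zs)\<leftarrow>map (\<lambda>(c, S). (c, map (lconj l) S)) (map (\<lambda>(c, y). (c, stab_orbit x0 y)) T).
          if y \<in> set zs then c else 0)" if "l \<in> set R" for y l
  proof -
    have l: "l \<in> set A5_list" using that R by blast
    have "(case p of (c, y0) \<Rightarrow> if \<exists>g\<in>carrier (alt_group 5). conj_act g y0 = y \<and> conj_act g x0 = lconj l x0 then c else 0)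
        = (case (case (case p of (c, y) \<Rightarrow> (c, stab_orbit x0 y)) of (c, S) \<Rightarrow> (c, map (lconj l) S)) of
            (c, zs) \<Rightarrow> if y \<in> set zs then c else 0)" if "p \<in> set T" for p
    proof (cases p)
      case (Pair c y0)
      then have "y0 \<in> self_maps" using T that by auto
      from stab_orbit_iff[OF this x0 l] Pair show ?thesis by simp
    qed
    then show ?thesis unfolding orbital_def map_map comp_def
      by (intro arg_cong[of _ _ sum_list] map_cong) auto
  qed
  then show ?thesis unfolding orbital_rows_def Let_def by simp
qed

lemma tables_self_maps:
  "\<forall>(c, y0)\<in>set T1. y0 \<in> self_maps" "\<forall>(c, y0)\<in>set T2. y0 \<in> self_maps" "\<forall>(c, y0)\<in>set T3. y0 \<in> self_maps"
proof -
  have *: "y0 \<in> self_maps" if "length y0 = 6" "list_all (\<lambda>i. i < 6) y0" for y0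
    using that by (auto simp: self_maps_def list_all_length)
  show "\<forall>(c, y0)\<in>set T1. y0 \<in> self_maps" "\<forall>(c, y0)\<in>set T2. y0 \<in> self_maps" "\<forall>(c, y0)\<in>set T3. y0 \<in> self_maps"
    by (auto simp: T1_def T2_def T3_def intro!: *)
qed

text \<open>A point of \<open>P_list\<close> lies in just one of the two orbits, and there the other
  summand vanishes by \<open>orbital_zero\<close>; the sum thus glues the maps on the two
  summands.\<close>

definition kernel2 :: "nat list \<Rightarrow> nat list \<Rightarrow> int" where
  "kernel2 y x = orbital T2 t0 y x + orbital T3 c0 y x"

lemma orbital_zero:
  assumes "is_orbit X x0" "x \<notin> set X"
  shows "orbital T x0 y x = 0"
proof -
  have neg: "(\<exists>g\<in>carrier (alt_group 5). conj_act g y0 = y \<and> conj_act g x0 = x) = False" for y0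
    using assms by (auto simp: is_orbit_def)
  have "orbital T x0 y x = (\<Sum>(c, y0)\<leftarrow>T. 0)"
    unfolding orbital_def neg if_False ..
  also have "\<dots> = 0" by (induction T) auto
  finally show ?thesis .
qed

lemma kmat_D1: "kmat (orbital T1 t0) P_list X15 = mD1"
  using orbital_rows_eq[OF tables_self_maps(1) _ transversals(1), of t0 P_list] orbits(1) lengths(1)
  unfolding D1_rows kmat_rows X15_def[symmetric] is_orbit_def by simp

lemma map2_append_map: "map2 (@) (map f ys) (map g ys) = map (\<lambda>y. f y @ g y) ys"
  by (induction ys) auto

lemma kmat_D2: "kmat kernel2 Q_list P_list = mD2"
proof -
  have disj: "x \<in> set X15 \<Longrightarrow> x \<notin> set X20" "x \<in> set X20 \<Longrightarrow> x \<notin> set X15" for x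
    using Q_distinct(2) by (auto simp: P_list_def)
  have "map (kernel2 y) P_list = map (orbital T2 t0 y) X15 @ map (orbital T3 c0 y) X20" for y
    using orbital_zero[OF orbits(1)] orbital_zero[OF orbits(2)] disj
    by (auto simp: P_list_def kernel2_def)
  then have "map (\<lambda>y. map (kernel2 y) P_list) Q_list
      = map2 (@) (map (\<lambda>y. map (orbital T2 t0 y) X15) Q_list) (map (\<lambda>y. map (orbital T3 c0 y) X20) Q_list)"
    by (simp add: map2_append_map)
  also have "\<dots> = D2"
    using orbital_rows_eq[OF tables_self_maps(2) _ transversals(1), of t0 Q_list]
      orbital_rows_eq[OF tables_self_maps(3) _ transversals(2), of c0 Q_list] orbits(1,2)
    unfolding D2_rows[symmetric] X15_def[symmetric] X20_def[symmetric] is_orbit_def by simp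
  finally show ?thesis unfolding kmat_rows lengths by simp
qed

lemma P_Q_self_maps: "set X15 \<subseteq> self_maps" "set P_list \<subseteq> self_maps" "set Q_list \<subseteq> self_maps"
  using orbit_acts(1)[OF orbits(1)] orbit_acts(1)[OF orbits(2)] orbit_acts(1)[OF orbits(3)]
    orbit_acts(1)[OF orbits(4)] orbit_acts(1)[OF orbits(5)]
  by (simp_all add: P_list_def Q_list_def)

lemma X_distinct: "distinct X15" "distinct X20" "distinct X12" "distinct X5" "distinct X5'"
  using Q_distinct by (simp_all add: P_list_def Q_list_def)

abbreviation "P_lat \<equiv> list_lat P_list conj_act"
abbreviation "Q_lat \<equiv> list_lat Q_list conj_act"

lemma hom_D1: "lat_hom (alt_group 5) (list_lat X15 conj_act) P_lat mD1"
  unfolding kmat_D1[symmetric]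
proof (rule lat_hom_kmat[OF alt_group_is_group orbit_acts(2)[OF orbits(1)] acts_on_P X_distinct(1) Q_distinct(2)])
  fix g y x assume "g \<in> carrier (alt_group 5)" "y \<in> set P_list" "x \<in> set X15"
  then show "orbital T1 t0 (conj_act g y) (conj_act g x) = orbital T1 t0 y x"
    using orbital_invariant[OF tables_self_maps(1)] orbits(1) P_Q_self_maps unfolding is_orbit_def by blast
qed

lemma hom_D2: "lat_hom (alt_group 5) P_lat Q_lat mD2"
  unfolding kmat_D2[symmetric]
proof (rule lat_hom_kmat[OF alt_group_is_group acts_on_P acts_on_Q Q_distinct(2,1)])
  fix g y x assume *: "g \<in> carrier (alt_group 5)" "y \<in> set Q_list" "x \<in> set P_list"
  have "t0 \<in> self_maps" "c0 \<in> self_maps" using orbits(1,2) by (auto simp: is_orbit_def)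
  then show "kernel2 (conj_act g y) (conj_act g x) = kernel2 y x"
    unfolding kernel2_def
    using * orbital_invariant[OF tables_self_maps(2)] orbital_invariant[OF tables_self_maps(3)] P_Q_self_maps
    by (metis subsetD)
qed

lemma weights_invariant:
  assumes "g \<in> carrier (alt_group 5)" "y \<in> set Q_list"
  shows "weight_E (conj_act g y) = weight_E y" "weight_S (conj_act g y) = weight_S y"
proof -
  have iff: "conj_act g y \<in> set X \<longleftrightarrow> y \<in> set X" if "is_orbit X x" for X x
  proof -
    have "inv\<^bsub>alt_group 5\<^esub> g \<in> carrier (alt_group 5)"
      using assms(1) group.inv_closed[OF alt_group_is_group] by blast
    then show ?thesis
      using acts_onD(1)[OF orbit_acts(2)[OF that]] assms P_Q_self_maps(3)
        acts_on_inv(1)[OF alt_group_is_group acts_on_self_maps assms(1)] by (metis subsetD)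
  qed
  show "weight_E (conj_act g y) = weight_E y" "weight_S (conj_act g y) = weight_S y"
    unfolding weight_E_def weight_S_def by (simp_all only: iff[OF orbits(3)] iff[OF orbits(4)])
qed

lemma kmat_E: "kmat (\<lambda>_. weight_E) [()] Q_list = mE"
  using weights(1) unfolding kmat_rows lengths by simp

lemma kmat_S: "kmat (\<lambda>y _. weight_S y) Q_list [()] = mS"
  using weights(2) unfolding kmat_rows by simp

lemma E_invariant: "g \<in> carrier (alt_group 5) \<Longrightarrow> mE * snd Q_lat g = mE"
  unfolding kmat_E[symmetric] list_lat_def snd_conv
  by (subst kmat_mult_graph[OF Q_distinct(1)])
    (use acts_onD(1)[OF acts_on_Q] weights_invariant(1) in \<open>auto intro!: kmat_cong\<close>)

lemma S_invariant:
  assumes "g \<in> carrier (alt_group 5)"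
  shows "snd Q_lat g * mS = mS"
proof -
  have i: "inv\<^bsub>alt_group 5\<^esub> g \<in> carrier (alt_group 5)"
    using assms group.inv_closed[OF alt_group_is_group] by blast
  show ?thesis
    unfolding kmat_S[symmetric] list_lat_def snd_conv
    by (subst kmat_graph_mult[OF Q_distinct(1), where f="conj_act (inv\<^bsub>alt_group 5\<^esub> g)"])
      (use acts_onD(1)[OF acts_on_Q i] weights_invariant(2)[OF i]
        acts_on_eq_iff[OF alt_group_is_group acts_on_Q assms] in \<open>auto intro!: kmat_cong\<close>)
qed

section \<open>The resolution\<close>

text \<open>A single point \<open>()\<close> with full stabilizer exhibits the trivial lattice as
  the coset lattice of the whole group. It is the permutation lattice added to \<open>F\<close> at
  the end.\<close>

lemma lat_triv_coset: "lat_iso G lat_triv (coset_lat G (carrier G))" "G_lattice G (coset_lat G (carrier G))"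
  if "group G" for G :: "('g, 'b) monoid_scheme"
proof -
  have acts: "acts_on G (\<lambda>_ x. x) (set [()])" by (simp add: acts_on_def)
  interpret group G by fact
  have "\<forall>x\<in>set [()]. \<exists>g\<in>carrier G. () = x" by auto
  note c = coset_lat_iso[OF that acts _ _ this, of "carrier G"]
  have triv: "lat_iso G lat_triv (list_lat [()] (\<lambda>_ x. x))"
  proof (rule lat_iso_cong)
    show "G_lattice G (list_lat [()] (\<lambda>_ x. x))" by (rule G_lattice_list_lat[OF acts]) simp
  qed (auto simp: lat_triv_def list_lat_def kmat_def intro!: eq_matI)
  show "G_lattice G (coset_lat G (carrier G))" using c by simp
  moreover have "G_lattice G lat_triv" by (simp add: G_lattice_def lat_triv_def)
  moreover have "G_lattice G (list_lat [()] (\<lambda>_ x. x))" by (rule G_lattice_list_lat[OF acts]) simp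
  ultimately show "lat_iso G lat_triv (coset_lat G (carrier G))"
    using lat_iso_trans[OF triv] c by simp
qed

lemma perm_lattice_single:
  assumes "G_lattice G M" "subgroup K G" "lat_iso G M (coset_lat G K)" "G_lattice G (coset_lat G K)" "group G"
  shows "perm_lattice G M"
  unfolding perm_lattice_def
proof (intro conjI exI)
  show "lat_iso G M (lat_dsum_list (map (coset_lat G) [K]))"
    using lat_iso_trans[OF assms(3) lat_iso_sym[OF lat_iso_dsum_zero[OF assms(4)]] assms(1,4)
        G_lattice_dsum[OF assms(4) G_lattice_zero assms(5)]] by simp
qed (use assms in auto)

lemma P_lat_iso:
  assumes "x \<in> set X15" "y \<in> set X20"
  shows "lat_iso (alt_group 5) P_lat (lat_dsum_list (map (coset_lat (alt_group 5)) [stab x, stab y]))"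
proof -
  note X = orbit_coset_lat[OF orbits(1) X_distinct(1) assms(1)]
  note Y = orbit_coset_lat[OF orbits(2) X_distinct(2) assms(2)]
  note sum = G_lattice_dsum[OF _ _ alt_group_is_group]
  have 1: "lat_iso (alt_group 5) P_lat (lat_dsum (list_lat X15 conj_act) (list_lat X20 conj_act))"
    unfolding P_list_def
    by (rule list_lat_append[OF orbit_acts(2)[OF orbits(1)] orbit_acts(2)[OF orbits(2)]
          Q_distinct(2)[unfolded P_list_def] alt_group_is_group])
  have 2: "lat_iso (alt_group 5) (lat_dsum (list_lat X15 conj_act) (list_lat X20 conj_act))
      (lat_dsum (coset_lat (alt_group 5) (stab x)) (lat_dsum (coset_lat (alt_group 5) (stab y)) lat_zero))"
    by (rule lat_iso_dsum[OF X(1) lat_iso_trans[OF Y(1) lat_iso_sym[OF lat_iso_dsum_zero[OF Y(2)]] Y(4,2)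
            sum[OF Y(2) G_lattice_zero]] X(4) Y(4) X(2) sum[OF Y(2) G_lattice_zero]])
  show ?thesis
    unfolding list.map lat_dsum_list.simps
    by (rule lat_iso_trans[OF 1 2 G_lattice_list_lat[OF acts_on_P Q_distinct(2)] sum[OF X(4) Y(4)]
          sum[OF X(2) sum[OF Y(2) G_lattice_zero]]])
qed

lemma Q_lat_iso:
  assumes "x \<in> set X12" "y \<in> set X5" "z \<in> set X5'"
  shows "lat_iso (alt_group 5) Q_lat (lat_dsum (coset_lat (alt_group 5) (stab x))
      (lat_dsum (coset_lat (alt_group 5) (stab y)) (coset_lat (alt_group 5) (stab z))))"
proof -
  note X = orbit_coset_lat[OF orbits(3) X_distinct(3) assms(1)]
  note Y = orbit_coset_lat[OF orbits(4) X_distinct(4) assms(2)]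
  note Z = orbit_coset_lat[OF orbits(5) X_distinct(5) assms(3)]
  note sum = G_lattice_dsum[OF _ _ alt_group_is_group]
  have d: "distinct (X12 @ X5 @ X5')" "distinct (X5 @ X5')" using Q_distinct(1) by (auto simp: Q_list_def)
  have YZ: "acts_on (alt_group 5) conj_act (set (X5 @ X5'))"
    using acts_on_Un[OF orbit_acts(2)[OF orbits(4)] orbit_acts(2)[OF orbits(5)]] by simp
  have LYZ: "G_lattice (alt_group 5) (list_lat (X5 @ X5') conj_act)" by (rule G_lattice_list_lat[OF YZ d(2)])
  note yz = list_lat_append[OF orbit_acts(2)[OF orbits(4)] orbit_acts(2)[OF orbits(5)] d(2) alt_group_is_group]
  note CYZ = sum[OF Y(2) Z(2)]
  have yz': "lat_iso (alt_group 5) (list_lat (X5 @ X5') conj_act)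
      (lat_dsum (coset_lat (alt_group 5) (stab y)) (coset_lat (alt_group 5) (stab z)))"
    by (rule lat_iso_trans[OF yz lat_iso_dsum[OF Y(1) Z(1) Y(4) Z(4) Y(2) Z(2)] LYZ sum[OF Y(4) Z(4)] CYZ])
  show ?thesis
    unfolding Q_list_def
    by (rule lat_iso_trans[OF list_lat_append[OF orbit_acts(2)[OF orbits(3)] YZ d(1) alt_group_is_group]
          lat_iso_dsum[OF X(1) yz' X(4) LYZ X(2) CYZ]
          G_lattice_list_lat[OF acts_on_Q[unfolded Q_list_def] d(1)] sum[OF X(4) LYZ] sum[OF X(2) CYZ]])
qed

lemma Q_lat_perm: "perm_lattice (alt_group 5) Q_lat"
proof -
  have "X12 \<noteq> []" "X5 \<noteq> []" "X5' \<noteq> []"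
    by (simp_all add: X12_def X5_def X5'_def R12_def lprod_def C3_list_def V4_list_def C5_list_def)
  then obtain a b c where abc: "a \<in> set X12" "b \<in> set X5" "c \<in> set X5'"
    by (metis list.set_sel(1))
  note A = orbit_coset_lat[OF orbits(3) X_distinct(3) abc(1)]
  note B = orbit_coset_lat[OF orbits(4) X_distinct(4) abc(2)]
  note C = orbit_coset_lat[OF orbits(5) X_distinct(5) abc(3)]
  note sum = G_lattice_dsum[OF _ _ alt_group_is_group]
  note C0 = sum[OF C(2) G_lattice_zero]
  have "lat_iso (alt_group 5)
      (lat_dsum (coset_lat (alt_group 5) (stab a)) (lat_dsum (coset_lat (alt_group 5) (stab b)) (coset_lat (alt_group 5) (stab c))))
      (lat_dsum_list (map (coset_lat (alt_group 5)) [stab a, stab b, stab c]))"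
    unfolding list.map lat_dsum_list.simps
    by (rule lat_iso_dsum[OF lat_iso_refl[OF A(2)] lat_iso_dsum[OF lat_iso_refl[OF B(2)]
            lat_iso_sym[OF lat_iso_dsum_zero[OF C(2)]] B(2) C(2) B(2) C0]
          A(2) sum[OF B(2) C(2)] A(2) sum[OF B(2) C0]])
  moreover have "G_lattice (alt_group 5) (lat_dsum_list (map (coset_lat (alt_group 5)) [stab a, stab b, stab c]))"
    using sum[OF A(2) sum[OF B(2) C0]] by simp
  moreover have Q: "G_lattice (alt_group 5) Q_lat" by (rule G_lattice_list_lat[OF acts_on_Q Q_distinct(1)])
  ultimately have "lat_iso (alt_group 5) Q_lat (lat_dsum_list (map (coset_lat (alt_group 5)) [stab a, stab b, stab c]))"
    using lat_iso_trans[OF Q_lat_iso[OF abc]] sum[OF A(2) sum[OF B(2) C(2)]] by blast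
  then show ?thesis
    unfolding perm_lattice_def using Q A(3) B(3) C(3)
    by (intro conjI exI[of _ "[stab a, stab b, stab c]"]) auto
qed

text \<open>Transport from the explicit basis \<open>xs\<close> to the chosen basis
  \<open>cs\<close> of the coset lattice: the permutation matrices \<open>?T\<close> and
  \<open>?U\<close> of the orbit-stabilizer bijection are mutually inverse and preserve the all-ones
  vector, so all data can be conjugated.\<close>

lemma chevalley_short_exact_orbit:
  assumes "group G" "acts_on G act (set xs)" "distinct xs" "x0 \<in> set xs"
    and trans: "\<forall>x\<in>set xs. \<exists>g\<in>carrier G. act g x0 = x"
    and H: "H = {g \<in> carrier G. act g x0 = x0}"
    and P: "G_lattice G P" and F: "G_lattice G F"
    and D: "lat_hom G (list_lat xs act) P D" and B: "lat_hom G P F B"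
    and surj: "\<forall>w\<in>carrier_vec (fst F). \<exists>v\<in>carrier_vec (fst P). B *\<^sub>v v = w"
    and exact: "\<forall>v\<in>carrier_vec (fst P). B *\<^sub>v v = 0\<^sub>v (fst F) \<longleftrightarrow>
      (\<exists>w\<in>carrier_vec (length xs). D *\<^sub>v w = v)"
    and K: "K \<in> carrier_mat (length xs) (fst P)" and q: "q \<in> carrier_mat 1 (length xs)"
    and D0: "D * mat (length xs) 1 (\<lambda>_. 1) = 0\<^sub>m (fst P) 1"
    and hom: "K * D + mat (length xs) 1 (\<lambda>_. 1) * q = 1\<^sub>m (length xs)"
  shows "\<exists>A. short_exact G (chevalley_J G H) A P B F"
proof -
  let ?f = "\<lambda>x. {g \<in> carrier G. act g x0 = x}"
  let ?l = "\<lambda>g S. g <#\<^bsub>G\<^esub> S"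
  obtain cs where cs: "coset_lat G H = list_lat cs ?l" "distinct cs" "acts_on G ?l (set cs)"
    "bij_betw ?f (set xs) (set cs)" "\<forall>g\<in>carrier G. \<forall>x\<in>set xs. ?f (act g x) = g <#\<^bsub>G\<^esub> ?f x"
    by (rule coset_lat_eq_list_lat[of G act xs x0 H, OF assms(1,2,4) trans H])
  let ?T = "kmat (\<lambda>y x. of_bool (?f x = y)) cs xs" and ?U = "kmat (\<lambda>x y. of_bool (?f x = y)) xs cs"
  have TU: "?T * ?U = 1\<^sub>m (length cs)" and UT: "?U * ?T = 1\<^sub>m (length xs)"
    using kmat_bij[OF assms(3) cs(2,4)] by auto
  have homU: "lat_hom G (list_lat cs ?l) (list_lat xs act) ?U"
    by (rule lat_homs_bij(2)[of G act xs ?l cs ?f, OF assms(1,2) cs(3) assms(3) cs(2,4)]) (use cs(5) in blast)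
  have Dc: "D \<in> carrier_mat (fst P) (length xs)" using D by (simp add: lat_hom_def)
  have homD: "lat_hom G (list_lat cs ?l) P (D * ?U)"
    by (rule lat_hom_comp[OF homU D G_lattice_list_lat[OF cs(3,2)] G_lattice_list_lat[OF assms(2,3)] P])
  have ones: "mat (length ys) 1 (\<lambda>_. 1) = kmat (\<lambda>_ _. 1) ys [()]" for ys :: "'z list"
    by (auto simp: kmat_def)
  have fcs: "?f x \<in> set cs" if "x \<in> set xs" for x
    using cs(4) that by (auto simp: bij_betw_def)
  have U1: "?U * mat (length cs) 1 (\<lambda>_. 1) = mat (length xs) 1 (\<lambda>_. 1)"
    unfolding ones by (rule kmat_graph_mult[OF cs(2), where f="?f"]) (use fcs in auto)
  have T1: "?T * mat (length xs) 1 (\<lambda>_. 1) = mat (length cs) 1 (\<lambda>_. 1)"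
    unfolding U1[symmetric]
    using assoc_mult_mat[of ?T "length cs" "length xs" ?U "length cs" "mat (length cs) 1 (\<lambda>_. 1)" 1] TU
    by simp
  show ?thesis
  proof (rule chevalley_short_exact[OF assms(1) cs(1,3,2) _ P F homD B surj])
    show "cs \<noteq> []" using fcs[OF assms(4)] by auto
    have "(\<exists>w\<in>carrier_vec (length xs). D *\<^sub>v w = v) \<longleftrightarrow> (\<exists>w\<in>carrier_vec (length cs). D * ?U *\<^sub>v w = v)" for v
    proof
      assume "\<exists>w\<in>carrier_vec (length xs). D *\<^sub>v w = v"
      then obtain w where w: "w \<in> carrier_vec (length xs)" "D *\<^sub>v w = v" by blast
      have Tw: "?T *\<^sub>v w \<in> carrier_vec (length cs)" using w(1) by (intro mult_mat_vec_carrier[OF kmat_carrier])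
      have "D * ?U *\<^sub>v (?T *\<^sub>v w) = D *\<^sub>v (?U *\<^sub>v (?T *\<^sub>v w))"
        by (rule assoc_mult_mat_vec[OF Dc kmat_carrier Tw])
      also have "?U *\<^sub>v (?T *\<^sub>v w) = ?U * ?T *\<^sub>v w"
        by (rule assoc_mult_mat_vec[OF kmat_carrier kmat_carrier w(1), symmetric])
      finally show "\<exists>w\<in>carrier_vec (length cs). D * ?U *\<^sub>v w = v"
        using Tw w UT by (intro bexI[of _ "?T *\<^sub>v w"]) simp_all
    next
      assume "\<exists>w\<in>carrier_vec (length cs). D * ?U *\<^sub>v w = v"
      then obtain w where w: "w \<in> carrier_vec (length cs)" "D * ?U *\<^sub>v w = v" by blast
      have "?U *\<^sub>v w \<in> carrier_vec (length xs)" by (rule mult_mat_vec_carrier[OF kmat_carrier w(1)])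
      moreover have "D *\<^sub>v (?U *\<^sub>v w) = v"
        using assoc_mult_mat_vec[OF Dc kmat_carrier w(1)] w(2) by simp
      ultimately show "\<exists>w\<in>carrier_vec (length xs). D *\<^sub>v w = v" by blast
    qed
    then show "\<forall>v\<in>carrier_vec (fst P). (B *\<^sub>v v = 0\<^sub>v (fst F)) = (\<exists>w\<in>carrier_vec (length cs). D * ?U *\<^sub>v w = v)"
      using exact by simp
    show "?T * K \<in> carrier_mat (length cs) (fst P)" by (rule mult_carrier_mat[OF kmat_carrier K])
    show "q * ?U \<in> carrier_mat 1 (length cs)" by (rule mult_carrier_mat[OF q kmat_carrier])
    have "D * ?U * mat (length cs) 1 (\<lambda>_. 1) = D * (?U * mat (length cs) 1 (\<lambda>_. 1))"
      by (rule assoc_mult_mat[of _ "fst P" "length xs" _ "length cs" _ 1]) (use Dc in simp_all)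
    then show "D * ?U * mat (length cs) 1 (\<lambda>_. 1) = 0\<^sub>m (fst P) 1" unfolding U1 D0 .
    \<comment> \<open>Conjugating the homotopy by \<open>?T\<close> and \<open>?U\<close> turns its
      three ingredients into \<open>?T * K\<close>, \<open>D * ?U\<close> and \<open>q * ?U\<close>,
      since the all-ones vector is preserved.\<close>
    have "?T * (K * D + mat (length xs) 1 (\<lambda>_. 1) * q) * ?U = ?T * (K * D) * ?U + ?T * (mat (length xs) 1 (\<lambda>_. 1) * q) * ?U"
      using K Dc q by (subst mult_add_distrib_mat[of _ "length cs" "length xs" _ "length xs"])
        (auto intro!: add_mult_distrib_mat[of _ "length cs" "length xs"])
    moreover have "?T * (K * D) * ?U = ?T * K * (D * ?U)"
      using K Dc by (simp add: mat_assoc)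
    moreover have "?T * (mat (length xs) 1 (\<lambda>_. 1) * q) * ?U = ?T * mat (length xs) 1 (\<lambda>_. 1) * (q * ?U)"
      using q by (simp add: mat_assoc)
    moreover have "?T * 1\<^sub>m (length xs) = ?T" by (rule mat_mult_one) simp
    ultimately show "?T * K * (D * ?U) + mat (length cs) 1 (\<lambda>_. 1) * (q * ?U) = 1\<^sub>m (length cs)"
      unfolding hom T1 using TU by metis
  qed
qed

theorem theorem1p3:
  fixes H :: "(nat \<Rightarrow> nat) set"
  assumes "subgroup H (alt_group 5)"
    and "(alt_group 5)\<lparr>carrier := H\<rparr> \<cong> DirProd (integer_mod_group 2) (integer_mod_group 2)"
  shows "\<exists>A P B F. flabby_resolution (alt_group 5) (chevalley_J (alt_group 5) H) A P B F \<and>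
           fst F = 21 \<and>
           (\<forall>C A4. subgroup C (alt_group 5) \<longrightarrow> (alt_group 5)\<lparr>carrier := C\<rparr> \<cong> integer_mod_group 5 \<longrightarrow>
              subgroup A4 (alt_group 5) \<longrightarrow> (alt_group 5)\<lparr>carrier := A4\<rparr> \<cong> alt_group 4 \<longrightarrow>
              lat_iso (alt_group 5)
                (lat_dsum (coset_lat (alt_group 5) C)
                   (lat_dsum (coset_lat (alt_group 5) A4) (coset_lat (alt_group 5) A4)))
                (lat_dsum lat_triv F)) \<and>
           stably_perm (alt_group 5) F"
proof -
  let ?G = "alt_group 5"
  interpret group ?G by (rule alt_group_is_group)
  obtain x where x: "x \<in> set X15" "H = stab x" using klein_subgroup_stab[OF assms] by blast
  have Pl: "G_lattice ?G P_lat" by (rule G_lattice_list_lat[OF acts_on_P Q_distinct(2)])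
  have Ql: "G_lattice ?G Q_lat" by (rule G_lattice_list_lat[OF acts_on_Q Q_distinct(1)])
  have dims: "mD1 \<in> carrier_mat 35 15" "mD2 \<in> carrier_mat 22 35" "mH1 \<in> carrier_mat 15 35"
    "mH2 \<in> carrier_mat 35 22" "mE \<in> carrier_mat 1 22" "mS \<in> carrier_mat 22 1"
    using dims_mat dims_data by blast+
  have E0: "mE $$ (0, 0) = 1" by (simp add: E_row_def mat_of_rows_list_def nth_append)
  have nQ: "fst Q_lat = Suc 21" by (simp add: lengths)
  obtain F i r where F: "fst F = 21" "G_lattice ?G F" and hi: "lat_hom ?G F Q_lat i" and hr: "lat_hom ?G Q_lat F r"
    and ri: "r * i = 1\<^sub>m 21" and ir: "i * r + mS * mE = 1\<^sub>m (Suc 21)" and Ei: "mE * i = 0\<^sub>m 1 21"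
    and rS: "r * mS = 0\<^sub>m 21 1" and isoF: "lat_iso ?G Q_lat (lat_dsum lat_triv F)"
    by (rule kernel_complement[OF alt_group_is_group Ql nQ _ E0 _ matrix_identities(4) E_invariant S_invariant])
      (use dims in simp_all)
  have i: "i \<in> carrier_mat 22 21" and r: "r \<in> carrier_mat 21 22"
    using hi hr F(1) by (simp_all add: lat_hom_def lengths)
  obtain q e where q: "q \<in> carrier_mat 1 15" and e: "e \<in> carrier_mat 22 1"
    and h1: "mH1 * mD1 + mat 15 1 (\<lambda>_. 1) * q = 1\<^sub>m 15" and h2: "mD1 * mH1 + mH2 * mD2 = 1\<^sub>m 35"
    and h3: "mD2 * mH2 + e * mE = 1\<^sub>m 22"
    by (rule matrix_homotopy)
  \<comment> \<open>The second differential in coordinates of \<open>F\<close>, the kernel of the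
    weights.\<close>
  define B where "B = r * mD2"
  have B: "B \<in> carrier_mat 21 35" using r dims by (simp add: B_def)
  have homB: "lat_hom ?G P_lat F B"
    unfolding B_def by (rule lat_hom_comp[OF hom_D2 hr Pl Ql F(2)])
  \<comment> \<open>The columns of \<open>mD2\<close> already lie in the kernel of
    \<open>mE\<close>, so passing to coordinates of \<open>F\<close> and back changes
    nothing.\<close>
  have iB: "i * B = mD2"
  proof -
    have "i * (r * mD2) + mS * (mE * mD2) = mD2"
      by (rule split_mult[OF ir]) (use i r dims in auto)
    moreover have "mS * (mE * mD2) = 0\<^sub>m 22 35"
      unfolding matrix_identities using dims(6) by (rule right_mult_zero_mat)
    moreover have "i * (r * mD2) \<in> carrier_mat 22 35" using i r dims by auto
    ultimately show ?thesis unfolding B_def by (metis right_add_zero_mat)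
  qed
  have BD1: "B * mD1 = 0\<^sub>m 21 15"
    unfolding B_def using assoc_mult_mat[OF r dims(2,1)] matrix_identities(2) right_mult_zero_mat[OF r] by simp
  \<comment> \<open>On the kernel of \<open>mE\<close> the homotopy reduces to
    \<open>mD2 mH2 = 1\<close>, so \<open>mH2 * i\<close> is a section of \<open>B\<close> and gives
    surjectivity.\<close>
  have lift: "mD2 * (mH2 * i) = i"
  proof -
    have "mD2 * (mH2 * i) + e * (mE * i) = i"
      by (rule split_mult[OF h3]) (use i dims e in auto)
    moreover have "e * (mE * i) = 0\<^sub>m 22 21" unfolding Ei using e by (rule right_mult_zero_mat)
    moreover have "mD2 * (mH2 * i) \<in> carrier_mat 22 21" using i dims by auto
    ultimately show ?thesis by (metis right_add_zero_mat)
  qed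
  have surj: "\<forall>w\<in>carrier_vec (fst F). \<exists>v\<in>carrier_vec (fst P_lat). B *\<^sub>v v = w"
  proof
    fix w :: "int vec" assume "w \<in> carrier_vec (fst F)"
    then have w: "w \<in> carrier_vec 21" by (simp add: F)
    have "B * (mH2 * i) = 1\<^sub>m 21"
      unfolding B_def using assoc_mult_mat[OF r dims(2), of "mH2 * i" 21] dims(4) i lift ri by simp
    moreover have c: "mH2 * i \<in> carrier_mat 35 21" using dims(4) i by simp
    ultimately have "B *\<^sub>v (mH2 * i *\<^sub>v w) = w"
      using assoc_mult_mat_vec[OF B c w] w by simp
    then show "\<exists>v\<in>carrier_vec (fst P_lat). B *\<^sub>v v = w"
      using mult_mat_vec_carrier[OF c w] by (auto simp: lengths)
  qed
  have exact: "\<forall>v\<in>carrier_vec (fst P_lat). B *\<^sub>v v = 0\<^sub>v (fst F) \<longleftrightarrow>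
      (\<exists>w\<in>carrier_vec (length X15). mD1 *\<^sub>v w = v)"
  proof
    fix v :: "int vec" assume "v \<in> carrier_vec (fst P_lat)"
    then have v: "v \<in> carrier_vec 35" by (simp add: lengths)
    show "B *\<^sub>v v = 0\<^sub>v (fst F) \<longleftrightarrow> (\<exists>w\<in>carrier_vec (length X15). mD1 *\<^sub>v w = v)"
    proof
      assume "B *\<^sub>v v = 0\<^sub>v (fst F)"
      then have "mD2 *\<^sub>v v = i *\<^sub>v 0\<^sub>v 21"
        using assoc_mult_mat_vec[OF i B v] iB F(1) by simp
      then have "mD2 *\<^sub>v v = 0\<^sub>v 22" using i by (auto intro!: eq_vecI)
      then have z: "(mH2 * mD2) *\<^sub>v v = 0\<^sub>v 35"
        using assoc_mult_mat_vec[OF dims(4,2) v] dims(4) by (auto intro!: eq_vecI)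
      \<comment> \<open>With \<open>mD2 v = 0\<close> the homotopy leaves
        \<open>v = mD1 (mH1 v)\<close>, which is an explicit preimage.\<close>
      have "v = (mD1 * mH1 + mH2 * mD2) *\<^sub>v v" unfolding h2 using v by simp
      also have "\<dots> = (mD1 * mH1) *\<^sub>v v + (mH2 * mD2) *\<^sub>v v"
        by (rule add_mult_distrib_mat_vec[of _ 35 35]) (use dims v in auto)
      also have "\<dots> = mD1 *\<^sub>v (mH1 *\<^sub>v v) + 0\<^sub>v 35"
        unfolding z assoc_mult_mat_vec[OF dims(1,3) v] ..
      also have "\<dots> = mD1 *\<^sub>v (mH1 *\<^sub>v v)"
        by (rule right_zero_vec[OF mult_mat_vec_carrier[OF dims(1) mult_mat_vec_carrier[OF dims(3) v]]])
      finally show "\<exists>w\<in>carrier_vec (length X15). mD1 *\<^sub>v w = v"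
        using mult_mat_vec_carrier[OF dims(3) v] by (intro bexI[of _ "mH1 *\<^sub>v v"]) (simp_all add: lengths)
    next
      assume "\<exists>w\<in>carrier_vec (length X15). mD1 *\<^sub>v w = v"
      then obtain w where w: "w \<in> carrier_vec 15" "v = mD1 *\<^sub>v w" by (auto simp: lengths)
      have "B *\<^sub>v v = 0\<^sub>m 21 15 *\<^sub>v w"
        unfolding w(2) BD1[symmetric] by (rule assoc_mult_mat_vec[OF B dims(1) w(1), symmetric])
      then show "B *\<^sub>v v = 0\<^sub>v (fst F)" using w(1) F(1) by (auto intro!: eq_vecI simp: scalar_prod_def)
    qed
  qed
  have "\<exists>A. short_exact ?G (chevalley_J ?G H) A P_lat B F"
    by (rule chevalley_short_exact_orbit[OF alt_group_is_group orbit_acts(2)[OF orbits(1)] X_distinct(1) x(1)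
          orbit_acts(3)[OF orbits(1) x(1)] x(2) Pl F(2) hom_D1 homB surj exact, of mH1 q])
      (use dims q h1 matrix_identities(1) in \<open>simp_all add: lengths\<close>)
  then obtain A where A: "short_exact ?G (chevalley_J ?G H) A P_lat B F" by blast
  obtain y where y: "y \<in> set X20" using lengths by (auto simp: X20_def R20_def C5_list_def lprod_def V4_list_def)
  have permP: "perm_lattice ?G P_lat"
    unfolding perm_lattice_def
    using Pl P_lat_iso[OF x(1) y] orbit_coset_lat(3)[OF orbits(1) X_distinct(1) x(1)]
      orbit_coset_lat(3)[OF orbits(2) X_distinct(2) y]
    by (intro conjI exI[of _ "[stab x, stab y]"]) auto
  have flabby: "flabby ?G F"
    by (rule flabby_retract[OF alt_group_is_group finite_alt5 acts_on_Q Q_distinct(1) F(2) hi hr])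
      (simp add: ri F)
  have trivl: "G_lattice ?G lat_triv" by (simp add: G_lattice_def lat_triv_def)
  have sum_l: "G_lattice ?G (lat_dsum lat_triv F)" by (rule G_lattice_dsum[OF trivl F(2) alt_group_is_group])
  have iso: "lat_iso ?G (lat_dsum (coset_lat ?G C) (lat_dsum (coset_lat ?G A4) (coset_lat ?G A4))) (lat_dsum lat_triv F)"
    if C: "subgroup C ?G" "?G\<lparr>carrier := C\<rparr> \<cong> integer_mod_group 5"
      and A4: "subgroup A4 ?G" "?G\<lparr>carrier := A4\<rparr> \<cong> alt_group 4" for C A4
  proof -
    obtain a where a: "a \<in> set X12" "C = stab a" using cyclic5_subgroup_stab[OF C] by blast
    \<comment> \<open>The same subgroup is recognized in both encodings of the five-point action,
      which accounts for the two copies of its coset lattice.\<close>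
    obtain b c where b: "b \<in> set X5" "A4 = stab b" and c: "c \<in> set X5'" "A4 = stab c"
      using alt4_subgroup_stab[OF A4] by blast
    have "lat_iso ?G Q_lat (lat_dsum (coset_lat ?G C) (lat_dsum (coset_lat ?G A4) (coset_lat ?G A4)))"
      using Q_lat_iso[OF a(1) b(1) c(1)] a(2) b(2) c(2) by simp
    moreover have "G_lattice ?G (coset_lat ?G C)" "G_lattice ?G (coset_lat ?G A4)"
      using orbit_coset_lat(2)[OF orbits(3) X_distinct(3) a(1)] orbit_coset_lat(2)[OF orbits(4) X_distinct(4) b(1)]
        a(2) b(2) by simp_all
    ultimately show ?thesis
      using lat_iso_trans[OF lat_iso_sym isoF] G_lattice_dsum alt_group_is_group Ql sum_l by blast
  qed
  have permT: "perm_lattice ?G lat_triv"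
    by (rule perm_lattice_single[OF trivl subgroup_self lat_triv_coset alt_group_is_group])
      (rule alt_group_is_group)+
  \<comment> \<open>Adding the trivial lattice turns \<open>F\<close> into the permutation lattice
    of rank 22.\<close>
  have "lat_iso ?G (lat_dsum F lat_triv) Q_lat"
    by (rule lat_iso_trans[OF lat_dsum_comm[OF F(2) trivl] lat_iso_sym[OF isoF]
          G_lattice_dsum[OF F(2) trivl alt_group_is_group] sum_l Ql])
  then have "stably_perm ?G F" unfolding stably_perm_def using permT Q_lat_perm by blast
  then show ?thesis
    using A permP flabby F(1) iso unfolding flabby_resolution_def by blast
qed

end
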